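(* Let $n\geq2$, $d\geq1$, let $\Omega\subset\mathbb{R}^n$ be open, and suppose $f\in W^{1,n}(\Omega;\mathbb{R}^d)$ is continuous. Let $0\leq\lambda\leq n-1$ and $\alpha=1-\frac{\lambda}{n-1}$. If $$\int_\Omega |Df|^n\log^\lambda(e+|Df|)\,dy<\infty,$$ then there exists a set $E\subset\Omega$ such that $f$ satisfies Luzin's condition (N) in $\Omega\setminus E$, and $\mathcal{H}^\varphi(E)=0$ for every gauge function $\varphi$ which for some $\gamma>0$ satisfies $$\varphi(r)=\begin{cases}\exp\bigl(-\gamma\log^{\alpha}(\tfrac1r)\bigr), & \alpha>0,\\ \log^{-n-\gamma}(\tfrac1r), & \alpha=0,\end{cases}\qquad 0<r<1.$$
   Context: A gauge function is a nondecreasing function $h:[0,\infty]\to[0,\infty]$, positive on $(0,\infty]$ and right-continuous. For a gauge function $h$ and $A\subset\mathbb{R}^n$, $\mathcal{H}^h_\delta(A)=\inf\{\sum_j h(\operatorname{diam}C_j): A\subset\bigcup_j C_j,\ \operatorname{diam}C_j\leq\delta\}$ and $\mathcal{H}^h(A)=\lim_{\delta\to0}\mathcal{H}^h_\delta(A)$; $\mathcal{H}^n$ is the case $h(t)=t^n$ (taken in $\mathbb{R}^d$ for images). A map $f$ satisfies Luzin's condition (N) in a set $S$ if $\mathcal{H}^n(f(Z))=0$ for every $Z\subset S$ of zero $n$-dimensional Lebesgue measure. *)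

theory Defs
  imports "HOL-Analysis.Analysis"
begin

text \<open>A gauge function: nondecreasing on [0,oo), positive on (0,oo), right-continuous.
  Values are taken in [0,oo] (ennreal).  The value at the point oo plays no role,
  since only sets of diameter at most delta enter the definition below.\<close>
definition gauge_fun :: "(real \<Rightarrow> ennreal) \<Rightarrow> bool" where
  "gauge_fun h \<longleftrightarrow> mono_on {0..} h \<and> (\<forall>t>0. h t > 0) \<and>
     (\<forall>t\<ge>0. (h \<longlongrightarrow> h t) (at_right t))"

definition hausdorff_delta :: "(real \<Rightarrow> ennreal) \<Rightarrow> real \<Rightarrow> 'a::metric_space set \<Rightarrow> ennreal" where
  "hausdorff_delta h \<delta> A =
     (INF C \<in> {C :: nat \<Rightarrow> 'a set. A \<subseteq> (\<Union>j. C j) \<and> (\<forall>j. bounded (C j) \<and> diameter (C j) \<le> \<delta>)}.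
        (\<Sum>j. h (diameter (C j))))"

text \<open>H^h(A) = lim_{delta -> 0} H^h_delta(A); the limit is the supremum since
  H^h_delta is nonincreasing in delta.\<close>
definition hausdorff_gauge :: "(real \<Rightarrow> ennreal) \<Rightarrow> 'a::metric_space set \<Rightarrow> ennreal" where
  "hausdorff_gauge h A = (SUP \<delta> \<in> {0<..}. hausdorff_delta h \<delta> A)"

definition luzin_N :: "('a::euclidean_space \<Rightarrow> 'b::euclidean_space) \<Rightarrow> 'a set \<Rightarrow> bool" where
  "luzin_N f S \<longleftrightarrow> (\<forall>Z. Z \<subseteq> S \<longrightarrow> Z \<in> null_sets lebesgue \<longrightarrow>
       hausdorff_gauge (\<lambda>t. ennreal (t ^ DIM('a))) (f ` Z) = 0)"

coinductive smooth_fun :: "(real^'n \<Rightarrow> real) \<Rightarrow> bool" where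
  "\<lbrakk>\<forall>x. \<psi> differentiable (at x);
    \<forall>i. smooth_fun (\<lambda>x. frechet_derivative \<psi> (at x) (axis i 1))\<rbrakk> \<Longrightarrow> smooth_fun \<psi>"

definition partial_deriv :: "'n \<Rightarrow> (real^'n \<Rightarrow> real) \<Rightarrow> real^'n \<Rightarrow> real" where
  "partial_deriv i \<psi> x = frechet_derivative \<psi> (at x) (axis i 1)"

definition test_fun :: "(real^'n) set \<Rightarrow> (real^'n \<Rightarrow> real) \<Rightarrow> bool" where
  "test_fun \<Omega> \<psi> \<longleftrightarrow> smooth_fun \<psi> \<and> compact (closure {x. \<psi> x \<noteq> 0}) \<and>
     closure {x. \<psi> x \<noteq> 0} \<subseteq> \<Omega>"

definition Lp_on :: "real \<Rightarrow> (real^'n) set \<Rightarrow> (real^'n \<Rightarrow> real^'d) \<Rightarrow> bool" where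
  "Lp_on p \<Omega> u \<longleftrightarrow> set_borel_measurable lebesgue \<Omega> u \<and>
     set_integrable lebesgue \<Omega> (\<lambda>x. norm (u x) powr p)"

definition weak_partial :: "(real^'n) set \<Rightarrow> 'n \<Rightarrow> (real^'n \<Rightarrow> real^'d) \<Rightarrow> (real^'n \<Rightarrow> real^'d) \<Rightarrow> bool" where
  "weak_partial \<Omega> i u v \<longleftrightarrow> (\<forall>\<psi>. test_fun \<Omega> \<psi> \<longrightarrow>
      (\<integral>x\<in>\<Omega>. partial_deriv i \<psi> x *\<^sub>R u x \<partial>lebesgue) = - (\<integral>x\<in>\<Omega>. \<psi> x *\<^sub>R v x \<partial>lebesgue))"

definition sobolev_W1p :: "real \<Rightarrow> (real^'n) set \<Rightarrow> (real^'n \<Rightarrow> real^'d) \<Rightarrow> ('n \<Rightarrow> real^'n \<Rightarrow> real^'d) \<Rightarrow> bool" where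
  "sobolev_W1p p \<Omega> u g \<longleftrightarrow> Lp_on p \<Omega> u \<and> (\<forall>i. Lp_on p \<Omega> (g i) \<and> weak_partial \<Omega> i u (g i))"

definition weak_grad_norm :: "('n::finite \<Rightarrow> real^'n \<Rightarrow> real^'d) \<Rightarrow> real^'n \<Rightarrow> real" where
  "weak_grad_norm g x = sqrt (\<Sum>i\<in>UNIV. (norm (g i x))\<^sup>2)"

end

theory Submission
  imports Defs
begin

text \<open>Let \<open>G \<ge> 1\<close> be a Borel majorant of \<open>|Df|\<close>, let \<open>\<rho> = G\<^sup>n log\<^sup>\<lambda>(e + G)\<close>, and let \<open>\<mu>\<close> and \<open>\<nu>\<close> have the densities
  \<open>G\<close> and \<open>\<rho>\<close>. A point is good if \<open>\<nu>(B(z, r))\<close> decays, along \<open>r = 1/2\<^sup>m\<close>, at least as fast as the gauge allows;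
  by a Vitali covering, the set \<open>E\<close> of the other points is null for all the gauges in question.
  On a null set \<open>Z\<close> of good points the oscillation of \<open>f\<close> is bounded by the Riesz potential \<open>\<Sum>\<^sub>m r\<^sup>1\<^sup>-\<^sup>n \<mu>(B(z, r))\<close>. The
  balls \<open>B(z, r)\<close> with a non-negligible share of this potential give target balls around \<open>f z\<close>, and the shares
  along the scales \<open>m \<ge> N\<close> add up to a fractional covering of \<open>f(Z)\<close> of weight proportional to \<open>N\<close>.
  The logarithm in \<open>\<rho>\<close> keeps the sum over the scales of \<open>r\<^sup>1\<^sup>-\<^sup>n \<mu>(B(z, r)) / \<nu>(B(z, r))\<^sup>1\<^sup>/\<^sup>n\<close> of order \<open>N\<close> until
  the decay sets in, so that the covering costs \<open>O(\<nu>(U))\<close> per unit of weight for every open \<open>U \<supseteq> Z\<close>,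
  and \<open>\<nu>(U)\<close> can be made arbitrarily small.\<close>

section \<open>Hausdorff measures and fractional coverings\<close>

text \<open>The obstacle is overlap. If each point were covered at one scale where the tail
  \<open>T m z\<close> of the potential is comparable with \<open>v m z\<close>, the n-th root of
  the local energy, a target ball would cost about the energy of a source ball. But disjointness can
  be arranged only among the target balls: the source balls overlap, and since the number
  \<open>L\<close> of scales may be exponential in \<open>N\<close>, the same energy could be paid
  for about \<open>L\<close> times. Using all scales with weights repairs this. A ball of radius
  \<rho> of order at most \<open>v\<close> and weight \<open>A / \<rho>\<close> costs
  \<open>A * \<rho> ^ (n - 1)\<close>, that is, up to constants, at most \<open>A / v\<close> times
  its energy; so the overlap is measured by the sum of \<open>A / v\<close> over the scales, not by
  their number. This sum is at most of order \<open>N\<close>, and the total weight at each target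
  point is at least of order \<open>N\<close>, so that \<open>N\<close> cancels. The damping factors
  are tuned to each other: per scale \<open>v\<close> loses at most 2^8 and \<open>A\<close> at most
  2^9, so \<open>A / v\<close> inherits at most half of its previous value; and the factor 2^(8n) in
  the energy outweighs the growth of the number of lattice points.\<close>

lemma hausdorff_delta_le_suminf:
  assumes "A \<subseteq> (\<Union>j. C j)" "\<And>j::nat. bounded (C j)" "\<And>j. diameter (C j) \<le> \<delta>"
  shows "hausdorff_delta h \<delta> A \<le> (\<Sum>j. h (diameter (C j)))"
  unfolding hausdorff_delta_def by (rule INF_lower) (use assms in auto)

lemma hausdorff_delta_mono:
  assumes "A \<subseteq> B"
  shows "hausdorff_delta h \<delta> A \<le> hausdorff_delta h \<delta> B"
  unfolding hausdorff_delta_def by (rule INF_superset_mono) (use assms in auto)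

lemma hausdorff_delta_countable_subadditive:
  fixes A :: "nat \<Rightarrow> 'a::metric_space set"
  shows "hausdorff_delta h \<delta> (\<Union>i. A i) \<le> (\<Sum>i. hausdorff_delta h \<delta> (A i))"
proof (cases "(\<Sum>i. hausdorff_delta h \<delta> (A i)) = \<infinity>")
  case True
  then show ?thesis by simp
next
  case False
  have fin: "hausdorff_delta h \<delta> (A i) < \<infinity>" for i
    using False by (metis ennreal_suminf_lessD infinity_ennreal_def top.not_eq_extremum)
  show ?thesis
  proof (rule ennreal_le_epsilon)
    fix e :: real
    assume "0 < e"
    have "\<exists>C. A i \<subseteq> (\<Union>j. C j) \<and> (\<forall>j::nat. bounded (C j) \<and> diameter (C j) \<le> \<delta>) \<and>
        (\<Sum>j. h (diameter (C j))) < hausdorff_delta h \<delta> (A i) + ennreal (e * (1/2)^Suc i)" for i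
    proof -
      have "hausdorff_delta h \<delta> (A i) < hausdorff_delta h \<delta> (A i) + ennreal (e * (1/2)^Suc i)"
        using fin[of i] \<open>0 < e\<close>
        by (metis add.right_neutral ennreal_add_left_cancel_less ennreal_eq_0_iff infinity_ennreal_def
            less_irrefl linorder_not_le mult_pos_pos not_gr_zero zero_less_divide_1_iff zero_less_numeral
            zero_less_power)
      then show ?thesis
        unfolding hausdorff_delta_def by (subst (asm) INF_less_iff) blast
    qed
    then obtain C where C: "\<And>i. A i \<subseteq> (\<Union>j. C i j)"
        "\<And>i j. bounded (C i j)" "\<And>i (j::nat). diameter (C i j) \<le> \<delta>"
        "\<And>i. (\<Sum>j. h (diameter (C i j))) \<le> hausdorff_delta h \<delta> (A i) + ennreal (e * (1/2)^Suc i)"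
      by (metis less_imp_le)
    define D where "D k = (case prod_decode k of (i, j) \<Rightarrow> C i j)" for k
    have "hausdorff_delta h \<delta> (\<Union>i. A i) \<le> (\<Sum>k. h (diameter (D k)))"
    proof (rule hausdorff_delta_le_suminf)
      show "(\<Union>i. A i) \<subseteq> (\<Union>k. D k)"
      proof
        fix x assume "x \<in> (\<Union>i. A i)"
        then obtain i j where "x \<in> C i j" using C(1) by blast
        then have "x \<in> D (prod_encode (i, j))" by (simp add: D_def)
        then show "x \<in> (\<Union>k. D k)" by blast
      qed
    qed (use C in \<open>auto simp: D_def split: prod.split\<close>)
    also have "\<dots> = (\<Sum>i. \<Sum>j. h (diameter (C i j)))"
    proof -
      have "(\<lambda>k. h (diameter (D k))) = (\<lambda>k. (\<lambda>(i, j). h (diameter (C i j))) (prod_decode k))"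
        by (simp add: D_def fun_eq_iff split: prod.split)
      then show ?thesis
        using suminf_ennreal_2dimen[where g="\<lambda>i. \<Sum>j. h (diameter (C i j))"
            and f="\<lambda>(i, j). h (diameter (C i j))"] by auto
    qed
    also have "\<dots> \<le> (\<Sum>i. hausdorff_delta h \<delta> (A i) + ennreal (e * (1/2)^Suc i))"
      by (intro suminf_le C(4)) auto
    also have "\<dots> = (\<Sum>i. hausdorff_delta h \<delta> (A i)) + (\<Sum>i. ennreal (e * (1/2)^Suc i))"
      by (rule suminf_add[symmetric]) auto
    also have "(\<Sum>i. ennreal (e * (1/2)^Suc i)) = ennreal e"
    proof -
      have "(\<lambda>i. e * (1/2)^Suc i) sums (e * 1)"
        by (intro sums_mult power_half_series)
      then show ?thesis
        using \<open>0 < e\<close> by (subst suminf_ennreal_eq[where x=e]) auto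
    qed
    finally show "hausdorff_delta h \<delta> (\<Union>i. A i) \<le> (\<Sum>i. hausdorff_delta h \<delta> (A i)) + ennreal e" .
  qed
qed

lemma hausdorff_gauge_eq_0_iff:
  "hausdorff_gauge h A = 0 \<longleftrightarrow> (\<forall>\<delta>>0. hausdorff_delta h \<delta> A = 0)"
  unfolding hausdorff_gauge_def by (auto simp: SUP_eq_iff bot_ennreal[symmetric])

lemma hausdorff_gauge_UN_eq_0:
  fixes A :: "nat \<Rightarrow> 'a::metric_space set"
  assumes "B \<subseteq> (\<Union>i. A i)" "\<And>i. hausdorff_gauge h (A i) = 0"
  shows "hausdorff_gauge h B = 0"
  unfolding hausdorff_gauge_eq_0_iff
proof (intro allI impI)
  fix \<delta> :: real assume "\<delta> > 0"
  have "hausdorff_delta h \<delta> B \<le> hausdorff_delta h \<delta> (\<Union>i. A i)"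
    by (rule hausdorff_delta_mono) fact
  also have "\<dots> \<le> (\<Sum>i. hausdorff_delta h \<delta> (A i))"
    by (rule hausdorff_delta_countable_subadditive)
  also have "\<dots> = 0"
    using assms(2) \<open>\<delta> > 0\<close> by (simp add: hausdorff_gauge_eq_0_iff)
  finally show "hausdorff_delta h \<delta> B = 0" by simp
qed

lemma hausdorff_delta_countable_cover:
  assumes I: "countable I" and A: "A \<subseteq> (\<Union>i\<in>I. D i)" and h0: "h 0 = 0" and \<delta>: "\<delta> \<ge> 0"
    and D: "\<And>i. i \<in> I \<Longrightarrow> bounded (D i)" "\<And>i. i \<in> I \<Longrightarrow> diameter (D i) \<le> \<delta>"
  shows "hausdorff_delta h \<delta> A \<le> (\<integral>\<^sup>+i. h (diameter (D i)) \<partial>count_space I)"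
proof -
  define C where "C j = (if j \<in> to_nat_on I ` I then D (inv_into I (to_nat_on I) j) else {})" for j
  have inj: "inj_on (to_nat_on I) I" using I by (rule inj_on_to_nat_on)
  have C: "C (to_nat_on I i) = D i" if "i \<in> I" for i
    using that inj by (simp add: C_def)
  have "hausdorff_delta h \<delta> A \<le> (\<Sum>j. h (diameter (C j)))"
  proof (rule hausdorff_delta_le_suminf)
    show "A \<subseteq> (\<Union>j. C j)" using A C by fastforce
  qed (use D \<delta> in \<open>auto simp: C_def inv_into_into\<close>)
  also have "\<dots> = (\<integral>\<^sup>+j. h (diameter (C j)) \<partial>count_space UNIV)"
    by (simp add: nn_integral_count_space_nat)
  also have "\<dots> = (\<integral>\<^sup>+j. h (diameter (C j)) \<partial>count_space (to_nat_on I ` I))"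
    by (subst nn_integral_count_space_indicator)
      (auto intro!: nn_integral_cong simp: C_def h0 split: split_indicator)
  also have "\<dots> = (\<integral>\<^sup>+i. h (diameter (C (to_nat_on I i))) \<partial>count_space I)"
    by (rule nn_integral_bij_count_space[symmetric]) (use inj in \<open>simp add: inj_on_imp_bij_betw\<close>)
  also have "\<dots> = (\<integral>\<^sup>+i. h (diameter (D i)) \<partial>count_space I)"
    by (intro nn_integral_cong) (simp add: C)
  finally show ?thesis .
qed

text \<open>An integer cover is extracted from a fractional one: peel off the largest common weight of a
  disjoint Vitali subfamily. Since the peeled balls are disjoint, every point loses at most that weight,
  and the subfamilies met on the way are covers whose average cost is at most the fractional cost.\<close>
lemma weighted_Vitali_covering:
  fixes a :: "'i \<Rightarrow> 'b::euclidean_space" and \<omega> r c :: "'i \<Rightarrow> real"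
  assumes "finite I" "\<And>i. i \<in> I \<Longrightarrow> \<omega> i \<ge> 0" "\<And>i. i \<in> I \<Longrightarrow> c i \<ge> 0" "W > 0" "\<And>i. i \<in> I \<Longrightarrow> r i > 0"
    and "\<And>y. y \<in> S \<Longrightarrow> (\<Sum>i\<in>{i\<in>I. y \<in> ball (a i) (r i)}. \<omega> i) \<ge> W"
  shows "\<exists>C\<subseteq>I. S \<subseteq> (\<Union>i\<in>C. ball (a i) (5 * r i)) \<and> W * sum c C \<le> (\<Sum>i\<in>I. \<omega> i * c i)"
  using assms
proof (induction "card {i\<in>I. \<omega> i > 0}" arbitrary: \<omega> W rule: less_induct)
  case less
  define K where "K = {i\<in>I. \<omega> i > 0}"
  have K: "finite K" "K \<subseteq> I" using less.prems by (auto simp: K_def)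
  have "S \<subseteq> (\<Union>i\<in>K. ball (a i) (r i))"
  proof
    fix y assume y: "y \<in> S"
    show "y \<in> (\<Union>i\<in>K. ball (a i) (r i))"
    proof (rule ccontr)
      assume "y \<notin> (\<Union>i\<in>K. ball (a i) (r i))"
      then have "(\<Sum>i\<in>{i\<in>I. y \<in> ball (a i) (r i)}. \<omega> i) \<le> 0"
        by (intro sum_nonpos) (force simp: K_def)
      then show False using less.prems(4) less.prems(6)[OF y] by linarith
    qed
  qed
  moreover have "0 < r i \<and> r i \<le> Max (r ` K)" if "i \<in> K" for i
    using less.prems(5) K that by auto
  ultimately have "\<exists>C. C \<subseteq> K \<and> pairwise (\<lambda>i j. disjnt (ball (a i) (r i)) (ball (a j) (r j))) C
      \<and> S \<subseteq> (\<Union>i\<in>C. ball (a i) (5 * r i))"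
    by (rule Vitali_covering_lemma_balls[where S=S and K=K and a=a and r=r and B="Max (r ` K)"]) blast+
  then obtain C where C: "C \<subseteq> K"
    "pairwise (\<lambda>i j. disjnt (ball (a i) (r i)) (ball (a j) (r j))) C"
    "S \<subseteq> (\<Union>i\<in>C. ball (a i) (5 * r i))"
    by blast
  have finC: "finite C" and CI: "C \<subseteq> I" using C K finite_subset by auto
  have tot0: "(\<Sum>i\<in>I. \<omega> i * c i) \<ge> 0" using less.prems by (intro sum_nonneg) auto
  show ?case
  proof (cases "C = {}")
    case True
    then show ?thesis using C tot0 by (intro exI[of _ "{}"]) auto
  next
    case False
    define t where "t = Min (\<omega> ` C)"
    have t: "\<And>i. i \<in> C \<Longrightarrow> t \<le> \<omega> i" "t > 0"
      using finC False C(1) by (auto simp: t_def K_def)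
    have split: "(\<Sum>i\<in>I. (\<omega> i - (if i \<in> C then t else 0)) * c i) = (\<Sum>i\<in>I. \<omega> i * c i) - t * sum c C"
    proof -
      have "(\<Sum>i\<in>I. (if i \<in> C then t else 0) * c i) = (\<Sum>i\<in>C. t * c i)"
        by (rule sum.mono_neutral_cong_right) (use less.prems(1) CI in auto)
      then show ?thesis by (simp add: left_diff_distrib sum_subtractf sum_distrib_left)
    qed
    show ?thesis
    proof (cases "W \<le> t")
      case True
      have "0 \<le> (\<Sum>i\<in>I. (\<omega> i - (if i \<in> C then t else 0)) * c i)"
        using t less.prems by (intro sum_nonneg) auto
      then have "t * sum c C \<le> (\<Sum>i\<in>I. \<omega> i * c i)" using split by simp
      moreover have "W * sum c C \<le> t * sum c C"
        using True less.prems CI by (intro mult_right_mono sum_nonneg) auto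
      ultimately show ?thesis using C(3) CI by (intro exI[of _ C]) auto
    next
      case False
      define \<omega>' where "\<omega>' i = \<omega> i - (if i \<in> C then t else 0)" for i
      obtain i0 where i0: "i0 \<in> C" "\<omega> i0 = t"
        using Min_in[of "\<omega> ` C"] finC \<open>C \<noteq> {}\<close> unfolding t_def[symmetric] by auto
      have nn: "\<omega>' i \<ge> 0" if "i \<in> I" for i
        using that t less.prems(2) by (auto simp: \<omega>'_def)
      \<comment> \<open>An index attaining the minimum \<open>t\<close> loses its whole weight, so
        the number of indices of positive weight drops; this drives the induction.\<close>
      have "{i\<in>I. \<omega>' i > 0} \<subset> K"
      proof
        show "{i\<in>I. \<omega>' i > 0} \<subseteq> K" using t(2) by (auto simp: \<omega>'_def K_def split: if_splits)
        have "i0 \<in> K" "\<not> \<omega>' i0 > 0" using i0 C by (auto simp: \<omega>'_def)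
        then show "{i\<in>I. \<omega>' i > 0} \<noteq> K" by blast
      qed
      then have lt: "card {i\<in>I. \<omega>' i > 0} < card {i\<in>I. \<omega> i > 0}"
        using K(1) unfolding K_def by (rule psubset_card_mono[rotated])
      have cov: "(\<Sum>i\<in>{i\<in>I. y \<in> ball (a i) (r i)}. \<omega>' i) \<ge> W - t" if y: "y \<in> S" for y
      proof -
        let ?J = "{i\<in>I. y \<in> ball (a i) (r i)}"
        have "card (C \<inter> ?J) \<le> Suc 0"
        proof (subst card_le_Suc0_iff_eq)
          show "\<forall>i\<in>C \<inter> ?J. \<forall>j\<in>C \<inter> ?J. i = j"
            using C(2) unfolding pairwise_def disjnt_def by blast
        qed (use finC in auto)
        then have "(\<Sum>i\<in>?J. if i \<in> C then t else 0) \<le> t"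
          using t(2) less.prems(1) by (simp add: sum.If_cases Int_commute Int_def)
        then show ?thesis using less.prems(6)[OF y]
          by (simp add: \<omega>'_def sum_subtractf)
      qed
      have "W - t > 0" using False by simp
      from less.hyps[OF lt less.prems(1) nn less.prems(3) this less.prems(5) cov]
      obtain C' where C': "C' \<subseteq> I" "S \<subseteq> (\<Union>i\<in>C'. ball (a i) (5 * r i))"
        "(W - t) * sum c C' \<le> (\<Sum>i\<in>I. \<omega>' i * c i)" by blast
      \<comment> \<open>The share \<open>t\<close> of the weight is spent on \<open>C\<close> and
        the share \<open>W - t\<close> on \<open>C'\<close>. The cheaper of the two covers costs at
        most this weighted average.\<close>
      have *: "t * sum c C + (W - t) * sum c C' \<le> (\<Sum>i\<in>I. \<omega> i * c i)"
        using C'(3) split by (simp add: \<omega>'_def)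
      show ?thesis
      proof (cases "sum c C \<le> sum c C'")
        case True
        then have "W * sum c C \<le> t * sum c C + (W - t) * sum c C"
          by (simp add: algebra_simps)
        also have "\<dots> \<le> t * sum c C + (W - t) * sum c C'"
          using True \<open>W - t > 0\<close> by (simp add: mult_left_mono)
        finally show ?thesis using * C(3) CI by (intro exI[of _ C]) auto
      next
        case False
        then have "W * sum c C' \<le> t * sum c C' + (W - t) * sum c C'"
          by (simp add: algebra_simps)
        also have "\<dots> \<le> t * sum c C + (W - t) * sum c C'"
          using False t(2) by (simp add: mult_left_mono)
        finally show ?thesis using * C' by (intro exI[of _ C']) auto
      qed
    qed
  qed
qed

section \<open>Mass and energy on dyadic scales\<close>

text \<open>Scale 0 is the whole space: the recursions below then start from total masses, which are
  the same at all points.\<close>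

definition dyadic_ball :: "nat \<Rightarrow> real^'n \<Rightarrow> (real^'n) set" where
  "dyadic_ball m x = (if m = 0 then UNIV else ball x ((1/2)^m))"

definition scaled_mass :: "(real^'n) measure \<Rightarrow> nat \<Rightarrow> real^'n \<Rightarrow> real" where
  "scaled_mass \<mu> m x = 2 ^ (m * (CARD('n) - 1)) * measure \<mu> (dyadic_ball m x)"

text \<open>Adding a geometric trace of the coarser scales makes mass and energy comparable between neighbouring
  scales and nearby points, in both directions.\<close>
fun reg_mass :: "(real^'n) measure \<Rightarrow> nat \<Rightarrow> real^'n \<Rightarrow> real" where
  "reg_mass \<mu> 0 x = scaled_mass \<mu> 0 x"
| "reg_mass \<mu> (Suc m) x = scaled_mass \<mu> (Suc m) x + reg_mass \<mu> m x / 2^9"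

fun reg_energy :: "(real^'n) measure \<Rightarrow> nat \<Rightarrow> real^'n \<Rightarrow> real" where
  "reg_energy \<nu> 0 x = 2 * measure \<nu> UNIV"
| "reg_energy \<nu> (Suc m) x =
     measure \<nu> (dyadic_ball (Suc m) x) + reg_energy \<nu> m x / 2 ^ (8 * CARD('n))"

lemma sets_dyadic_ball [simp, measurable]: "dyadic_ball m x \<in> sets borel"
  by (simp add: dyadic_ball_def)

lemma dyadic_ball_0 [simp]: "dyadic_ball 0 x = UNIV"
  by (simp add: dyadic_ball_def)

lemma dyadic_ball_shift:
  assumes "dist x y \<le> (1/2)^Suc m"
  shows "dyadic_ball (Suc m) x \<subseteq> dyadic_ball m y"
proof (cases "m = 0")
  case False
  have "dist y z < (1/2)^m" if "dist x z < (1/2)^Suc m" for z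
    using that assms dist_triangle[of y z x] by (simp add: dist_commute)
  then show ?thesis using False by (auto simp: dyadic_ball_def)
qed simp

lemma dyadic_ball_Suc: "dyadic_ball (Suc m) x \<subseteq> dyadic_ball m x"
  by (rule dyadic_ball_shift) simp

lemma dist_dyadic_ball: "m \<ge> 1 \<Longrightarrow> y \<in> dyadic_ball m x \<Longrightarrow> dist x y \<le> (1/2)^m"
  by (simp add: dyadic_ball_def)

text \<open>The assumptions isolate what the covering argument needs from the densities.
  \<open>mass_le\<close> is the Hoelder inequality with a free parameter \<open>s\<close>; choosing
  \<open>s\<close> as the n-th root of the energy balances its two terms. \<open>annulus_le\<close>
  is the same inequality with a logarithmic gain \<open>w m\<close>; the summand
  \<open>(1 / sqrt 2) ^ m\<close> is left over from the places where the density is too small to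
  have a large logarithm. The bound 1/2 on the total energy makes all values of \<open>V\<close> at
  most 1.\<close>

locale mass_energy =
  fixes \<mu> \<nu> :: "(real^'n) measure" and w :: "nat \<Rightarrow> real" and K :: real
  assumes n2: "CARD('n) \<ge> 2"
    and fin_mu: "finite_measure \<mu>" and fin_nu: "finite_measure \<nu>"
    and sets_mu [simp]: "sets \<mu> = sets borel" and sets_nu [simp]: "sets \<nu> = sets borel"
    and mu_pos: "measure \<mu> UNIV > 0"
    and nu_pos: "measure \<nu> UNIV > 0" and nu_le: "measure \<nu> UNIV \<le> 1/2"
    and w_pos: "\<And>m. m \<ge> 1 \<Longrightarrow> w m > 0"
    and K1: "K \<ge> 1"
    and mass_le: "\<And>m x s. s > 0 \<Longrightarrow>
      scaled_mass \<mu> m x \<le> K * (s + measure \<nu> (dyadic_ball m x) / s ^ (CARD('n) - 1))"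
    and annulus_le: "\<And>m x s. m \<ge> 1 \<Longrightarrow> s > 0 \<Longrightarrow>
      2 ^ (m * (CARD('n) - 1)) * measure \<mu> (dyadic_ball m x - dyadic_ball (Suc m) x)
      \<le> K * ((1 / sqrt 2) ^ m + s + w m ^ (CARD('n) - 1) *
          measure \<nu> (dyadic_ball m x - dyadic_ball (Suc m) x) / s ^ (CARD('n) - 1))"
begin

sublocale mu: finite_measure \<mu> by (rule fin_mu)
sublocale nu: finite_measure \<nu> by (rule fin_nu)

abbreviation \<alpha> where "\<alpha> \<equiv> scaled_mass \<mu>"
abbreviation A where "A \<equiv> reg_mass \<mu>"
abbreviation V where "V \<equiv> reg_energy \<nu>"
definition "v m x = root CARD('n) (V m x)"
definition ann :: "nat \<Rightarrow> real^'n \<Rightarrow> (real^'n) set" where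
  "ann m x = dyadic_ball m x - dyadic_ball (Suc m) x"

lemma n_pos [simp]: "0 < CARD('n)" by (simp add: card_gt_0_iff)

lemma alpha_nonneg: "\<alpha> m x \<ge> 0"
  by (simp add: scaled_mass_def)

lemma A_pos: "A m x > 0"
proof (induction m)
  case 0
  then show ?case using mu_pos by (simp add: scaled_mass_def)
next
  case (Suc m)
  then show ?case using alpha_nonneg[of "Suc m" x] by (simp add: add_nonneg_pos)
qed

lemma A_ge_alpha: "\<alpha> m x \<le> A m x"
  by (cases m) (use A_pos[of _ x] in \<open>auto simp: less_imp_le\<close>)

lemma V_pos: "V m x > 0"
  by (induction m) (use nu_pos in \<open>auto intro: add_nonneg_pos\<close>)

lemma V_0_le: "V 0 x \<le> 1"
  using nu_le by simp

lemma V_Suc_ge: "V m x \<le> 2 ^ (8 * CARD('n)) * V (Suc m) x"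
  by (simp add: field_simps)

lemma nu_ann: "measure \<nu> (ann m x) = measure \<nu> (dyadic_ball m x) - measure \<nu> (dyadic_ball (Suc m) x)"
  unfolding ann_def by (rule nu.finite_measure_Diff) (auto intro: dyadic_ball_Suc[THEN subsetD])

lemma mu_ann: "measure \<mu> (ann m x) = measure \<mu> (dyadic_ball m x) - measure \<mu> (dyadic_ball (Suc m) x)"
  unfolding ann_def by (rule mu.finite_measure_Diff) (auto intro: dyadic_ball_Suc[THEN subsetD])

text \<open>The trace inherited from coarser scales shrinks along with \<open>V\<close>, so
  \<open>V\<close> loses at least the energy of the annulus. Divided by \<open>V\<close>, the
  annulus energies then become differences of logarithms, which telescope.\<close>

lemma V_drop: "V (Suc m) x + measure \<nu> (ann m x) \<le> V m x"
proof (induction m)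
  case 0
  \<comment> \<open>\<open>V 0\<close> starts from twice the total energy: the second copy pays for
    the trace that \<open>V 1\<close> inherits.\<close>
  have "4 * (measure \<nu> UNIV :: real) \<le> 2 ^ (8 * CARD('n)) * measure \<nu> UNIV"
    using power_increasing[of 2 "8 * CARD('n)" "2::real"] n2 by (intro mult_right_mono) auto
  then show ?case using nu_pos by (simp add: nu_ann field_simps)
next
  case (Suc m)
  have "0 \<le> measure \<nu> (ann m x)" by simp
  with Suc have "V (Suc m) x \<le> V m x" by linarith
  then have "V (Suc m) x / 2 ^ (8 * CARD('n)) \<le> V m x / 2 ^ (8 * CARD('n))"
    by (intro divide_right_mono) auto
  moreover have "V (Suc (Suc m)) x = measure \<nu> (dyadic_ball (Suc (Suc m)) x) + V (Suc m) x / 2 ^ (8 * CARD('n))"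
    "V (Suc m) x = measure \<nu> (dyadic_ball (Suc m) x) + V m x / 2 ^ (8 * CARD('n))"
    by simp_all
  ultimately show ?case unfolding nu_ann by linarith
qed

lemma V_decreasing: "l \<le> m \<Longrightarrow> V m x \<le> V l x"
proof (induction m rule: dec_induct)
  case (step m)
  have "0 \<le> measure \<nu> (ann m x)" by simp
  then show ?case using V_drop[of m x] step by linarith
qed simp

lemma V_shift: "dist x y \<le> (1/2)^Suc m \<Longrightarrow> V (Suc m) x \<le> V m y"
proof (induction m)
  case 0
  have "V (Suc 0) x \<le> V 0 x" by (rule V_decreasing) simp
  also have "V 0 x = V 0 y" by simp
  finally show ?case .
next
  case (Suc m)
  have "dist x y \<le> (1/2)^Suc m"
    using Suc.prems by (rule order_trans) (simp add: field_simps)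
  then have "V (Suc m) x \<le> V m y" by (rule Suc.IH)
  then have "V (Suc m) x / 2 ^ (8 * CARD('n)) \<le> V m y / 2 ^ (8 * CARD('n))"
    by (intro divide_right_mono) auto
  moreover have "measure \<nu> (dyadic_ball (Suc (Suc m)) x) \<le> measure \<nu> (dyadic_ball (Suc m) y)"
    by (rule nu.finite_measure_mono) (use dyadic_ball_shift[OF Suc.prems] in auto)
  moreover have "V (Suc (Suc m)) x = measure \<nu> (dyadic_ball (Suc (Suc m)) x) + V (Suc m) x / 2 ^ (8 * CARD('n))"
    "V (Suc m) y = measure \<nu> (dyadic_ball (Suc m) y) + V m y / 2 ^ (8 * CARD('n))"
    by simp_all
  ultimately show ?case by linarith
qed

lemma A_shift: "dist x y \<le> (1/2)^Suc m \<Longrightarrow> A (Suc m) x \<le> 2 ^ CARD('n) * A m y"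
proof (induction m)
  case 0
  have "measure \<mu> (dyadic_ball (Suc 0) x) \<le> measure \<mu> UNIV"
    by (rule mu.finite_measure_mono) auto
  then have "2 ^ (CARD('n) - 1) * measure \<mu> (dyadic_ball (Suc 0) x) \<le> 2 ^ (CARD('n) - 1) * measure \<mu> UNIV"
    by (intro mult_left_mono) auto
  moreover have "measure \<mu> UNIV / 2^9 \<le> 2 ^ (CARD('n) - 1) * measure \<mu> UNIV"
  proof -
    have "(1::real) / 2^9 \<le> 2 ^ (CARD('n) - 1)"
      by (rule order_trans[OF _ one_le_power]) auto
    then have "1 / 2^9 * measure \<mu> UNIV \<le> 2 ^ (CARD('n) - 1) * measure \<mu> UNIV"
      by (rule mult_right_mono) simp
    then show ?thesis by simp
  qed
  moreover have "(2::real) ^ CARD('n) = 2 * 2 ^ (CARD('n) - 1)"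
    using n2 by (cases "CARD('n)") auto
  moreover have "A (Suc 0) x = 2 ^ (CARD('n) - 1) * measure \<mu> (dyadic_ball (Suc 0) x) + measure \<mu> UNIV / 2^9"
    "2 ^ CARD('n) * A 0 y = 2 ^ CARD('n) * measure \<mu> UNIV"
    by (simp_all add: scaled_mass_def)
  ultimately show ?case by (simp only:)
next
  case (Suc m)
  have "dist x y \<le> (1/2)^Suc m"
    using Suc.prems by (rule order_trans) (simp add: field_simps)
  then have IH: "A (Suc m) x \<le> 2 ^ CARD('n) * A m y" by (rule Suc.IH)
  have p: "(2::real) ^ CARD('n) = 2 * 2 ^ (CARD('n) - 1)"
    using n2 by (cases "CARD('n)") auto
  have "measure \<mu> (dyadic_ball (Suc (Suc m)) x) \<le> measure \<mu> (dyadic_ball (Suc m) y)"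
    by (rule mu.finite_measure_mono) (use dyadic_ball_shift[OF Suc.prems] in auto)
  then have "\<alpha> (Suc (Suc m)) x \<le> 2 ^ (CARD('n) - 1) * \<alpha> (Suc m) y"
  proof -
    assume *: "measure \<mu> (dyadic_ball (Suc (Suc m)) x) \<le> measure \<mu> (dyadic_ball (Suc m) y)"
    have "(2::real) ^ (Suc (Suc m) * (CARD('n) - 1)) = 2 ^ (CARD('n) - 1) * 2 ^ (Suc m * (CARD('n) - 1))"
      by (subst mult_Suc, rule power_add)
    then show ?thesis
      unfolding scaled_mass_def using * by (simp only: mult.assoc) (intro mult_left_mono, auto)
  qed
  also have "\<dots> \<le> 2 ^ CARD('n) * \<alpha> (Suc m) y"
    using alpha_nonneg[of "Suc m" y] p by (intro mult_right_mono) auto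
  finally show ?case using IH by (simp add: field_simps)
qed

lemma A_grow: "A (Suc m) x \<le> 2 ^ CARD('n) * A m x"
  by (rule A_shift) simp

lemma A_Suc_ge: "A m x \<le> 2^9 * A (Suc m) x"
  using alpha_nonneg[of "Suc m" x] by (simp add: field_simps)

lemma v_pos: "v m x > 0"
  using V_pos by (simp add: v_def)

lemma v_power: "v m x ^ CARD('n) = V m x"
  using V_pos[of m x] by (simp add: v_def less_imp_le)

lemma v_le_iff: "v m x \<le> v l y \<longleftrightarrow> V m x \<le> V l y"
  by (simp add: v_def)

lemma v_le_1: "v m x \<le> 1"
  using V_decreasing[of 0 m x] V_0_le[of x] by (simp add: v_def)

lemma v_decreasing: "l \<le> m \<Longrightarrow> v m x \<le> v l x"
  by (simp add: v_le_iff V_decreasing)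

lemma v_shift: "dist x y \<le> (1/2)^Suc m \<Longrightarrow> v (Suc m) x \<le> v m y"
  by (simp only: v_le_iff V_shift)

lemma v_Suc_ge: "v m x \<le> 2^8 * v (Suc m) x"
proof (rule power_le_imp_le_base)
  have "v m x ^ CARD('n) \<le> (2^8 * v (Suc m) x) ^ CARD('n)"
    using V_Suc_ge[of m x] by (simp only: v_power power_mult_distrib power_mult)
  moreover have "Suc (CARD('n) - 1) = CARD('n)" by simp
  ultimately show "v m x ^ Suc (CARD('n) - 1) \<le> (2^8 * v (Suc m) x) ^ Suc (CARD('n) - 1)" by simp
qed (use v_pos[of "Suc m" x] in simp)

lemma V_div_v: "V m x / v m x ^ (CARD('n) - 1) = v m x"
proof -
  have "V m x = v m x * v m x ^ (CARD('n) - 1)"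
    using power_eq_if[of "v m x" "CARD('n)"] v_power[of m x] by simp
  then show ?thesis using v_pos[of m x] by simp
qed

lemma nu_le_V: "measure \<nu> (dyadic_ball m x) \<le> V m x"
  by (cases m) (use V_pos[of _ x] nu_pos in \<open>auto simp: less_imp_le\<close>)

text \<open>With \<open>s = v m x\<close> the second term of \<open>mass_le\<close> is at most
  \<open>V / v ^ (n - 1) = v\<close>, so both terms are bounded by \<open>v\<close>.\<close>

lemma alpha_le_v: "\<alpha> m x \<le> 2 * K * v m x"
proof -
  have "measure \<nu> (dyadic_ball m x) / v m x ^ (CARD('n) - 1) \<le> V m x / v m x ^ (CARD('n) - 1)"
    using nu_le_V v_pos[of m x] by (intro divide_right_mono) (auto simp: less_imp_le)
  then have "measure \<nu> (dyadic_ball m x) / v m x ^ (CARD('n) - 1) \<le> v m x" unfolding V_div_v .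
  then have "K * (v m x + measure \<nu> (dyadic_ball m x) / v m x ^ (CARD('n) - 1)) \<le> K * (v m x + v m x)"
    using K1 by (intro mult_left_mono) auto
  with mass_le[OF v_pos[of m x], of m x] show ?thesis by simp
qed

text \<open>The trace of the coarser scale is divided by 2^9 while \<open>v\<close> loses at most
  2^8, so it takes up at most half of the constant \<open>4 * K\<close>; \<open>alpha_le_v\<close>
  fills the other half.\<close>

lemma A_le_v: "A m x \<le> 4 * K * v m x"
proof (induction m)
  case 0
  have "0 \<le> K * v 0 x" using K1 v_pos[of 0 x] by simp
  then show ?case using alpha_le_v[of 0 x] by simp
next
  case (Suc m)
  have "A m x \<le> 4 * K * (2^8 * v (Suc m) x)"
    by (rule order_trans[OF Suc mult_left_mono[OF v_Suc_ge]]) (use K1 in simp)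
  then have "A m x / 2^9 \<le> 2 * K * v (Suc m) x" by simp
  with alpha_le_v[of "Suc m" x] show ?case by simp
qed

text \<open>One scale finer, the normalizing power of 2 grows by 2^(n-1), which is at least 2
  because n is at least 2. Hence the inner ball accounts for at most half of its own scaled
  mass.\<close>

lemma alpha_split: "\<alpha> m x \<le> 2 ^ (m * (CARD('n) - 1)) * measure \<mu> (ann m x) + \<alpha> (Suc m) x / 2"
proof -
  have p: "2 ^ (Suc m * (CARD('n) - 1)) \<ge> (2::real) * 2 ^ (m * (CARD('n) - 1))"
    using power_increasing[of "Suc (m * (CARD('n) - 1))" "Suc m * (CARD('n) - 1)" "2::real"] n2 by simp
  have "2 * 2 ^ (m * (CARD('n) - 1)) * measure \<mu> (dyadic_ball (Suc m) x) \<le> \<alpha> (Suc m) x"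
    unfolding scaled_mass_def using p by (intro mult_right_mono) auto
  then show ?thesis unfolding mu_ann by (simp add: scaled_mass_def algebra_simps)
qed

text \<open>The bound is linear in \<open>N\<close> although the number \<open>M\<close> of scales
  is not restricted. The first \<open>2 * D * N\<close> scales cost at most \<open>2 * K\<close>
  each. Afterwards \<open>annulus_le\<close> leaves a geometric series, the sum of the weights
  \<open>w m\<close>, and logarithms of \<open>V\<close> that telescope; the lower bound on
  \<open>v\<close> makes the last sum linear in \<open>N\<close> as well.\<close>

lemma sum_scaled_mass_div_v_le:
  assumes N: "N \<ge> 1" and D: "D \<ge> 1"
    and v: "\<And>m. m < M \<Longrightarrow> v m x \<ge> 1 / 2 ^ (D * N)"
    and w: "(\<Sum>m=1..<M. w m) \<le> D * N"
  shows "(\<Sum>m<M. 2 ^ (m * (CARD('n) - 1)) * measure \<mu> (ann m x) / v m x)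
    \<le> K * (5 * D + CARD('n) * D + 4 + 8 * CARD('n)) * N" (is "(\<Sum>m<M. ?b m) \<le> _")
proof -
  let ?n = "CARD('n)"
  have b1: "?b m \<le> 2 * K" for m
  proof -
    have "2 ^ (m * (?n - 1)) * measure \<mu> (ann m x) \<le> \<alpha> m x"
      unfolding scaled_mass_def mu_ann by (intro mult_left_mono) auto
    with alpha_le_v[of m x] show ?thesis using v_pos[of m x] by (simp add: divide_le_eq)
  qed
  have sq: "1 / sqrt 2 < 1" "1 / sqrt 2 \<ge> 0" by simp_all
  have b2: "?b m \<le> K * ((1 / sqrt 2) ^ (m - 2 * D * N) + w m + (ln (V m x) - ln (V (Suc m) x)))"
    if m: "m < M" "m \<ge> 2 * D * N" for m
  proof -
    have m1: "m \<ge> 1" using m N D by (metis One_nat_def Suc_leI less_le_trans mult_pos_pos nat_0_less_mult_iff zero_less_numeral less_eq_Suc_le)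
    \<comment> \<open>The parameter \<open>s = v m x * w m\<close> is chosen so that, after division
      by \<open>v\<close>, the second term of \<open>annulus_le\<close> is \<open>w m\<close> and
      the third is free of \<open>w m\<close>.\<close>
    have vw: "v m x * w m > 0" using v_pos w_pos[OF m1] by simp
    have "?b m \<le> K * ((1 / sqrt 2) ^ m + v m x * w m + w m ^ (?n - 1) *
          measure \<nu> (ann m x) / (v m x * w m) ^ (?n - 1)) / v m x"
      using annulus_le[OF m1 vw, of x] v_pos[of m x] unfolding ann_def
      by (intro divide_right_mono) auto
    also have "\<dots> = K * ((1 / sqrt 2) ^ m / v m x + w m + measure \<nu> (ann m x) / v m x ^ (?n - 1) / v m x)"
    proof -
      have "((1 / sqrt 2) ^ m + v m x * w m + w m ^ (?n - 1) *
            measure \<nu> (ann m x) / (v m x * w m) ^ (?n - 1)) / v m x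
          = (1 / sqrt 2) ^ m / v m x + w m + measure \<nu> (ann m x) / v m x ^ (?n - 1) / v m x"
        using v_pos[of m x] w_pos[OF m1] by (simp add: power_mult_distrib add_divide_distrib)
      then show ?thesis by (metis times_divide_eq_right)
    qed
    also have "measure \<nu> (ann m x) / v m x ^ (?n - 1) / v m x = measure \<nu> (ann m x) / V m x"
      using power_eq_if[of "v m x" ?n] v_power[of m x] by simp
    finally have *: "?b m \<le> K * ((1 / sqrt 2) ^ m / v m x + w m + measure \<nu> (ann m x) / V m x)" .
    have "(1 / sqrt 2) ^ m / v m x \<le> (1 / sqrt 2) ^ m / (1 / 2 ^ (D * N))"
      using v[OF m(1)] v_pos[of m x] by (intro divide_left_mono) auto
    \<comment> \<open>The factor \<open>2 ^ (D * N)\<close> lost by \<open>1 / v\<close> is worth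
      exactly \<open>2 * D * N\<close> powers of \<open>1 / sqrt 2\<close>. This is why the trivial
      bound is used up to that scale.\<close>
    also have "\<dots> = (1 / sqrt 2) ^ (m - 2 * D * N) * ((1 / sqrt 2) ^ (2 * D * N) * 2 ^ (D * N))"
      using m(2) by (simp add: power_add[symmetric] flip: mult.assoc)
    also have "(1 / sqrt 2) ^ (2 * D * N) = (1/2::real) ^ (D * N)"
      by (simp add: power_mult power_divide mult.assoc)
    also have "(1/2::real) ^ (D * N) * 2 ^ (D * N) = 1"
      by (simp add: power_divide)
    finally have **: "(1 / sqrt 2) ^ m / v m x \<le> (1 / sqrt 2) ^ (m - 2 * D * N)" by simp
    have "measure \<nu> (ann m x) / V m x \<le> 1 - V (Suc m) x / V m x"
      using V_drop[of m x] V_pos[of m x] by (simp add: field_simps)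
    also have "\<dots> \<le> - ln (V (Suc m) x / V m x)"
      using ln_le_minus_one[of "V (Suc m) x / V m x"] V_pos[of m x] V_pos[of "Suc m" x] by simp
    also have "\<dots> = ln (V m x) - ln (V (Suc m) x)"
      using V_pos[of m x] V_pos[of "Suc m" x] by (simp add: ln_div del: reg_energy.simps)
    finally have "measure \<nu> (ann m x) / V m x \<le> ln (V m x) - ln (V (Suc m) x)" .
    with ** have "K * ((1 / sqrt 2) ^ m / v m x + w m + measure \<nu> (ann m x) / V m x)
      \<le> K * ((1 / sqrt 2) ^ (m - 2 * D * N) + w m + (ln (V m x) - ln (V (Suc m) x)))"
      using K1 by (intro mult_left_mono) auto
    with * show ?thesis by linarith
  qed
  define P where "P = {2 * D * N..<M}"
  have "(\<Sum>m<M. ?b m) = (\<Sum>m\<in>{..<M} \<inter> {..<2 * D * N}. ?b m) + (\<Sum>m\<in>P. ?b m)"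
    by (subst sum.union_disjoint[symmetric]) (auto simp: P_def intro!: sum.cong)
  also have "(\<Sum>m\<in>{..<M} \<inter> {..<2 * D * N}. ?b m) \<le> (\<Sum>m\<in>{..<2 * D * N}. 2 * K)"
  proof (rule order_trans)
    show "(\<Sum>m\<in>{..<M} \<inter> {..<2 * D * N}. ?b m) \<le> (\<Sum>m\<in>{..<M} \<inter> {..<2 * D * N}. 2 * K)"
      by (rule sum_mono) (rule b1)
    show "(\<Sum>m\<in>{..<M} \<inter> {..<2 * D * N}. 2 * K) \<le> (\<Sum>m\<in>{..<2 * D * N}. 2 * K)"
      using K1 by (intro sum_mono2) auto
  qed
  also have "\<dots> = 4 * K * D * N" by simp
  also have "(\<Sum>m\<in>P. ?b m) \<le> (\<Sum>m\<in>P. K * ((1 / sqrt 2) ^ (m - 2 * D * N) + w m + (ln (V m x) - ln (V (Suc m) x))))"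
    by (intro sum_mono b2) (auto simp: P_def)
  also have "\<dots> = K * ((\<Sum>m\<in>P. (1 / sqrt 2) ^ (m - 2 * D * N)) + (\<Sum>m\<in>P. w m) + (\<Sum>m\<in>P. ln (V m x) - ln (V (Suc m) x)))"
    by (simp add: sum_distrib_left[symmetric] sum.distrib)
  also have "\<dots> \<le> K * (4 + real (D * N) + real (CARD('n) * D * N + 8 * CARD('n)))"
  proof (intro mult_left_mono add_mono)
    have "(\<Sum>m\<in>P. (1 / sqrt 2) ^ (m - 2 * D * N)) \<le> (\<Sum>m<M. (1 / sqrt 2) ^ m)"
    proof (rule sum_le_included[where i="\<lambda>m. m + 2 * D * N"])
      show "\<forall>m\<in>P. \<exists>k\<in>{..<M}. k + 2 * D * N = m \<and> (1 / sqrt 2) ^ (m - 2 * D * N) \<le> (1 / sqrt 2) ^ k"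
      proof
        fix m assume "m \<in> P"
        then show "\<exists>k\<in>{..<M}. k + 2 * D * N = m \<and> (1 / sqrt 2) ^ (m - 2 * D * N) \<le> (1 / sqrt 2) ^ k"
          by (intro bexI[of _ "m - 2 * D * N"]) (auto simp: P_def)
      qed
    qed (auto simp: P_def)
    also have "\<dots> \<le> 1 / (1 - 1 / sqrt 2)"
      using sum_le_suminf[OF summable_geometric[of "1 / sqrt 2"], of "{..<M}"] sq
        suminf_geometric[of "1 / sqrt 2"] by simp
    also have "\<dots> \<le> 4"
    proof -
      have "4 / 3 \<le> sqrt 2" by (rule real_le_rsqrt) (simp add: power2_eq_square)
      then have "1 / sqrt 2 \<le> 3 / 4" by (simp add: field_simps)
      then show ?thesis using sq by (simp add: divide_le_eq)
    qed
    finally show "(\<Sum>m\<in>P. (1 / sqrt 2) ^ (m - 2 * D * N)) \<le> 4" .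
    have "2 * D * N \<ge> 1" using N D by simp
    then have "m \<in> {1..<M}" if "m \<in> P" for m
      using that unfolding P_def atLeastLessThan_iff by linarith
    then have "P \<subseteq> {1..<M}" by blast
    moreover have "0 \<le> w m" if "m \<in> {1..<M} - P" for m
      using that by (intro less_imp_le[OF w_pos]) simp
    ultimately have "(\<Sum>m\<in>P. w m) \<le> (\<Sum>m=1..<M. w m)"
      by (intro sum_mono2) simp_all
    with w show "(\<Sum>m\<in>P. w m) \<le> real (D * N)" by linarith
    show "(\<Sum>m\<in>P. ln (V m x) - ln (V (Suc m) x)) \<le> real (CARD('n) * D * N + 8 * CARD('n))"
    proof (cases "2 * D * N < M")
      case False
      then show ?thesis by (simp add: P_def)
    next
      case True
      have "(\<Sum>m\<in>P. ln (V m x) - ln (V (Suc m) x)) = ln (V (2 * D * N) x) - ln (V M x)"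
        using sum_Suc_diff'[of "2 * D * N" M "\<lambda>m. - ln (V m x)"] True by (simp add: P_def)
      also have "ln (V (2 * D * N) x) \<le> 0"
        using V_decreasing[of 0 "2 * D * N" x] V_0_le[of x] V_pos[of "2 * D * N" x] by simp
      also have "0 - ln (V M x) \<le> real (CARD('n) * D * N + 8 * CARD('n))"
      proof -
        \<comment> \<open>The lower bound on \<open>v\<close> is available only below
          \<open>M\<close>; going one scale back costs the additional \<open>8 * n\<close>.\<close>
        obtain M' where M': "M = Suc M'" using True by (cases M) auto
        have "(1 / 2 ^ (D * N)) ^ ?n \<le> V M' x"
          using power_mono[OF v[of M'], of ?n] M' by (simp add: v_power)
        also have "\<dots> \<le> 2 ^ (8 * ?n) * V M x" unfolding M' by (rule V_Suc_ge)
        finally have "ln ((1 / 2 ^ (D * N)) ^ ?n) \<le> ln (2 ^ (8 * ?n) * V M x)"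
          using V_pos[of M x] by (subst ln_le_cancel_iff) (auto simp: zero_less_mult_iff)
        then have "- (?n * (D * N) * ln 2) \<le> 8 * ?n * ln 2 + ln (V M x)"
          using V_pos[of M x] by (simp add: ln_mult ln_realpow ln_div mult.assoc)
        moreover have "(?n * (D * N) + 8 * ?n) * ln 2 \<le> real (?n * (D * N) + 8 * ?n) * 1"
          using ln_2_less_1 by (intro mult_left_mono) auto
        ultimately show ?thesis by (simp add: algebra_simps)
      qed
      finally show ?thesis by simp
    qed
  qed (use K1 in auto)
  finally have "(\<Sum>m<M. ?b m) \<le> K * (5 * D * N + CARD('n) * D * N + 4 + 8 * CARD('n))"
    by (simp add: algebra_simps)
  also have "\<dots> \<le> K * ((5 * D + CARD('n) * D + 4 + 8 * CARD('n)) * N)"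
  proof (intro mult_left_mono)
    have "(4 + 8 * CARD('n)) * 1 \<le> (4 + 8 * CARD('n)) * N" using N by (intro mult_le_mono) auto
    then have "5 * D * N + CARD('n) * D * N + 4 + 8 * CARD('n) \<le> (5 * D + CARD('n) * D + 4 + 8 * CARD('n)) * N"
      by (simp add: algebra_simps)
    then show "real (5 * D * N + CARD('n) * D * N + 4 + 8 * CARD('n)) \<le> real ((5 * D + CARD('n) * D + 4 + 8 * CARD('n)) * N)"
      by (rule of_nat_mono)
  qed (use K1 in auto)
  finally show ?thesis by (simp add: mult.assoc)
qed

text \<open>Two recursions with ratio 1/2 lead from annuli to the regularized mass, and each at most
  doubles the sum up to a boundary term: \<open>rs\<close> passes from annuli to balls by looking at
  the next finer scale, \<open>qs\<close> passes from balls to \<open>A\<close> by looking at the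
  next coarser one.\<close>

lemma sum_A_div_v_le:
  assumes N: "N \<ge> 1" and D: "D \<ge> 1"
    and v: "\<And>m. m < M \<Longrightarrow> v m x \<ge> 1 / 2 ^ (D * N)"
    and w: "(\<Sum>m=1..<M. w m) \<le> D * N"
  shows "(\<Sum>m<M. A m x / v m x) \<le> 4 * K * (5 * D + CARD('n) * D + 5 + 8 * CARD('n)) * N"
proof -
  let ?b = "\<lambda>m. 2 ^ (m * (CARD('n) - 1)) * measure \<mu> (ann m x) / v m x"
  define r where "r m = \<alpha> m x / v m x" for m
  define q where "q m = A m x / v m x" for m
  have r: "r m \<ge> 0" "r m \<le> 2 * K" for m
    using alpha_nonneg[of m x] alpha_le_v[of m x] v_pos[of m x] by (auto simp: r_def divide_le_eq)
  have q: "q m \<ge> 0" for m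
    using A_pos[of m x] v_pos[of m x] by (simp add: q_def less_imp_le)
  \<comment> \<open>The ratio 1/2 is 2^8/2^9, the possible loss of \<open>v\<close> against the
    damping of the mass.\<close>
  have qs: "q (Suc m) \<le> r (Suc m) + q m / 2" for m
  proof -
    have "A m x / 2^9 / v (Suc m) x \<le> A m x / 2^9 / (v m x / 2^8)"
      using v_Suc_ge[of m x] v_pos[of m x] v_pos[of "Suc m" x] A_pos[of m x]
      by (intro divide_left_mono) auto
    then show ?thesis by (simp add: q_def r_def add_divide_distrib)
  qed
  have rs: "r m \<le> ?b m + r (Suc m) / 2" for m
  proof -
    have "\<alpha> (Suc m) x / 2 / v m x \<le> \<alpha> (Suc m) x / 2 / v (Suc m) x"
      using v_decreasing[of m "Suc m" x] v_pos[of m x] v_pos[of "Suc m" x] alpha_nonneg[of "Suc m" x]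
      by (intro divide_left_mono) auto
    moreover have "r m \<le> ?b m + \<alpha> (Suc m) x / 2 / v m x"
      using divide_right_mono[OF alpha_split[of m x], of "v m x"] v_pos[of m x]
      by (simp add: r_def add_divide_distrib)
    ultimately show ?thesis by (simp add: r_def)
  qed
  have "(\<Sum>m<Suc i. q m) \<le> 2 * (\<Sum>m<Suc i. r m) - q i" for i
  proof (induction i)
    case 0
    then show ?case by (simp add: q_def r_def)
  next
    case (Suc i)
    then show ?case using qs[of i] by simp
  qed
  from this[of "M - 1"] q[of "M - 1"] have 1: "(\<Sum>m<M. q m) \<le> 2 * (\<Sum>m<M. r m)"
    by (cases M) auto
  have "(\<Sum>m<i. r m) \<le> 2 * (\<Sum>m<i. ?b m) + r i - r 0" for i
  proof (induction i)
    case (Suc i)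
    then show ?case using rs[of i] by simp
  qed simp
  from this[of M] r(1)[of 0] r(2)[of M] have 2: "(\<Sum>m<M. r m) \<le> 2 * (\<Sum>m<M. ?b m) + 2 * K"
    by linarith
  have "4 * K \<le> 4 * K * N" using K1 N by simp
  with 1 2 sum_scaled_mass_div_v_le[OF assms] show ?thesis
    unfolding q_def by (simp add: algebra_simps)
qed

end

section \<open>Lattice points on dyadic scales\<close>

definition lattice_point :: "nat \<Rightarrow> ('n \<Rightarrow> int) \<Rightarrow> real^'n" where
  "lattice_point i k = (\<chi> j. real_of_int (k j) / (2 ^ (i + 2) * real CARD('n)))"

lemma card_int_near_le:
  fixes a h r :: real
  assumes "h > 0" "r > 0"
  shows "finite {t::int. \<bar>of_int t / h - a\<bar> \<le> r}" "real (card {t::int. \<bar>of_int t / h - a\<bar> \<le> r}) \<le> 2 * r * h + 1"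
proof -
  have sub: "{t::int. \<bar>of_int t / h - a\<bar> \<le> r} \<subseteq> {\<lceil>(a - r) * h\<rceil>..\<lfloor>(a + r) * h\<rfloor>}"
  proof
    fix t :: int assume "t \<in> {t::int. \<bar>of_int t / h - a\<bar> \<le> r}"
    then have "a - r \<le> of_int t / h" "of_int t / h \<le> a + r" by auto
    then have "(a - r) * h \<le> of_int t" "of_int t \<le> (a + r) * h"
      using assms(1) by (auto simp: field_simps)
    then show "t \<in> {\<lceil>(a - r) * h\<rceil>..\<lfloor>(a + r) * h\<rfloor>}" by (simp add: ceiling_le_iff le_floor_iff)
  qed
  then show "finite {t::int. \<bar>of_int t / h - a\<bar> \<le> r}" by (rule finite_subset) simp
  have "card {t::int. \<bar>of_int t / h - a\<bar> \<le> r} \<le> nat (\<lfloor>(a + r) * h\<rfloor> - \<lceil>(a - r) * h\<rceil> + 1)"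
    using card_mono[OF _ sub] by (simp add: algebra_simps)
  also have "real (nat (\<lfloor>(a + r) * h\<rfloor> - \<lceil>(a - r) * h\<rceil> + 1)) \<le> 2 * r * h + 1"
  proof -
    have "of_int (\<lfloor>(a + r) * h\<rfloor> - \<lceil>(a - r) * h\<rceil> + 1) \<le> (a + r) * h - (a - r) * h + 1"
      using of_int_floor_le[of "(a + r) * h"] le_of_int_ceiling[of "(a - r) * h"] by (simp only: of_int_diff of_int_add of_int_1)
    then have "of_int (\<lfloor>(a + r) * h\<rfloor> - \<lceil>(a - r) * h\<rceil> + 1) \<le> 2 * r * h + 1"
      by (simp add: algebra_simps)
    then show ?thesis using assms
      by (cases "\<lfloor>(a + r) * h\<rfloor> - \<lceil>(a - r) * h\<rceil> + 1 \<ge> 0") (auto simp: less_imp_le add_nonneg_nonneg)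
  qed
  finally show "real (card {t::int. \<bar>of_int t / h - a\<bar> \<le> r}) \<le> 2 * r * h + 1" by simp
qed

lemma card_lattice_near_le:
  fixes x :: "real^'n"
  assumes "r > 0"
  shows "finite {k. dist x (lattice_point i k) \<le> r}"
    "real (card {k. dist x (lattice_point i k) \<le> r}) \<le> (2 * r * (2 ^ (i + 2) * real CARD('n)) + 1) ^ CARD('n)"
proof -
  let ?h = "2 ^ (i + 2) * real CARD('n)"
  have h: "?h > 0" by (simp add: card_gt_0_iff)
  define F where "F j = {t::int. \<bar>of_int t / ?h - x $ j\<bar> \<le> r}" for j
  have F: "finite (F j)" "real (card (F j)) \<le> 2 * r * ?h + 1" for j
    unfolding F_def using card_int_near_le[OF h assms] by auto
  have sub: "{k. dist x (lattice_point i k) \<le> r} \<subseteq> PiE UNIV F"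
  proof
    fix k assume "k \<in> {k. dist x (lattice_point i k) \<le> r}"
    then have "norm (lattice_point i k - x) \<le> r" by (simp add: dist_norm norm_minus_commute)
    then have "\<bar>(lattice_point i k - x) $ j\<bar> \<le> r" for j
      using component_le_norm_cart[of "lattice_point i k - x" j] by linarith
    then show "k \<in> PiE UNIV F" by (auto simp: F_def lattice_point_def PiE_def)
  qed
  have fin: "finite (PiE UNIV F)" using F(1) by (intro finite_PiE) auto
  show "finite {k. dist x (lattice_point i k) \<le> r}" using sub fin by (rule finite_subset)
  have "real (card {k. dist x (lattice_point i k) \<le> r}) \<le> real (card (PiE UNIV F))"
    using card_mono[OF fin sub] by simp
  also have "\<dots> = (\<Prod>j\<in>UNIV. real (card (F j)))" by (simp add: card_PiE)
  also have "\<dots> \<le> (\<Prod>j\<in>(UNIV::'n set). 2 * r * ?h + 1)"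
    using F by (intro prod_mono) auto
  finally show "real (card {k. dist x (lattice_point i k) \<le> r}) \<le> (2 * r * ?h + 1) ^ CARD('n)"
    by simp
qed

text \<open>Rounding a coordinate down errs by at most the mesh, and the errors of the n coordinates
  add up in the l1 norm. The factor n in the mesh compensates for this.\<close>

lemma lattice_point_near:
  fixes x :: "real^'n"
  obtains k where "dist x (lattice_point i k) \<le> (1/2)^(i + 2)"
proof -
  let ?h = "2 ^ (i + 2) * real CARD('n)"
  have h: "?h > 0" by (simp add: card_gt_0_iff)
  define k where "k j = \<lfloor>x $ j * ?h\<rfloor>" for j
  have c: "\<bar>(x - lattice_point i k) $ j\<bar> \<le> 1 / ?h" for j
  proof -
    have "of_int (k j) \<le> x $ j * ?h" "x $ j * ?h \<le> of_int (k j) + 1"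
      unfolding k_def by linarith+
    then have "of_int (k j) / ?h \<le> x $ j" "x $ j \<le> of_int (k j) / ?h + 1 / ?h"
      using h by (simp_all add: field_simps)
    then show ?thesis by (simp add: lattice_point_def)
  qed
  have "dist x (lattice_point i k) \<le> (\<Sum>j\<in>UNIV. \<bar>(x - lattice_point i k) $ j\<bar>)"
    unfolding dist_norm by (rule norm_le_l1_cart)
  also have "\<dots> \<le> (\<Sum>j\<in>(UNIV::'n set). 1 / ?h)" by (rule sum_mono[OF c])
  also have "\<dots> = (1/2)^(i + 2)" by (simp add: power_divide card_gt_0_iff)
  finally show thesis by (rule that)
qed

text \<open>Integration turns a pointwise bound on a weighted overlap into a bound on the weighted
  sum of measures.\<close>

lemma (in finite_measure) sum_measure_le:
  fixes c :: "'i \<Rightarrow> real"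
  assumes J: "finite J" and B: "\<And>j. j \<in> J \<Longrightarrow> B j \<in> sets M"
    and le: "\<And>y. y \<in> space M \<Longrightarrow> (\<Sum>j\<in>J. c j * indicator (B j) y) \<le> C"
  shows "(\<Sum>j\<in>J. c j * measure M (B j)) \<le> C * measure M (space M)"
proof -
  have int: "integrable M (\<lambda>y. c j * indicator (B j) y)" if "j \<in> J" for j
    using B[OF that] by (auto intro!: integrable_mult_right simp: emeasure_eq_measure)
  have "(\<Sum>j\<in>J. c j * measure M (B j)) = (\<Sum>j\<in>J. \<integral>y. c j * indicator (B j) y \<partial>M)"
    using B by (intro sum.cong) (auto simp: sets.sets_into_space Int_absorb2)
  also have "\<dots> = (\<integral>y. (\<Sum>j\<in>J. c j * indicator (B j) y) \<partial>M)"
    by (rule Bochner_Integration.integral_sum[symmetric]) (rule int)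
  also have "\<dots> \<le> (\<integral>y. C \<partial>M)"
    by (intro integral_mono Bochner_Integration.integrable_sum int le) auto
  finally show ?thesis by (simp add: mult.commute)
qed

section \<open>The total cost of the lattice balls\<close>

context mass_energy
begin

lemma V_unroll: "V i x \<le> 2 * (\<Sum>l\<le>i. measure \<nu> (dyadic_ball l x) / 2 ^ (8 * CARD('n) * (i - l)))"
proof (induction i)
  case (Suc i)
  let ?f = "\<lambda>i l. measure \<nu> (dyadic_ball l x) / 2 ^ (8 * CARD('n) * (i - l))"
  have "?f (Suc i) l = ?f i l / 2 ^ (8 * CARD('n))" if "l \<le> i" for l
  proof -
    have "8 * CARD('n) * (Suc i - l) = 8 * CARD('n) * (i - l) + 8 * CARD('n)"
      using that by (simp add: Suc_diff_le)
    then show ?thesis by (simp add: power_add)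
  qed
  then have "(\<Sum>l\<le>i. ?f (Suc i) l) = (\<Sum>l\<le>i. ?f i l / 2 ^ (8 * CARD('n)))"
    by (intro sum.cong) auto
  then have "(\<Sum>l\<le>i. ?f (Suc i) l) = (\<Sum>l\<le>i. ?f i l) / 2 ^ (8 * CARD('n))"
    by (simp only: sum_divide_distrib)
  moreover have "V i x / 2 ^ (8 * CARD('n)) \<le> 2 * (\<Sum>l\<le>i. ?f i l) / 2 ^ (8 * CARD('n))"
    by (rule divide_right_mono[OF Suc]) simp
  moreover have "0 \<le> measure \<nu> (dyadic_ball (Suc i) x)" by simp
  moreover have "(\<Sum>l\<le>Suc i. ?f (Suc i) l) = (\<Sum>l\<le>i. ?f (Suc i) l) + measure \<nu> (dyadic_ball (Suc i) x)"
    by simp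
  moreover have "V (Suc i) x = measure \<nu> (dyadic_ball (Suc i) x) + V i x / 2 ^ (8 * CARD('n))" by simp
  ultimately show ?case by linarith
qed simp

text \<open>The cost \<open>A * v ^ (n - 1)\<close> of a ball equals \<open>q * V\<close>. By
  \<open>A_le_v\<close> each value is at most \<open>4 * K\<close>; what matters is that the sum
  over all scales of non-negligible energy is linear in \<open>N\<close>.\<close>

definition "q m x = A m x / v m x"

lemma q_nonneg: "q m x \<ge> 0"
  using A_pos[of m x] v_pos[of m x] by (simp add: q_def less_imp_le)

lemma q_Suc: "q (Suc m) x \<le> 2 ^ (CARD('n) + 8) * q m x"
proof -
  have "A (Suc m) x / v (Suc m) x \<le> 2 ^ CARD('n) * A m x / (v m x / 2^8)"
    using A_grow[of m x] v_Suc_ge[of m x] v_pos[of m x] v_pos[of "Suc m" x] A_pos[of m x] A_pos[of "Suc m" x]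
    by (intro frac_le) (auto simp: less_imp_le)
  then show ?thesis by (simp add: q_def power_add mult_ac)
qed

lemma q_grow: "l \<le> i \<Longrightarrow> q i x \<le> 2 ^ ((CARD('n) + 8) * (i - l)) * q l x"
proof (induction i rule: dec_induct)
  case (step i)
  have "q (Suc i) x \<le> 2 ^ (CARD('n) + 8) * (2 ^ ((CARD('n) + 8) * (i - l)) * q l x)"
    by (rule order_trans[OF q_Suc mult_left_mono[OF step.IH]]) simp
  moreover have "(CARD('n) + 8) * (Suc i - l) = (CARD('n) + 8) + (CARD('n) + 8) * (i - l)"
    using step by (simp add: Suc_diff_le)
  ultimately show ?case by (simp add: power_add mult_ac)
qed simp

text \<open>One scale is given up in order to move the centre. The comparison of \<open>v\<close>
  from below alternates two losses of 2^8 with one shift, which gives 2^16. The truncated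
  \<open>l - 1\<close> is harmless for \<open>l = 0\<close>, where nothing depends on the
  centre.\<close>

lemma q_shift:
  assumes "y \<in> dyadic_ball l x"
  shows "q l x \<le> 2 ^ (CARD('n) + 16) * q (l - 1) y" "v l x \<le> v (l - 1) y"
proof -
  have *: "q l x \<le> 2 ^ (CARD('n) + 16) * q (l - 1) y \<and> v l x \<le> v (l - 1) y"
  proof (cases l)
    case 0
    have "q 0 x = q 0 y" by (simp add: q_def v_def scaled_mass_def)
    moreover have "1 * q 0 y \<le> 2 ^ (CARD('n) + 16) * q 0 y"
      using q_nonneg by (intro mult_right_mono) (auto simp: one_le_power)
    ultimately show ?thesis using 0 by (simp add: v_def)
  next
    case (Suc m)
    have d: "dist x y \<le> (1/2)^Suc m" using dist_dyadic_ball[of l y x] assms Suc by simp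
    have "v m y \<le> 2^8 * v (Suc m) y" by (rule v_Suc_ge)
    also have "\<dots> \<le> 2^8 * v m x" using v_shift[of y x m] d by (simp add: dist_commute)
    also have "\<dots> \<le> 2^8 * (2^8 * v (Suc m) x)" using v_Suc_ge[of m x] by simp
    finally have "v m y / 2^16 \<le> v (Suc m) x" by simp
    then have "A (Suc m) x / v (Suc m) x \<le> 2 ^ CARD('n) * A m y / (v m y / 2^16)"
      using A_shift[OF d] v_pos[of m y] A_pos[of m y] A_pos[of "Suc m" x]
      by (intro frac_le) (auto simp: less_imp_le)
    then show ?thesis using Suc v_shift[OF d] by (simp add: q_def power_add mult_ac)
  qed
  then show "q l x \<le> 2 ^ (CARD('n) + 16) * q (l - 1) y" "v l x \<le> v (l - 1) y" by auto
qed

text \<open>Since \<open>v\<close> decreases with the scale, the scales that pass the threshold form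
  an initial segment, and \<open>sum_A_div_v_le\<close> applies to it.\<close>

lemma sum_q_le:
  assumes N: "N \<ge> 1" and D: "D \<ge> 1" and w: "(\<Sum>m=1..<L. w m) \<le> D * N"
  shows "(\<Sum>m<L. if v m y \<ge> 1 / 2 ^ (D * N) then q m y else 0)
    \<le> 4 * K * (5 * D + CARD('n) * D + 5 + 8 * CARD('n)) * N"
proof -
  define M where "M = (LEAST m. m \<ge> L \<or> v m y < 1 / 2 ^ (D * N))"
  have M: "M \<ge> L \<or> v M y < 1 / 2 ^ (D * N)" unfolding M_def by (rule LeastI_ex) auto
  have M1: "m < L \<and> v m y \<ge> 1 / 2 ^ (D * N)" if "m < M" for m
    using not_less_Least[of m "\<lambda>m. m \<ge> L \<or> v m y < 1 / 2 ^ (D * N)"] that unfolding M_def by auto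
  have M_le: "M \<le> L" unfolding M_def by (rule Least_le) simp
  have "(\<Sum>m<L. if v m y \<ge> 1 / 2 ^ (D * N) then q m y else 0) = (\<Sum>m<M. q m y)"
  proof (rule sum.mono_neutral_cong_right)
    show "\<forall>m\<in>{..<L} - {..<M}. (if v m y \<ge> 1 / 2 ^ (D * N) then q m y else 0) = 0"
    proof
      fix m assume "m \<in> {..<L} - {..<M}"
      then have "m < L" "M \<le> m" by auto
      then have "v m y < 1 / 2 ^ (D * N)" using M v_decreasing[of M m y] by linarith
      then show "(if v m y \<ge> 1 / 2 ^ (D * N) then q m y else 0) = 0" by simp
    qed
  qed (use M1 M_le in auto)
  also have "\<dots> \<le> 4 * K * (5 * D + CARD('n) * D + 5 + 8 * CARD('n)) * N"
    unfolding q_def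
  proof (rule sum_A_div_v_le[OF N D])
    have "(\<Sum>m=1..<M. w m) \<le> (\<Sum>m=1..<L. w m)"
      using M_le by (intro sum_mono2) (auto intro!: less_imp_le[OF w_pos])
    with w show "(\<Sum>m=1..<M. w m) \<le> D * N" by simp
  qed (use M1 in auto)
  finally show ?thesis .
qed

lemma sum_geometric_convolution_le:
  fixes g :: "nat \<Rightarrow> real"
  assumes "\<And>l. g l \<ge> 0"
  shows "(\<Sum>i<L. \<Sum>l\<le>i. g l / 2 ^ (i - l)) \<le> 2 * (\<Sum>l<L. g l)"
proof -
  define s where "s i = (\<Sum>l\<le>i. g l / 2 ^ (i - l))" for i
  have s: "s i \<ge> 0" for i unfolding s_def by (intro sum_nonneg) (use assms in auto)
  have s0: "s 0 = g 0" by (simp add: s_def)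
  have sSuc: "s (Suc i) = g (Suc i) + s i / 2" for i
  proof -
    have "(\<Sum>l\<le>i. g l / 2 ^ (Suc i - l)) = (\<Sum>l\<le>i. g l / 2 ^ (i - l) / 2)"
      by (intro sum.cong) (auto simp: Suc_diff_le)
    then show ?thesis by (simp add: s_def sum_divide_distrib)
  qed
  have "(\<Sum>i<Suc k. s i) \<le> 2 * (\<Sum>l<Suc k. g l) - s k" for k
  proof (induction k)
    case (Suc k)
    then show ?case using sSuc[of k] by simp
  qed (simp add: s0)
  from this[of "L - 1"] s[of "L - 1"] show ?thesis unfolding s_def[symmetric] by (cases L) auto
qed

text \<open>Volume counting: a ball of radius \<open>(1/2) ^ l\<close> meets of the order of
  \<open>2 ^ (n * (i - l))\<close> cells of scale \<open>i\<close>. For \<open>l = 0\<close> the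
  dyadic ball is the whole space and the restriction to norm at most \<open>R + 1\<close> takes
  over.\<close>

lemma lattice_count_le:
  fixes y :: "real^'n"
  assumes R: "R \<ge> 0" and l: "l \<le> i"
  shows "finite {k::'n \<Rightarrow> int. norm (lattice_point i k) \<le> R + 1}"
    and "real (card {k. norm (lattice_point i k) \<le> R + 1 \<and> y \<in> dyadic_ball l (lattice_point i k)})
      \<le> ((8 * R + 9) * CARD('n)) ^ CARD('n) * 2 ^ (CARD('n) * (i - l))"
proof -
  let ?n = "real CARD('n)"
  have n1: "?n \<ge> 1" using n_pos by linarith
  have f0: "finite {k. dist (0::real^'n) (lattice_point i k) \<le> R + 1}"
    using card_lattice_near_le(1)[of "R + 1" 0 i] R by simp
  then show fin: "finite {k::'n \<Rightarrow> int. norm (lattice_point i k) \<le> R + 1}" by simp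
  show "real (card {k. norm (lattice_point i k) \<le> R + 1 \<and> y \<in> dyadic_ball l (lattice_point i k)})
      \<le> ((8 * R + 9) * CARD('n)) ^ CARD('n) * 2 ^ (CARD('n) * (i - l))"
  proof (cases "l = 0")
    case True
    have "card {k. norm (lattice_point i k) \<le> R + 1 \<and> y \<in> dyadic_ball l (lattice_point i k)}
        \<le> card {k. dist (0::real^'n) (lattice_point i k) \<le> R + 1}"
      by (rule card_mono[OF f0]) auto
    then have "real (card {k. norm (lattice_point i k) \<le> R + 1 \<and> y \<in> dyadic_ball l (lattice_point i k)})
        \<le> (2 * (R + 1) * (2 ^ (i + 2) * ?n) + 1) ^ CARD('n)"
      using card_lattice_near_le(2)[of "R + 1" "0::real^'n" i] R by linarith
    also have "\<dots> \<le> (((8 * R + 9) * ?n) * 2 ^ i) ^ CARD('n)"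
    proof (rule power_mono)
      have "1 * 1 \<le> ?n * 2 ^ i" using n1 by (intro mult_mono) auto
      then show "2 * (R + 1) * (2 ^ (i + 2) * ?n) + 1 \<le> ((8 * R + 9) * ?n) * 2 ^ i"
        by (simp add: algebra_simps power_add)
    qed (use R in auto)
    finally show ?thesis using True by (simp add: power_mult_distrib power_mult mult.commute)
  next
    case False
    have f1: "finite {k. dist y (lattice_point i k) \<le> (1/2)^l}"
      by (rule card_lattice_near_le(1)) simp
    have "card {k. norm (lattice_point i k) \<le> R + 1 \<and> y \<in> dyadic_ball l (lattice_point i k)}
        \<le> card {k. dist y (lattice_point i k) \<le> (1/2)^l}"
    proof (intro card_mono[OF f1] subsetI)
      fix k assume "k \<in> {k. norm (lattice_point i k) \<le> R + 1 \<and> y \<in> dyadic_ball l (lattice_point i k)}"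
      then show "k \<in> {k. dist y (lattice_point i k) \<le> (1/2)^l}"
        using dist_dyadic_ball[of l y "lattice_point i k"] False by (simp add: dist_commute)
    qed
    then have "real (card {k. norm (lattice_point i k) \<le> R + 1 \<and> y \<in> dyadic_ball l (lattice_point i k)})
        \<le> (2 * (1/2)^l * (2 ^ (i + 2) * ?n) + 1) ^ CARD('n)"
      using card_lattice_near_le(2)[of "(1/2)^l" y i] by simp
    also have "(1/2)^l * 2 ^ (i + 2) = (4::real) * 2 ^ (i - l)"
      using l by (simp add: power_add power_divide power_diff)
    then have "2 * (1/2)^l * (2 ^ (i + 2) * ?n) = 8 * 2 ^ (i - l) * ?n"
      by (simp add: mult_ac)
    also have "(8 * 2 ^ (i - l) * ?n + 1) ^ CARD('n) \<le> (((8 * R + 9) * ?n) * 2 ^ (i - l)) ^ CARD('n)"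
    proof (rule power_mono)
      have "1 * 1 \<le> ?n * 2 ^ (i - l)" using n1 by (intro mult_mono) auto
      moreover have "0 \<le> R * (?n * 2 ^ (i - l))" using R n1 by simp
      ultimately show "8 * 2 ^ (i - l) * ?n + 1 \<le> ((8 * R + 9) * ?n) * 2 ^ (i - l)"
        by (simp add: algebra_simps)
    qed auto
    finally show ?thesis by (simp only: power_mult_distrib power_mult[symmetric] mult.commute[of "i - l" "CARD('n)"])
  qed
qed

definition near_cells :: "real \<Rightarrow> real \<Rightarrow> nat \<Rightarrow> ('n \<Rightarrow> int) set" where
  "near_cells R e i = {k. norm (lattice_point i k :: real^'n) \<le> R + 1 \<and> v i (lattice_point i k) \<ge> e}"

lemma finite_near_cells: "R \<ge> 0 \<Longrightarrow> finite (near_cells R e i)"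
  unfolding near_cells_def by (rule finite_subset[OF _ lattice_count_le(1)[of R i i]]) auto

text \<open>Three rates compete in \<open>j = i - l\<close>: there are of the order of
  \<open>2 ^ (n * j)\<close> lattice points, \<open>q\<close> grows by at most
  \<open>2 ^ ((n + 8) * j)\<close>, and the trace in the energy is damped by
  \<open>2 ^ (8 * n * j)\<close>. Since 2n + 9 is at most 8n for n at least 2, a factor
  \<open>1 / 2 ^ j\<close> survives.\<close>

lemma weighted_cell_sum_le:
  fixes R :: real
  assumes R: "R \<ge> 0" and l: "l \<le> i"
  shows "(\<Sum>k\<in>near_cells R e i. 2 * q i (lattice_point i k) / 2 ^ (8 * CARD('n) * (i - l))
        * indicator (dyadic_ball l (lattice_point i k)) y)
    \<le> ((8 * R + 9) * CARD('n)) ^ CARD('n) * 2 ^ (CARD('n) + 17)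
        * ((if v (l - 1) y \<ge> e then q (l - 1) y else 0) / 2 ^ (i - l))"
    (is "?lhs \<le> ?C * _ * (?G / _)")
proof -
  let ?n = "CARD('n)" and ?j = "i - l"
  define P where "P = {k \<in> near_cells R e i. y \<in> dyadic_ball l (lattice_point i k)}"
  have finP: "finite P" unfolding P_def using finite_near_cells[OF R] by simp
  have G0: "?G \<ge> 0" using q_nonneg by simp
  have le: "2 * q i (lattice_point i k) / 2 ^ (8 * ?n * ?j)
      \<le> 2 ^ (?n + 17) * (2 ^ ((?n + 8) * ?j) / 2 ^ (8 * ?n * ?j)) * ?G" if k: "k \<in> P" for k
  proof -
    let ?x = "lattice_point i k"
    have y: "y \<in> dyadic_ball l ?x" and vk: "e \<le> v i ?x"
      using k by (auto simp: P_def near_cells_def)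
    \<comment> \<open>The threshold at the lattice point passes to \<open>y\<close>:
      \<open>v\<close> decreases with the scale, and the shift costs one scale but no
      constant.\<close>
    have "e \<le> v (l - 1) y"
      using vk v_decreasing[OF l, of ?x] q_shift(2)[OF y] by linarith
    then have "?G = q (l - 1) y" by simp
    moreover have "q i ?x \<le> 2 ^ ((?n + 8) * ?j) * (2 ^ (?n + 16) * q (l - 1) y)"
      by (rule order_trans[OF q_grow[OF l] mult_left_mono[OF q_shift(1)[OF y]]]) simp
    ultimately have "2 * q i ?x \<le> 2 ^ (?n + 17) * 2 ^ ((?n + 8) * ?j) * ?G"
      by (simp add: power_add mult_ac)
    from divide_right_mono[OF this, of "2 ^ (8 * ?n * ?j)"] show ?thesis by simp
  qed
  have "?lhs = (\<Sum>k\<in>P. 2 * q i (lattice_point i k) / 2 ^ (8 * ?n * ?j))"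
    unfolding P_def using finite_near_cells[OF R]
    by (intro sum.mono_neutral_cong_right) (auto simp: indicator_def)
  also have "\<dots> \<le> (\<Sum>k\<in>P. 2 ^ (?n + 17) * (2 ^ ((?n + 8) * ?j) / 2 ^ (8 * ?n * ?j)) * ?G)"
    by (rule sum_mono[OF le])
  also have "\<dots> = card P * (2 ^ (?n + 17) * (2 ^ ((?n + 8) * ?j) / 2 ^ (8 * ?n * ?j)) * ?G)" by simp
  also have "\<dots> \<le> (?C * 2 ^ (?n * ?j)) * (2 ^ (?n + 17) * (2 ^ ((?n + 8) * ?j) / 2 ^ (8 * ?n * ?j)) * ?G)"
  proof (rule mult_right_mono)
    have "real (card P) \<le> real (card {k. norm (lattice_point i k) \<le> R + 1 \<and> y \<in> dyadic_ball l (lattice_point i k)})"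
      unfolding of_nat_le_iff
      by (rule card_mono) (auto simp: P_def near_cells_def intro: finite_subset[OF _ lattice_count_le(1)[OF R l]])
    with lattice_count_le(2)[OF R l, of y] show "real (card P) \<le> ?C * 2 ^ (?n * ?j)" by linarith
  qed (use G0 in simp)
  also have "\<dots> = ?C * 2 ^ (?n + 17) * (2 ^ (?n * ?j + (?n + 8) * ?j) / 2 ^ (8 * ?n * ?j) * ?G)"
    by (simp add: power_add mult_ac)
  also have "\<dots> \<le> ?C * 2 ^ (?n + 17) * (1 / 2 ^ ?j * ?G)"
  proof (intro mult_left_mono mult_right_mono G0)
    have "?n * ?j + (?n + 8) * ?j + ?j \<le> 8 * ?n * ?j"
      using mult_right_mono[OF n2, of "6 * ?j"] by (simp add: algebra_simps)
    then have "(2::real) ^ (?n * ?j + (?n + 8) * ?j) * 2 ^ ?j \<le> 2 ^ (8 * ?n * ?j)"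
      unfolding power_add[symmetric] by (rule power_increasing) simp
    then show "2 ^ (?n * ?j + (?n + 8) * ?j) / 2 ^ (8 * ?n * ?j) \<le> 1 / (2::real) ^ ?j"
      by (simp add: field_simps)
  qed (use R in auto)
  finally show ?thesis by simp
qed

text \<open>Unrolling \<open>V\<close> in \<open>A * v ^ (n - 1) = q * V\<close> gives a weighted
  sum of energies of balls. Its weighted overlap at a point \<open>y\<close> is dominated by a
  geometric convolution of the values of \<open>q\<close> at \<open>y\<close>, so it is linear in
  \<open>N\<close> and does not see \<open>L\<close>.\<close>

lemma cell_cost_le:
  fixes R :: real
  assumes R: "R \<ge> 0" and N: "N \<ge> 1" and D: "D \<ge> 1" and w: "(\<Sum>m=1..<L. w m) \<le> D * N"
  defines "e \<equiv> 1 / 2 ^ (D * N)"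
  shows "(\<Sum>i<L. \<Sum>k\<in>near_cells R e i. A i (lattice_point i k) * v i (lattice_point i k) ^ (CARD('n) - 1))
    \<le> ((8 * R + 9) * CARD('n)) ^ CARD('n) * 2 ^ (CARD('n) + 21) * K
      * (5 * D + CARD('n) * D + 5 + 8 * CARD('n)) * N * measure \<nu> UNIV"
proof -
  let ?n = "CARD('n)" and ?x = "\<lambda>i k. lattice_point i k :: real^'n"
  let ?C = "((8 * R + 9) * CARD('n)) ^ CARD('n) * 2 ^ (CARD('n) + 17)"
  define S where "S = 4 * K * (5 * D + CARD('n) * D + 5 + 8 * CARD('n)) * N"
  define c where "c = (\<lambda>(i, k, l). 2 * q i (?x i k) / 2 ^ (8 * ?n * (i - l)))"
  define B where "B = (\<lambda>(i, k, l). dyadic_ball l (?x i k))"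
  define J where "J = Sigma {..<L} (\<lambda>i. near_cells R e i \<times> {..i})"
  have fin: "finite (near_cells R e i)" for i by (rule finite_near_cells[OF R])
  have finJ: "finite J" unfolding J_def using fin by auto
  have J: "(\<Sum>j\<in>J. f j) = (\<Sum>i<L. \<Sum>k\<in>near_cells R e i. \<Sum>l\<le>i. f (i, k, l))" for f :: "_ \<Rightarrow> real"
  proof -
    have "(\<Sum>j\<in>J. f j) = (\<Sum>i<L. \<Sum>p\<in>near_cells R e i \<times> {..i}. f (i, p))"
      unfolding J_def using fin by (subst sum.Sigma) (auto simp: case_prod_beta)
    also have "\<dots> = (\<Sum>i<L. \<Sum>k\<in>near_cells R e i. \<Sum>l\<le>i. f (i, k, l))"
      by (intro sum.cong refl) (simp add: sum.cartesian_product case_prod_beta)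
    finally show ?thesis .
  qed
  have pw: "(\<Sum>j\<in>J. c j * indicator (B j) y) \<le> ?C * (2 * (2 * S))" for y
  proof -
    define g where "g l = (if v (l - 1) y \<ge> e then q (l - 1) y else 0)" for l
    have g0: "g l \<ge> 0" for l using q_nonneg by (simp add: g_def)
    have "(\<Sum>j\<in>J. c j * indicator (B j) y)
        = (\<Sum>i<L. \<Sum>l\<le>i. \<Sum>k\<in>near_cells R e i. c (i, k, l) * indicator (B (i, k, l)) y)"
      unfolding J by (intro sum.cong sum.swap refl)
    also have "\<dots> \<le> (\<Sum>i<L. \<Sum>l\<le>i. ?C * (g l / 2 ^ (i - l)))"
      unfolding c_def B_def g_def prod.case by (intro sum_mono weighted_cell_sum_le R) auto
    also have "\<dots> = ?C * (\<Sum>i<L. \<Sum>l\<le>i. g l / 2 ^ (i - l))"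
      by (simp only: sum_distrib_left)
    also have "\<dots> \<le> ?C * (2 * (\<Sum>l<L. g l))"
      using R by (intro mult_left_mono sum_geometric_convolution_le g0) auto
    also have "\<dots> \<le> ?C * (2 * (2 * S))"
    proof (intro mult_left_mono)
      have sg: "(\<Sum>m<L. g (Suc m)) \<le> S"
      proof -
        have "g (Suc m) = (if v m y \<ge> 1 / 2 ^ (D * N) then q m y else 0)" for m
          by (simp only: g_def e_def diff_Suc_1)
        then show ?thesis using sum_q_le[OF N D w, of y] by (simp only: S_def)
      qed
      \<comment> \<open>The truncated index \<open>l - 1\<close> counts scale 0 twice, hence the
        factor 2.\<close>
      show "(\<Sum>l<L. g l) \<le> 2 * S"
      proof (cases L)
        case 0
        then show ?thesis using sg by simp
      next
        case (Suc L')
        have "(\<Sum>l<L. g l) = g 0 + (\<Sum>m<L'. g (Suc m))" unfolding Suc by (rule sum.lessThan_Suc_shift)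
        also have "g 0 = g (Suc 0)" by (simp add: g_def)
        also have "g (Suc 0) \<le> (\<Sum>m<L. g (Suc m))"
          using Suc g0 by (intro member_le_sum) auto
        also have "(\<Sum>m<L'. g (Suc m)) \<le> (\<Sum>m<L. g (Suc m))"
          using Suc g0 by (intro sum_mono2) auto
        finally show ?thesis using sg by linarith
      qed
    qed (use R in auto)
    finally show ?thesis .
  qed
  have "A i x * v i x ^ (?n - 1) \<le> (\<Sum>l\<le>i. 2 * q i x / 2 ^ (8 * ?n * (i - l)) * measure \<nu> (dyadic_ball l x))" for i x
  proof -
    have "A i x * v i x ^ (?n - 1) = q i x * V i x"
      using power_eq_if[of "v i x" ?n] v_power[of i x] v_pos[of i x] by (simp add: q_def)
    also have "\<dots> \<le> q i x * (2 * (\<Sum>l\<le>i. measure \<nu> (dyadic_ball l x) / 2 ^ (8 * ?n * (i - l))))"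
      by (rule mult_left_mono[OF V_unroll q_nonneg])
    also have "\<dots> = (\<Sum>l\<le>i. 2 * q i x / 2 ^ (8 * ?n * (i - l)) * measure \<nu> (dyadic_ball l x))"
      by (simp add: sum_distrib_left mult_ac)
    finally show ?thesis .
  qed
  then have "(\<Sum>i<L. \<Sum>k\<in>near_cells R e i. A i (?x i k) * v i (?x i k) ^ (?n - 1)) \<le> (\<Sum>j\<in>J. c j * measure \<nu> (B j))"
    unfolding J c_def B_def prod.case by (intro sum_mono)
  also have "\<dots> \<le> ?C * (2 * (2 * S)) * measure \<nu> (space \<nu>)"
    by (rule nu.sum_measure_le[OF finJ _ pw]) (auto simp: B_def)
  also have "space \<nu> = UNIV" using sets_eq_imp_space_eq[OF sets_nu] by simp
  finally show ?thesis by (simp add: S_def power_add algebra_simps)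
qed

end

section \<open>Tails of the regularized potential\<close>

lemma sum_regularized_le:
  fixes s g :: "nat \<Rightarrow> real"
  assumes "\<And>m. s (Suc m) \<le> g (Suc m) + s m / 2" "\<And>m. s m \<ge> 0"
  shows "(\<Sum>i<k. s (Suc (i + p))) \<le> 2 * (\<Sum>i<k. g (Suc (i + p))) + s p"
proof -
  have "(\<Sum>i<k. s (Suc (i + p))) + s (k + p) \<le> 2 * (\<Sum>i<k. g (Suc (i + p))) + s p"
  proof (induction k)
    case (Suc k)
    then show ?case using assms(1)[of "k + p"] by simp
  qed simp
  with assms(2)[of "k + p"] show ?thesis by linarith
qed

declare reg_mass.simps(2) [simp del]

context mass_energy
begin

definition "T m x = (\<Sum>l. A (l + m) x)"

lemma A_Suc_le: "A (Suc m) x \<le> \<alpha> (Suc m) x + A m x / 2"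
  using A_pos[of m x] by (simp add: reg_mass.simps(2))

lemma summable_A:
  assumes "summable (\<lambda>l. \<alpha> l x)"
  shows "summable (\<lambda>l. A (l + m) x)"
proof -
  have "summable (\<lambda>i. A (Suc i) x)"
  proof (rule summableI_nonneg_bounded)
    fix k
    have "(\<Sum>i<k. A (Suc i) x) \<le> 2 * (\<Sum>i<k. \<alpha> (Suc i) x) + A 0 x"
      using sum_regularized_le[where s="\<lambda>m. A m x" and g="\<lambda>m. \<alpha> m x" and k=k and p=0] A_Suc_le A_pos
      by (simp add: less_imp_le)
    also have "(\<Sum>i<k. \<alpha> (Suc i) x) \<le> (\<Sum>i. \<alpha> (Suc i) x)"
      by (rule sum_le_suminf) (use summable_ignore_initial_segment[OF assms, of 1] alpha_nonneg in auto)
    finally show "(\<Sum>i<k. A (Suc i) x) \<le> 2 * (\<Sum>i. \<alpha> (Suc i) x) + A 0 x" by simp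
  qed (use A_pos in \<open>auto intro: less_imp_le\<close>)
  then have "summable (\<lambda>l. A l x)" using summable_Suc_iff[of "\<lambda>l. A l x"] by simp
  then show ?thesis by (rule summable_ignore_initial_segment)
qed

context
  fixes x :: "real^'n"
  assumes sum: "summable (\<lambda>l. \<alpha> l x)"
begin

lemma T_eq: "T m x = A m x + T (Suc m) x"
  unfolding T_def using suminf_split_head[OF summable_A[OF sum, of m]] by simp

lemma T_pos: "T m x > 0"
  unfolding T_def using A_pos by (intro suminf_pos summable_A sum) auto

lemma A_le_T: "A m x \<le> T m x"
  using T_eq[of m] T_pos[of "Suc m"] by simp

lemma T_decreasing: "l \<le> m \<Longrightarrow> T m x \<le> T l x"
proof (induction m rule: dec_induct)
  case (step m)
  then show ?case using T_eq[of m] A_pos[of m x] by simp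
qed simp

lemma suminf_alpha_le_T: "(\<Sum>l. \<alpha> (l + m) x) \<le> T m x"
  unfolding T_def by (intro suminf_le summable_A A_ge_alpha sum summable_ignore_initial_segment[OF sum])

lemma T_split: "l \<le> m \<Longrightarrow> T l x = (\<Sum>i=l..<m. A i x) + T m x"
proof (induction m rule: dec_induct)
  case (step m)
  then show ?case using T_eq[of m] by simp
qed simp

text \<open>\<open>A m x\<close> is the decrement of \<open>T\<close>, so the quotients
  \<open>A / T\<close> sum like the logarithmic derivative of \<open>T\<close>. The constant is 2^9
  + 1: since \<open>A m\<close> is at most 2^9 times \<open>A (Suc m)\<close>, one step cannot
  shrink \<open>T\<close> by more than that factor. Without the trace of coarser scales in
  \<open>A\<close> no such bound would be available.\<close>

lemma T_ratio: "ln (T m x) - ln (T (Suc m) x) \<le> 513 * (A m x / T m x)"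
proof -
  have "A m x \<le> 2^9 * T (Suc m) x"
    by (rule order_trans[OF A_Suc_ge mult_left_mono[OF A_le_T]]) simp
  then have le: "T m x \<le> 513 * T (Suc m) x" using T_eq[of m] by simp
  have "ln (T m x) - ln (T (Suc m) x) = ln (T m x / T (Suc m) x)"
    using T_pos[of m] T_pos[of "Suc m"] by (simp add: ln_div)
  also have "\<dots> \<le> T m x / T (Suc m) x - 1"
    using T_pos[of m] T_pos[of "Suc m"] by (intro ln_le_minus_one) simp
  also have "\<dots> = A m x / T (Suc m) x" using T_eq[of m] T_pos[of "Suc m"] by (simp add: field_simps)
  also have "\<dots> \<le> A m x / (T m x / 513)"
    using le T_pos[of m] T_pos[of "Suc m"] A_pos[of m x] by (intro divide_left_mono) auto
  finally show ?thesis by (simp add: mult.commute)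
qed

lemma T_Suc_le: "T (Suc p) x \<le> 2 * (\<Sum>i. \<alpha> (Suc (i + p)) x) + A p x"
proof -
  have s1: "summable (\<lambda>i. A (Suc (i + p)) x)" using summable_A[OF sum, of "Suc p"] by simp
  have s2: "summable (\<lambda>i. \<alpha> (Suc (i + p)) x)"
    using sum summable_iff_shift[of "\<lambda>i. \<alpha> i x" "Suc p"] by simp
  have "(\<Sum>i<k. A (Suc (i + p)) x) \<le> 2 * (\<Sum>i. \<alpha> (Suc (i + p)) x) + A p x" for k
  proof -
    have "(\<Sum>i<k. A (Suc (i + p)) x) \<le> 2 * (\<Sum>i<k. \<alpha> (Suc (i + p)) x) + A p x"
      using sum_regularized_le[where s="\<lambda>m. A m x" and g="\<lambda>m. \<alpha> m x" and k=k and p=p] A_Suc_le A_pos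
      by (simp add: less_imp_le)
    also have "(\<Sum>i<k. \<alpha> (Suc (i + p)) x) \<le> (\<Sum>i. \<alpha> (Suc (i + p)) x)"
      by (rule sum_le_suminf) (use s2 alpha_nonneg in auto)
    finally show ?thesis by simp
  qed
  then have "(\<Sum>i. A (Suc (i + p)) x) \<le> 2 * (\<Sum>i. \<alpha> (Suc (i + p)) x) + A p x"
    by (intro suminf_le_const s1)
  then show ?thesis by (simp add: T_def)
qed

lemma A_add_le: "A (m + j) x \<le> A m x / 2 ^ (9 * j) + (\<Sum>i<j. \<alpha> (Suc (i + m)) x)"
proof (induction j)
  case (Suc j)
  have "A (m + j) x / 2^9 \<le> A m x / 2 ^ (9 * j) / 2^9 + (\<Sum>i<j. \<alpha> (Suc (i + m)) x) / 2^9"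
    using divide_right_mono[OF Suc, of "2^9"] by (simp add: add_divide_distrib)
  moreover have "(\<Sum>i<j. \<alpha> (Suc (i + m)) x) / 2^9 \<le> (\<Sum>i<j. \<alpha> (Suc (i + m)) x)"
    using sum_nonneg[of "{..<j}" "\<lambda>i. \<alpha> (Suc (i + m)) x"] alpha_nonneg by simp
  ultimately show ?case by (simp add: power_add add.commute reg_mass.simps(2))
qed simp

text \<open>At scale \<open>M\<close> the trace of coarser scales still has size up to
  \<open>4 * K\<close>. After \<open>2 * N\<close> further scales it is damped by 2^(18N), and from
  there on the tail of \<psi> dominates.\<close>

lemma T_tail_le:
  assumes \<psi>: "summable \<psi>" "\<And>m. m \<ge> M \<Longrightarrow> \<alpha> m x \<le> 2 * K * \<psi> m"
    and tail: "(\<Sum>m. \<psi> (m + M)) \<le> (1/2) ^ (16 * N)" and \<psi>0: "\<And>m. \<psi> m \<ge> 0"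
  shows "T (M + 2 * N + 1) x \<le> 10 * K * (1/2) ^ (16 * N)"
proof -
  let ?p = "M + 2 * N"
  have s\<alpha>: "summable (\<lambda>i. \<alpha> (i + k) x)" for k by (rule summable_ignore_initial_segment[OF sum])
  have al: "(\<Sum>i. \<alpha> (i + M) x) \<le> 2 * K * (1/2) ^ (16 * N)"
  proof -
    have "(\<Sum>i. \<alpha> (i + M) x) \<le> (\<Sum>i. 2 * K * \<psi> (i + M))"
      using \<psi> s\<alpha> by (intro suminf_le summable_mult) (auto simp: summable_iff_shift)
    also have "\<dots> = 2 * K * (\<Sum>i. \<psi> (i + M))"
      using \<psi> by (intro suminf_mult) (simp add: summable_iff_shift)
    also have "\<dots> \<le> 2 * K * (1/2) ^ (16 * N)"
      using tail K1 by (intro mult_left_mono) auto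
    finally show ?thesis .
  qed
  have sub: "(\<Sum>i<2 * N. \<alpha> (Suc (i + M)) x) \<le> (\<Sum>i. \<alpha> (i + M) x)"
  proof -
    have "(\<Sum>i<2 * N. \<alpha> (Suc (i + M)) x) \<le> (\<Sum>i<Suc (2 * N). \<alpha> (i + M) x)"
      unfolding sum.lessThan_Suc_shift using alpha_nonneg[of M x] by simp
    also have "\<dots> \<le> (\<Sum>i. \<alpha> (i + M) x)" using alpha_nonneg s\<alpha> by (intro sum_le_suminf) auto
    finally show ?thesis .
  qed
  have sub2: "(\<Sum>i. \<alpha> (Suc (i + ?p)) x) \<le> (\<Sum>i. \<alpha> (i + M) x)"
  proof -
    have "(\<Sum>i. \<alpha> (i + M) x) = (\<Sum>i. \<alpha> (i + (2 * N + 1) + M) x) + (\<Sum>i<2 * N + 1. \<alpha> (i + M) x)"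
      by (rule suminf_split_initial_segment[OF s\<alpha>])
    moreover have "0 \<le> (\<Sum>i<2 * N + 1. \<alpha> (i + M) x)" using alpha_nonneg by (intro sum_nonneg) auto
    moreover have "(\<Sum>i. \<alpha> (Suc (i + ?p)) x) = (\<Sum>i. \<alpha> (i + (2 * N + 1) + M) x)"
      by (intro arg_cong[where f=suminf] ext arg_cong[where f="\<lambda>k. \<alpha> k x"]) simp
    ultimately show ?thesis by linarith
  qed
  have "A ?p x \<le> A M x / 2 ^ (9 * (2 * N)) + (\<Sum>i<2 * N. \<alpha> (Suc (i + M)) x)" by (rule A_add_le)
  also have "A M x / 2 ^ (9 * (2 * N)) \<le> 4 * K * (1/2) ^ (16 * N)"
  proof -
    have "4 * K * v M x \<le> 4 * K * 1" using v_le_1 K1 by (intro mult_left_mono) auto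
    with A_le_v[of M x] have "A M x \<le> 4 * K" by simp
    then have "A M x / 2 ^ (9 * (2 * N)) \<le> 4 * K / 2 ^ (16 * N)"
      using K1 by (intro frac_le) auto
    then show ?thesis by (simp add: power_divide)
  qed
  finally have "A ?p x \<le> 6 * K * (1/2) ^ (16 * N)" using sub al by linarith
  with T_Suc_le[of ?p] sub2 al show ?thesis by simp
qed

text \<open>\<open>T\<close> falls from at least 2^(-10N) at scale \<open>N\<close>, because
  \<open>A\<close> starts above 2^(-N) and loses at most 2^9 per scale, to at most 2^(-15N) at the
  stopping scale \<open>M\<close>. By \<open>T_ratio\<close> the scales in between therefore carry a
  sum of at least \<open>N / 200\<close>. Where \<open>T\<close> exceeds \<open>s * v\<close>, the
  quotient \<open>A / T\<close> is at most \<open>A / v\<close> divided by \<open>s\<close>, and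
  \<open>s\<close> is chosen such that these scales take away no more than
  \<open>N / 400\<close>.\<close>

lemma sum_A_div_T_ge:
  assumes N: "N \<ge> 1" and D: "D \<ge> 1" and NL: "N \<le> L"
    and w: "(\<Sum>m=1..<L. w m) \<le> real ((D + 16) * N)"
    and L: "real L \<le> 2 ^ (D * N)"
    and TL: "T L x \<le> 10 * K * (1/2) ^ (16 * N)"
    and big: "14 * K \<le> 2 ^ N" "1 \<le> A 0 x * 2 ^ N"
    and s: "s = 1600 * K * (5 * (D + 16) + CARD('n) * (D + 16) + 5 + 8 * CARD('n))"
  shows "(\<Sum>m\<in>{m\<in>{N..<L}. v m x \<ge> 1 / 2 ^ ((D + 16) * N) \<and> T m x \<le> s * v m x}. A m x / T m x)
    \<ge> N / 400"
proof -
  define e :: real where "e = 1 / 2 ^ ((D + 16) * N)"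
  define M where "M = (LEAST m. m \<ge> N \<and> (m \<ge> L \<or> v m x < e))"
  have M: "M \<ge> N \<and> (M \<ge> L \<or> v M x < e)"
    unfolding M_def by (rule LeastI[of _ L]) (use NL in auto)
  have M_le: "M \<le> L" unfolding M_def by (rule Least_le) (use NL in auto)
  have M1: "m < L \<and> v m x \<ge> e" if "m < M" "N \<le> m" for m
    using not_less_Least[of m "\<lambda>m. m \<ge> N \<and> (m \<ge> L \<or> v m x < e)"] that unfolding M_def by auto
  have e: "2 ^ (D * N) * e = (1/2) ^ (16 * N)"
    by (simp add: e_def power_add power_divide algebra_simps)
  have TM: "T M x \<le> 14 * K * (1/2) ^ (16 * N)"
  proof (cases "M = L")
    case True
    have "10 * K * (1/2) ^ (16 * N) \<le> 14 * K * (1/2) ^ (16 * N)"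
      using K1 by (intro mult_right_mono) auto
    with True TL show ?thesis by simp
  next
    case False
    then have vM: "v M x < e" and "M < L" using M M_le by auto
    \<comment> \<open>Beyond \<open>M\<close> the energy is below the threshold \<open>e\<close>.
      There are at most \<open>2 ^ (D * N)\<close> such scales, each contributing at most
      \<open>4 * K * e\<close>; the summand 16 in the exponent of \<open>e\<close> leaves 2^(-16N)
      after this count.\<close>
    have "(\<Sum>i=M..<L. A i x) \<le> (\<Sum>i=M..<L. 4 * K * e)"
    proof (rule sum_mono)
      fix i assume "i \<in> {M..<L}"
      then have "v i x \<le> e" using v_decreasing[of M i x] vM by simp
      then have "4 * K * v i x \<le> 4 * K * e" using K1 by (intro mult_left_mono) auto
      with A_le_v[of i x] show "A i x \<le> 4 * K * e" by linarith
    qed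
    also have "\<dots> = 4 * K * (real (L - M) * e)" by simp
    also have "\<dots> \<le> 4 * K * (2 ^ (D * N) * e)"
      using L K1 by (intro mult_left_mono mult_right_mono) (auto simp: e_def)
    finally show ?thesis using T_split[OF M_le] TL e by simp
  qed
  have TN: "T N x \<ge> (1/2) ^ (10 * N)"
  proof -
    have "A 0 x / 2 ^ (9 * m) \<le> A m x" for m
    proof (induction m)
      case (Suc m)
      have "A 0 x / 2 ^ (9 * m) / 2^9 \<le> A m x / 2^9" by (rule divide_right_mono[OF Suc]) simp
      also have "\<dots> \<le> A (Suc m) x" using A_Suc_ge[of m x] by simp
      finally show ?case by (simp add: power_add mult.commute)
    qed simp
    then have "A 0 x / 2 ^ (9 * N) \<le> T N x" using A_le_T[of N] order_trans by blast
    moreover have "(1/2) ^ (10 * N) \<le> A 0 x / 2 ^ (9 * N)"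
    proof -
      have "(1/2::real) ^ (10 * N) = 1 / 2 ^ N / 2 ^ (9 * N)"
        by (simp add: power_divide flip: power_add)
      also have "\<dots> \<le> A 0 x / 2 ^ (9 * N)"
        using big(2) by (intro divide_right_mono) (auto simp: field_simps)
      finally show ?thesis .
    qed
    ultimately show ?thesis by linarith
  qed
  have lnT: "ln (T N x) - ln (T M x) \<ge> 5 * N * ln 2"
  proof -
    have "T M x \<le> 2 ^ N * (1/2) ^ (16 * N)"
      by (rule order_trans[OF TM mult_right_mono[OF big(1)]]) simp
    also have "\<dots> = (1/2) ^ (15 * N)"
      by (simp add: power_divide divide_simps flip: power_add)
    finally have "ln (T M x) \<le> ln ((1/2) ^ (15 * N))"
      using T_pos[of M] by (subst ln_le_cancel_iff) auto
    moreover have "ln (T N x) \<ge> ln ((1/2) ^ (10 * N))"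
      using TN T_pos[of N] by (subst ln_le_cancel_iff) auto
    ultimately show ?thesis by (simp add: ln_realpow ln_div)
  qed
  have all: "(\<Sum>m=N..<M. A m x / T m x) \<ge> N / 200"
  proof -
    have "ln (T N x) - ln (T M x) = (\<Sum>m=N..<M. ln (T m x) - ln (T (Suc m) x))"
      using sum_Suc_diff'[of N M "\<lambda>m. - ln (T m x)"] M by simp
    also have "\<dots> \<le> (\<Sum>m=N..<M. 513 * (A m x / T m x))" by (rule sum_mono[OF T_ratio])
    also have "\<dots> = 513 * (\<Sum>m=N..<M. A m x / T m x)" by (simp add: sum_distrib_left)
    finally have "5 * N * ln 2 \<le> 513 * (\<Sum>m=N..<M. A m x / T m x)" using lnT by linarith
    moreover have "5 * N * (2/3) \<le> 5 * N * ln 2" using ln2_ge_two_thirds by (intro mult_left_mono) auto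
    ultimately show ?thesis by simp
  qed
  have s0: "s > 0" unfolding s using K1 by (simp add: add_pos_nonneg)
  let ?G = "{m\<in>{N..<M}. T m x \<le> s * v m x}" and ?H = "{m\<in>{N..<M}. \<not> T m x \<le> s * v m x}"
  have "(\<Sum>m\<in>?H. A m x / T m x) \<le> (\<Sum>m\<in>?H. (A m x / v m x) / s)"
  proof (rule sum_mono)
    fix m assume "m \<in> ?H"
    then have "A m x / T m x \<le> A m x / (s * v m x)"
      using A_pos[of m x] v_pos[of m x] s0 by (intro divide_left_mono) (auto intro: less_imp_le mult_pos_pos T_pos)
    then show "A m x / T m x \<le> (A m x / v m x) / s" by (simp add: mult.commute)
  qed
  also have "\<dots> \<le> (\<Sum>m<M. if v m x \<ge> e then q m x else 0) / s"
    unfolding sum_divide_distrib[symmetric] using s0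
  proof (intro divide_right_mono)
    show "(\<Sum>m\<in>?H. A m x / v m x) \<le> (\<Sum>m<M. if v m x \<ge> e then q m x else 0)"
    proof (rule sum_le_included[where i="\<lambda>m. m"])
      show "\<forall>m\<in>?H. \<exists>k\<in>{..<M}. k = m \<and> A m x / v m x \<le> (if v k x \<ge> e then q k x else 0)"
        using M1 by (auto simp: q_def)
    qed (use q_nonneg in auto)
  qed auto
  also have "\<dots> \<le> (s / 400 * N) / s"
  proof (intro divide_right_mono)
    have "(\<Sum>m=1..<M. w m) \<le> (\<Sum>m=1..<L. w m)"
      using M_le by (intro sum_mono2) (auto intro!: less_imp_le[OF w_pos])
    with w have wM: "(\<Sum>m=1..<M. w m) \<le> real ((D + 16) * N)" by linarith
    have "(\<Sum>m<M. if v m x \<ge> e then q m x else 0)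
        \<le> 4 * K * (5 * (D + 16) + CARD('n) * (D + 16) + 5 + 8 * CARD('n)) * N"
      using sum_q_le[of N "D + 16" M x] N wM by (simp add: e_def)
    then show "(\<Sum>m<M. if v m x \<ge> e then q m x else 0) \<le> s / 400 * N" unfolding s by simp
  qed (use s0 in auto)
  also have "\<dots> = N / 400" using s0 by simp
  finally have H: "(\<Sum>m\<in>?H. A m x / T m x) \<le> N / 400" .
  have "(\<Sum>m=N..<M. A m x / T m x) = (\<Sum>m\<in>?G. A m x / T m x) + (\<Sum>m\<in>?H. A m x / T m x)"
    by (subst sum.union_disjoint[symmetric]) (auto intro!: sum.cong)
  with all H have "(\<Sum>m\<in>?G. A m x / T m x) \<ge> N / 400" by simp
  also have "?G = {m\<in>{N..<L}. v m x \<ge> 1 / 2 ^ ((D + 16) * N) \<and> T m x \<le> s * v m x}"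
  proof -
    have "m < M" if "m < L" "N \<le> m" "v m x \<ge> e" for m
    proof (rule ccontr)
      assume "\<not> m < M"
      then have "M \<le> m" by simp
      with M that v_decreasing[of M m x] show False by linarith
    qed
    then show ?thesis using M1 unfolding e_def by auto
  qed
  finally show ?thesis .
qed

end

end

text \<open>The factors are, in this order, the diameters of the enlarged target balls, the lower
  bound \<open>N / 400\<close> for the weight, the constants of the weights together with the
  geometric sum over \<open>p\<close>, the power \<open>s ^ (n - 1)\<close>, and the bound of
  \<open>cell_cost_le\<close>. The parameter \<open>N\<close> has cancelled, and so has the number
  of scales.\<close>

definition luzin_const :: "nat \<Rightarrow> real \<Rightarrow> real \<Rightarrow> nat \<Rightarrow> real \<Rightarrow> real" where
  "luzin_const n K R D C0 =
    (let W = real (5 * (D + 16) + n * (D + 16) + 5 + 8 * n) in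
      (20 * C0) ^ n * 400 * 2 ^ (n + 2) * (1600 * K * W) ^ (n - 1) *
      (((8 * R + 9) * n) ^ n * 2 ^ (n + 21) * K * W))"

text \<open>Each lattice point at scale \<open>m\<close> contributes target balls with radii proportional to \<open>s v / 2 ^ p\<close>, weighted by
  \<open>A m\<close> over the radius. The smallest of them whose radius is still above the order of \<open>T m z\<close> contains \<open>F z\<close>, with weight
  at least \<open>A m z / T m z\<close>; these quotients add up to the logarithm of \<open>T N z / T L z\<close>, of order \<open>N\<close>.\<close>
lemma (in mass_energy) cover_of_image:
  fixes F :: "real^'n \<Rightarrow> 'b::euclidean_space" and S :: "(real^'n) set" and c :: "nat \<Rightarrow> ('n \<Rightarrow> int) \<Rightarrow> 'b"
  assumes R: "R \<ge> 0" "S \<subseteq> ball 0 R" and C0: "C0 > 0" and \<delta>: "\<delta> > 0" and D: "D \<ge> 1"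
    and N: "N \<ge> 1" and NL: "N \<le> L"
    and w: "(\<Sum>m=1..<L. w m) \<le> real ((D + 16) * N)"
    and L: "real L \<le> 2 ^ (D * N)"
    and sum: "\<And>z. z \<in> S \<Longrightarrow> summable (\<lambda>l. \<alpha> l z)"
    and TL: "\<And>z. z \<in> S \<Longrightarrow> T L z \<le> 10 * K * (1/2) ^ (16 * N)"
    and T\<delta>: "\<And>z. z \<in> S \<Longrightarrow> T N z \<le> \<delta> / (40 * C0)"
    and big: "14 * K \<le> 2 ^ N" "1 \<le> measure \<mu> UNIV * 2 ^ N"
    and near: "\<And>z m k. z \<in> S \<Longrightarrow> m \<ge> N \<Longrightarrow> dist z (lattice_point (m - 1) k) \<le> (1/2) ^ (m + 1) \<Longrightarrow>
      norm (F z - c m k) \<le> C0 * (\<Sum>l. \<alpha> (l + m) z)"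
  shows "hausdorff_delta (\<lambda>t. ennreal (t ^ CARD('n))) \<delta> (F ` S)
    \<le> ennreal (luzin_const CARD('n) K R D C0 * measure \<nu> UNIV)"
proof -
  let ?n = "CARD('n)"
  define W :: real where "W = real (5 * (D + 16) + ?n * (D + 16) + 5 + 8 * ?n)"
  define s where "s = 1600 * K * W"
  define e :: real where "e = 1 / 2 ^ ((D + 16) * N)"
  have W0: "W > 0" unfolding W_def of_nat_0_less_iff by simp
  then have s0: "s > 0" using K1 unfolding s_def by simp
  have A0: "A 0 x = measure \<mu> UNIV" for x by (simp add: scaled_mass_def)
  define x where "x = (\<lambda>i k. lattice_point i k :: real^'n)"
  \<comment> \<open>The tail \<open>T m z\<close> with \<open>m < L\<close> is at least
    \<open>A m z\<close> and hence at least the total mass divided by 2^(9L). A radius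
    \<open>s * v / 2 ^ p\<close> that is not smaller than \<open>T m z\<close> therefore has
    \<open>p < P\<close>, which keeps the family finite.\<close>
  obtain P where P: "s * 2 ^ (9 * L) / measure \<mu> UNIV < 2 ^ P"
    using real_arch_pow[of 2 "s * 2 ^ (9 * L) / measure \<mu> UNIV"] by auto
  define \<rho> where "\<rho> = (\<lambda>(i, k, p). s * v i (x i k) / 2 ^ p)"
  \<comment> \<open>Of the factor 2^(n+1), 2^n pays for moving \<open>A\<close> from
    \<open>z\<close> to the lattice point and 2 for the radius being less than twice
    \<open>T m z\<close>.\<close>
  define \<omega> where "\<omega> = (\<lambda>(i, k, p). 2 ^ (?n + 1) * A i (x i k) / \<rho> (i, k, p))"
  define I0 where "I0 = Sigma {..<L} (\<lambda>i. near_cells R e i \<times> {..<P})"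
  define I where "I = {j \<in> I0. 20 * C0 * \<rho> j \<le> \<delta>}"
  define a where "a = (\<lambda>(i, k, p::nat). c (Suc i) k)"
  have fin: "finite (near_cells R e i)" for i by (rule finite_near_cells[OF R(1)])
  have finI0: "finite I0" unfolding I0_def using fin by auto
  then have finI: "finite I" unfolding I_def by simp
  have \<rho>0: "\<rho> j > 0" for j
    using s0 v_pos by (auto simp: \<rho>_def split: prod.split)
  have \<omega>0: "\<omega> j \<ge> 0" for j
  proof -
    obtain i k p where j: "j = (i, k, p)" by (cases j)
    show ?thesis using \<rho>0[of "(i, k, p)"] A_pos[of i "x i k"] by (simp add: j \<omega>_def)
  qed
  have cover: "(\<Sum>j\<in>{j\<in>I. y \<in> ball (a j) (2 * C0 * \<rho> j)}. \<omega> j) \<ge> N / 400" if y: "y \<in> F ` S" for y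
  proof -
    obtain z where z: "z \<in> S" "y = F z" using y by auto
    note sumz = sum[OF z(1)]
    define G where "G = {m\<in>{N..<L}. v m z \<ge> e \<and> T m z \<le> s * v m z}"
    have "\<exists>j. j \<in> I \<and> fst j = m - 1 \<and> y \<in> ball (a j) (2 * C0 * \<rho> j) \<and> A m z / T m z \<le> \<omega> j" if m: "m \<in> G" for m
    proof -
      have m1: "m \<ge> N" "m < L" "v m z \<ge> e" "T m z \<le> s * v m z" "m \<ge> 1" "Suc (m - 1) = m"
        using m N by (auto simp: G_def)
      obtain k where k: "dist z (x (m - 1) k) \<le> (1/2)^(m - 1 + 2)"
        using lattice_point_near[of z "m - 1"] unfolding x_def by auto
      have k': "dist z (x (m - 1) k) \<le> (1/2)^(m + 1)" using k m1(5,6) by simp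
      have km: "dist z (x (m - 1) k) \<le> (1/2)^Suc (m - 1)"
        using k' unfolding m1(6) by (rule order_trans) simp
      have vz: "v m z \<le> v (m - 1) (x (m - 1) k)" using v_shift[OF km] m1(6) by simp
      have Az: "A m z \<le> 2 ^ ?n * A (m - 1) (x (m - 1) k)" using A_shift[OF km] m1(6) by simp
      have Tp: "T m z > 0" by (rule T_pos[OF sumz])
      let ?r = "\<lambda>p. s * v (m - 1) (x (m - 1) k) / 2 ^ p"
      have ex: "\<exists>p. ?r (Suc p) < T m z"
      proof -
        obtain p where "s * v (m - 1) (x (m - 1) k) / T m z < 2 ^ p"
          using real_arch_pow[of 2 "s * v (m - 1) (x (m - 1) k) / T m z"] by auto
        then have "?r p < T m z" using Tp by (simp add: divide_less_eq mult.commute)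
        moreover have "?r (Suc p) \<le> ?r p"
          using s0 v_pos[of "m - 1" "x (m - 1) k"] by (intro divide_left_mono) auto
        ultimately show ?thesis by (intro exI[of _ p]) linarith
      qed
      define p where "p = (LEAST p. ?r (Suc p) < T m z)"
      have p1: "?r (Suc p) < T m z" unfolding p_def by (rule LeastI_ex[OF ex])
      have p2: "T m z \<le> ?r p"
      proof (cases p)
        \<comment> \<open>If already the first halving goes below \<open>T m z\<close>, the radius
          is \<open>s * v\<close> itself; here the restriction to scales with
          \<open>T m z \<le> s * v m z\<close> is needed.\<close>
        case 0
        have "s * v m z \<le> s * v (m - 1) (x (m - 1) k)" using vz s0 by (intro mult_left_mono) auto
        then show ?thesis using m1(4) 0 by simp
      next
        case (Suc p')
        then have "\<not> ?r (Suc p') < T m z"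
          using not_less_Least[of p' "\<lambda>p. ?r (Suc p) < T m z"] unfolding p_def by simp
        then show ?thesis using Suc by simp
      qed
      let ?j = "(m - 1, k, p)"
      have \<rho>j: "\<rho> ?j = ?r p" by (simp add: \<rho>_def)
      have "p < P"
      proof -
        have "A 0 z / 2 ^ (9 * l) \<le> A l z" for l
        proof (induction l)
          case (Suc l)
          have "A 0 z / 2 ^ (9 * l) / 2^9 \<le> A l z / 2^9" by (rule divide_right_mono[OF Suc]) simp
          also have "\<dots> \<le> A (Suc l) z" using A_Suc_ge[of l z] by simp
          finally show ?case by (simp add: power_add mult.commute)
        qed simp
        from this[of m] have "measure \<mu> UNIV / 2 ^ (9 * m) \<le> T m z"
          using A_le_T[OF sumz, of m] unfolding A0 by linarith
        moreover have "measure \<mu> UNIV / 2 ^ (9 * L) \<le> measure \<mu> UNIV / 2 ^ (9 * m)"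
          using m1(2) by (intro divide_left_mono) auto
        moreover have "?r p \<le> s / 2 ^ p"
          using v_le_1[of "m - 1" "x (m - 1) k"] s0 by (intro divide_right_mono) (auto simp: mult_left_le)
        ultimately have "measure \<mu> UNIV / 2 ^ (9 * L) \<le> s / 2 ^ p" using p2 by linarith
        then have "2 ^ p \<le> s * 2 ^ (9 * L) / measure \<mu> UNIV" using mu_pos by (simp add: field_simps)
        with P have "(2::real) ^ p < 2 ^ P" by linarith
        then show ?thesis by simp
      qed
      moreover have "k \<in> near_cells R e (m - 1)"
      proof -
        have "norm (x (m - 1) k) \<le> norm z + dist z (x (m - 1) k)"
          using norm_triangle_ineq4[of z "z - x (m - 1) k"] by (simp add: dist_norm)
        moreover have "norm z < R" using R(2) z(1) by auto
        moreover have "(1/2::real)^(m + 1) \<le> 1" by (rule power_le_one) auto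
        ultimately have "norm (x (m - 1) k) \<le> R + 1" using k' by linarith
        then show ?thesis using vz m1(3) unfolding near_cells_def x_def by auto
      qed
      ultimately have "?j \<in> I0" using m1(2) by (auto simp: I0_def)
      have \<rho>T: "\<rho> ?j < 2 * T m z" using p1 unfolding \<rho>j by (simp add: field_simps)
      also have "\<dots> \<le> 2 * T N z" using T_decreasing[OF sumz m1(1)] by simp
      also have "\<dots> \<le> 2 * (\<delta> / (40 * C0))" using T\<delta>[OF z(1)] by simp
      finally have "20 * C0 * \<rho> ?j \<le> \<delta>" using C0 by (simp add: field_simps)
      then have "?j \<in> I" using \<open>?j \<in> I0\<close> by (simp add: I_def)
      moreover have "y \<in> ball (a ?j) (2 * C0 * \<rho> ?j)"
      proof -
        have "norm (F z - c m k) \<le> C0 * (\<Sum>l. \<alpha> (l + m) z)"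
          using near[OF z(1) m1(1)] k' unfolding x_def by blast
        also have "\<dots> \<le> C0 * T m z" using suminf_alpha_le_T[OF sumz] C0 by simp
        also have "\<dots> \<le> C0 * \<rho> ?j" using p2 C0 unfolding \<rho>j by (intro mult_left_mono) auto
        also have "\<dots> < 2 * C0 * \<rho> ?j" using C0 \<rho>0[of ?j] by simp
        finally show ?thesis using z(2) m1(6) by (simp add: a_def dist_norm norm_minus_commute)
      qed
      moreover have "A m z / T m z \<le> \<omega> ?j"
      proof -
        have "A m z / T m z \<le> (2 ^ ?n * A (m - 1) (x (m - 1) k)) / (\<rho> ?j / 2)"
          using Az \<rho>T \<rho>0[of ?j] A_pos[of m z] by (intro frac_le) auto
        also have "\<dots> = \<omega> ?j" by (simp add: \<omega>_def mult_ac)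
        finally show ?thesis .
      qed
      ultimately show ?thesis by (intro exI[of _ ?j]) auto
    qed
    then obtain j where j: "\<And>m. m \<in> G \<Longrightarrow> j m \<in> I \<and> fst (j m) = m - 1 \<and>
        y \<in> ball (a (j m)) (2 * C0 * \<rho> (j m)) \<and> A m z / T m z \<le> \<omega> (j m)" by metis
    \<comment> \<open>The label of a ball records its scale, so the balls found at different scales
      are distinct and their weights add up.\<close>
    have injj: "inj_on j G"
    proof (rule inj_onI)
      fix m m' assume "m \<in> G" "m' \<in> G" "j m = j m'"
      then have "m - 1 = m' - 1" using j by metis
      moreover have "m \<ge> 1" "m' \<ge> 1" using \<open>m \<in> G\<close> \<open>m' \<in> G\<close> N by (auto simp: G_def)
      ultimately show "m = m'" by simp
    qed
    have "N / 400 \<le> (\<Sum>m\<in>G. A m z / T m z)"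
      unfolding G_def e_def
      by (rule sum_A_div_T_ge[OF sumz N D NL w L TL[OF z(1)] big(1)])
        (use big(2) in \<open>simp_all add: scaled_mass_def s_def W_def\<close>)
    also have "\<dots> \<le> (\<Sum>m\<in>G. \<omega> (j m))" using j by (intro sum_mono) auto
    also have "\<dots> = (\<Sum>i\<in>j ` G. \<omega> i)" using injj by (simp add: sum.reindex)
    also have "\<dots> \<le> (\<Sum>j\<in>{j\<in>I. y \<in> ball (a j) (2 * C0 * \<rho> j)}. \<omega> j)"
      using finI j \<omega>0 by (intro sum_mono2) auto
    finally show ?thesis .
  qed
  have cost: "(\<Sum>j\<in>I. \<omega> j * \<rho> j ^ ?n)
      \<le> 2 ^ (?n + 2) * s ^ (?n - 1) * (((8 * R + 9) * ?n) ^ ?n * 2 ^ (?n + 21) * K * W * N * measure \<nu> UNIV)"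
  proof -
    have mark: "\<omega> (i, k, p) * \<rho> (i, k, p) ^ ?n
        \<le> 2 ^ (?n + 1) * s ^ (?n - 1) * (A i (x i k) * v i (x i k) ^ (?n - 1)) * (1/2) ^ p" for i k p
    proof -
      have "\<rho> (i, k, p) ^ ?n = \<rho> (i, k, p) * \<rho> (i, k, p) ^ (?n - 1)"
        using power_eq_if[of "\<rho> (i, k, p)" ?n] by simp
      then have "\<omega> (i, k, p) * \<rho> (i, k, p) ^ ?n = 2 ^ (?n + 1) * A i (x i k) * \<rho> (i, k, p) ^ (?n - 1)"
        using \<rho>0[of "(i, k, p)"] by (simp add: \<omega>_def)
      also have "\<rho> (i, k, p) ^ (?n - 1) = (s * v i (x i k)) ^ (?n - 1) * ((1/2) ^ p) ^ (?n - 1)"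
        by (simp add: \<rho>_def power_divide)
      also have "2 ^ (?n + 1) * A i (x i k) * \<dots> \<le> 2 ^ (?n + 1) * A i (x i k) * ((s * v i (x i k)) ^ (?n - 1) * (1/2) ^ p)"
      proof (intro mult_left_mono)
        \<comment> \<open>As n is at least 2, the costs of the halved radii form a geometric series
          in \<open>p\<close>.\<close>
        have "((1/2::real) ^ p) ^ (?n - 1) \<le> ((1/2) ^ p) ^ 1"
          using n2 by (intro power_decreasing) (auto simp: power_le_one)
        then show "((1/2::real) ^ p) ^ (?n - 1) \<le> (1/2) ^ p" by simp
      qed (use s0 v_pos[of i "x i k"] A_pos[of i "x i k"] in auto)
      finally show ?thesis by (simp add: power_mult_distrib mult_ac)
    qed
    have "(\<Sum>j\<in>I. \<omega> j * \<rho> j ^ ?n) \<le> (\<Sum>j\<in>I0. \<omega> j * \<rho> j ^ ?n)"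
      using finI0 \<omega>0 \<rho>0 by (intro sum_mono2) (auto simp: I_def less_imp_le)
    also have "\<dots> = (\<Sum>i<L. \<Sum>k\<in>near_cells R e i. \<Sum>p<P. \<omega> (i, k, p) * \<rho> (i, k, p) ^ ?n)"
    proof -
      have "(\<Sum>j\<in>I0. \<omega> j * \<rho> j ^ ?n) = (\<Sum>i<L. \<Sum>q\<in>near_cells R e i \<times> {..<P}. \<omega> (i, q) * \<rho> (i, q) ^ ?n)"
        unfolding I0_def using fin by (subst sum.Sigma) (auto simp: case_prod_beta)
      then show ?thesis by (simp add: sum.cartesian_product case_prod_beta)
    qed
    also have "\<dots> \<le> (\<Sum>i<L. \<Sum>k\<in>near_cells R e i. 2 ^ (?n + 1) * s ^ (?n - 1) * (A i (x i k) * v i (x i k) ^ (?n - 1)) * 2)"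
    proof (intro sum_mono)
      fix i k
      have "(\<Sum>p<P. \<omega> (i, k, p) * \<rho> (i, k, p) ^ ?n)
          \<le> (\<Sum>p<P. 2 ^ (?n + 1) * s ^ (?n - 1) * (A i (x i k) * v i (x i k) ^ (?n - 1)) * (1/2) ^ p)"
        by (intro sum_mono mark)
      also have "\<dots> = 2 ^ (?n + 1) * s ^ (?n - 1) * (A i (x i k) * v i (x i k) ^ (?n - 1)) * (\<Sum>p<P. (1/2) ^ p)"
        by (simp only: sum_distrib_left)
      also have "\<dots> \<le> 2 ^ (?n + 1) * s ^ (?n - 1) * (A i (x i k) * v i (x i k) ^ (?n - 1)) * 2"
      proof (intro mult_left_mono)
        have "(\<Sum>p<P. (1/2::real) ^ p) \<le> (\<Sum>p. (1/2) ^ p)" by (intro sum_le_suminf summable_geometric) auto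
        then show "(\<Sum>p<P. (1/2::real) ^ p) \<le> 2" by (simp add: suminf_geometric)
      qed (use s0 v_pos[of i "x i k"] A_pos[of i "x i k"] in auto)
      finally show "(\<Sum>p<P. \<omega> (i, k, p) * \<rho> (i, k, p) ^ ?n)
        \<le> 2 ^ (?n + 1) * s ^ (?n - 1) * (A i (x i k) * v i (x i k) ^ (?n - 1)) * 2" .
    qed
    also have "\<dots> = 2 ^ (?n + 2) * s ^ (?n - 1) * (\<Sum>i<L. \<Sum>k\<in>near_cells R e i. A i (x i k) * v i (x i k) ^ (?n - 1))"
      by (simp add: sum_distrib_left mult_ac)
    also have "\<dots> \<le> 2 ^ (?n + 2) * s ^ (?n - 1) * (((8 * R + 9) * ?n) ^ ?n * 2 ^ (?n + 21) * K * W * N * measure \<nu> UNIV)"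
      using cell_cost_le[OF R(1) N, of "D + 16" L] w s0 unfolding x_def e_def W_def
      by (intro mult_left_mono) auto
    finally show ?thesis .
  qed
  have "\<exists>C\<subseteq>I. F ` S \<subseteq> (\<Union>j\<in>C. ball (a j) (5 * (2 * C0 * \<rho> j))) \<and>
      N / 400 * (\<Sum>j\<in>C. \<rho> j ^ ?n) \<le> (\<Sum>j\<in>I. \<omega> j * \<rho> j ^ ?n)"
    by (rule weighted_Vitali_covering) (use finI \<omega>0 \<rho>0 N C0 cover in \<open>auto simp: less_imp_le\<close>)
  then obtain C where C: "C \<subseteq> I" "F ` S \<subseteq> (\<Union>j\<in>C. ball (a j) (5 * (2 * C0 * \<rho> j)))"
    "N / 400 * (\<Sum>j\<in>C. \<rho> j ^ ?n) \<le> (\<Sum>j\<in>I. \<omega> j * \<rho> j ^ ?n)" by blast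
  have finC: "finite C" using C(1) finI by (rule finite_subset)
  let ?D = "\<lambda>j. ball (a j) (5 * (2 * C0 * \<rho> j))"
  have dia: "diameter (?D j) \<le> 20 * C0 * \<rho> j" for j
    using C0 \<rho>0[of j] by simp
  have "hausdorff_delta (\<lambda>t. ennreal (t ^ ?n)) \<delta> (F ` S)
      \<le> (\<integral>\<^sup>+j. ennreal (diameter (?D j) ^ ?n) \<partial>count_space C)"
    using C(1) dia by (intro hausdorff_delta_countable_cover[OF countable_finite[OF finC] C(2)])
      (use \<delta> in \<open>auto simp: I_def intro: order_trans\<close>)
  also have "\<dots> = (\<Sum>j\<in>C. ennreal (diameter (?D j) ^ ?n))"
    using finC by (simp add: nn_integral_count_space_finite)
  also have "\<dots> = ennreal (\<Sum>j\<in>C. diameter (?D j) ^ ?n)"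
    by (rule sum_ennreal) (simp add: diameter_ge_0)
  also have "\<dots> \<le> ennreal (luzin_const ?n K R D C0 * measure \<nu> UNIV)"
  proof (rule ennreal_leI)
    have "(\<Sum>j\<in>C. diameter (?D j) ^ ?n) \<le> (\<Sum>j\<in>C. (20 * C0 * \<rho> j) ^ ?n)"
      by (intro sum_mono power_mono dia) (simp add: diameter_ge_0)
    also have "\<dots> = (20 * C0) ^ ?n * (\<Sum>j\<in>C. \<rho> j ^ ?n)"
      by (simp add: power_mult_distrib sum_distrib_left)
    also have "\<dots> \<le> (20 * C0) ^ ?n * (400 / N * (2 ^ (?n + 2) * s ^ (?n - 1) * (((8 * R + 9) * ?n) ^ ?n * 2 ^ (?n + 21) * K * W * N * measure \<nu> UNIV)))"
    proof (intro mult_left_mono)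
      from C(3) cost have "N / 400 * (\<Sum>j\<in>C. \<rho> j ^ ?n) \<le> 2 ^ (?n + 2) * s ^ (?n - 1) * (((8 * R + 9) * ?n) ^ ?n * 2 ^ (?n + 21) * K * W * N * measure \<nu> UNIV)"
        by linarith
      then show "(\<Sum>j\<in>C. \<rho> j ^ ?n) \<le> 400 / N * (2 ^ (?n + 2) * s ^ (?n - 1) * (((8 * R + 9) * ?n) ^ ?n * 2 ^ (?n + 21) * K * W * N * measure \<nu> UNIV))"
        using N by (simp add: field_simps)
    qed (use C0 in auto)
    also have "\<dots> = luzin_const ?n K R D C0 * measure \<nu> UNIV"
      using N by (simp add: luzin_const_def s_def W_def Let_def)
    finally show "(\<Sum>j\<in>C. diameter (?D j) ^ ?n) \<le> luzin_const ?n K R D C0 * measure \<nu> UNIV" .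
  qed
  finally show ?thesis .
qed

text \<open>The fineness \<delta> requires \<open>T N z\<close> to be small uniformly on
  \<open>S\<close>. The decay gives this only from scale \<open>Lf N' + 2 * N' + 1\<close> on, for a
  suitable \<open>N'\<close>, so \<open>N\<close> is taken beyond that scale. This does not spoil
  the bound, which is free of \<open>N\<close>.\<close>

lemma (in mass_energy) hausdorff_delta_image_le:
  fixes F :: "real^'n \<Rightarrow> 'b::euclidean_space" and S :: "(real^'n) set" and c :: "nat \<Rightarrow> ('n \<Rightarrow> int) \<Rightarrow> 'b"
  assumes R: "R \<ge> 0" "S \<subseteq> ball 0 R" and C0: "C0 > 0" and \<delta>: "\<delta> > 0" and D: "D \<ge> 1"
    and Lf: "\<And>N. N \<ge> N0 \<Longrightarrow> N \<le> Lf N"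
      "\<And>N. N \<ge> N0 \<Longrightarrow> (\<Sum>m=1..<Lf N + 2 * N + 1. w m) \<le> real ((D + 16) * N)"
      "\<And>N. N \<ge> N0 \<Longrightarrow> real (Lf N + 2 * N + 1) \<le> 2 ^ (D * N)"
    and \<psi>: "summable \<psi>" "\<And>m. \<psi> m > 0"
      "\<And>N. N \<ge> N0 \<Longrightarrow> (\<Sum>m. \<psi> (m + Lf N)) \<le> (1/2) ^ (16 * N)"
    and small: "\<And>z m. z \<in> S \<Longrightarrow> m \<ge> N1 \<Longrightarrow> measure \<nu> (dyadic_ball m z) \<le> \<psi> m ^ CARD('n)"
    and near: "\<And>z m k. z \<in> S \<Longrightarrow> m \<ge> N1 \<Longrightarrow> dist z (lattice_point (m - 1) k) \<le> (1/2) ^ (m + 1) \<Longrightarrow>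
      summable (\<lambda>l. \<alpha> l z) \<Longrightarrow> norm (F z - c m k) \<le> C0 * (\<Sum>l. \<alpha> (l + m) z)"
  shows "hausdorff_delta (\<lambda>t. ennreal (t ^ CARD('n))) \<delta> (F ` S)
    \<le> ennreal (luzin_const CARD('n) K R D C0 * measure \<nu> UNIV)"
proof -
  have al: "\<alpha> m z \<le> 2 * K * \<psi> m" if "z \<in> S" "m \<ge> N1" for m z
  proof -
    \<comment> \<open>The decay hypothesis makes \<open>s = \<psi> m\<close> the balancing parameter
      in \<open>mass_le\<close>.\<close>
    have "measure \<nu> (dyadic_ball m z) / \<psi> m ^ (CARD('n) - 1) \<le> \<psi> m ^ CARD('n) / \<psi> m ^ (CARD('n) - 1)"
      using small[OF that] \<psi>(2)[of m] by (intro divide_right_mono) (auto simp: less_imp_le)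
    also have "\<dots> = \<psi> m"
      using power_eq_if[of "\<psi> m" "CARD('n)"] \<psi>(2)[of m] by simp
    finally have "K * (\<psi> m + measure \<nu> (dyadic_ball m z) / \<psi> m ^ (CARD('n) - 1)) \<le> K * (\<psi> m + \<psi> m)"
      using K1 by (intro mult_left_mono add_left_mono) auto
    with mass_le[OF \<psi>(2), of m z m] show ?thesis by simp
  qed
  have sum: "summable (\<lambda>l. \<alpha> l z)" if "z \<in> S" for z
  proof (rule summable_comparison_test'[where N=N1])
    show "summable (\<lambda>l. 2 * K * \<psi> l)" using \<psi>(1) by (rule summable_mult)
  qed (use al[OF that] alpha_nonneg in auto)
  have tail: "T (Lf N + 2 * N + 1) z \<le> 10 * K * (1/2) ^ (16 * N)" if "z \<in> S" "N \<ge> N0" "N \<ge> N1" for z N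
    using T_tail_le[OF sum[OF that(1)] \<psi>(1) _ \<psi>(3)[OF that(2)]] al[OF that(1)] Lf(1)[OF that(2)] that(3) \<psi>(2)
    by (simp add: less_imp_le)
  have "(\<lambda>N. 10 * K * ((1/2) ^ 16) ^ N) \<longlonglongrightarrow> 10 * K * 0"
    by (intro tendsto_mult tendsto_const LIMSEQ_power_zero) (simp add: power_divide)
  then have "eventually (\<lambda>N. 10 * K * ((1/2) ^ 16) ^ N < \<delta> / (40 * C0)) sequentially"
    using C0 \<delta> by (intro order_tendstoD) auto
  then have "eventually (\<lambda>N. N \<ge> max N0 N1 \<and> 10 * K * ((1/2) ^ 16) ^ N < \<delta> / (40 * C0)) sequentially"
    using eventually_ge_at_top by (rule eventually_conj[rotated])
  then obtain N' where N': "N' \<ge> N0" "N' \<ge> N1" "10 * K * (1/2) ^ (16 * N') < \<delta> / (40 * C0)"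
    unfolding eventually_sequentially power_mult by (meson max.bounded_iff order_refl)
  obtain p1 where p1: "14 * K < 2 ^ p1" using real_arch_pow[of 2 "14 * K"] by auto
  obtain p2 where p2: "1 / measure \<mu> UNIV < 2 ^ p2" using real_arch_pow[of 2 "1 / measure \<mu> UNIV"] by auto
  define N where "N = Max {1, N0, N1, Lf N' + 2 * N' + 1, p1, p2}"
  have N: "N \<ge> 1" "N \<ge> N0" "N \<ge> N1" "N \<ge> Lf N' + 2 * N' + 1" "N \<ge> p1" "N \<ge> p2"
    unfolding N_def by (intro Max_ge; simp)+
  show ?thesis
  proof (rule cover_of_image[OF R C0 \<delta> D N(1), where L="Lf N + 2 * N + 1" and c=c])
    show "14 * K \<le> 2 ^ N" using p1 power_increasing[OF N(5), of "2::real"] by linarith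
    have "1 / measure \<mu> UNIV \<le> 2 ^ N" using p2 power_increasing[OF N(6), of "2::real"] by linarith
    then show "1 \<le> measure \<mu> UNIV * 2 ^ N" using mu_pos by (simp add: field_simps)
    show "T N z \<le> \<delta> / (40 * C0)" if "z \<in> S" for z
      using T_decreasing[OF sum[OF that] N(4)] tail[OF that N'(1,2)] N'(3) by linarith
    show "(\<Sum>m=1..<Lf N + 2 * N + 1. w m) \<le> real ((D + 16) * N)" by (rule Lf(2)[OF N(2)])
    show "real (Lf N + 2 * N + 1) \<le> 2 ^ (D * N)" by (rule Lf(3)[OF N(2)])
    show "norm (F z - c m k) \<le> C0 * (\<Sum>l. \<alpha> (l + m) z)"
      if "z \<in> S" "m \<ge> N" "dist z (lattice_point (m - 1) k) \<le> (1/2) ^ (m + 1)" for z m k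
      using near[OF that(1) _ that(3) sum[OF that(1)]] that(2) N(3) by simp
  qed (use N Lf(1)[OF N(2)] sum tail in simp_all)
qed

section \<open>Weak derivatives and the potential estimate\<close>

definition flat_exp :: "nat \<Rightarrow> real \<Rightarrow> real" where
  "flat_exp k t = (if t > 0 then exp (- (1 / t)) / t ^ k else 0)"

lemma flat_exp_nonneg: "flat_exp k t \<ge> 0"
  by (simp add: flat_exp_def)

lemma flat_exp_0_le_1: "flat_exp 0 t \<le> 1"
  by (simp add: flat_exp_def)

text \<open>Trades orders for polynomial factors, so that terms of different orders merge into a
  single one.\<close>

lemma flat_exp_add: "flat_exp k t = t ^ j * flat_exp (k + j) t"
  by (simp add: flat_exp_def power_add)

text \<open>The exponential dominates the power \<open>(1 + x / (k + 2)) ^ (k + 2)\<close> at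
  \<open>x = 1 / t\<close>. The quadratic decay at 0 that results is what makes the derivative there
  vanish, for every order \<open>k\<close>.\<close>

lemma flat_exp_le: "flat_exp k t \<le> real (k + 2) ^ (k + 2) * t ^ 2"
proof (cases "t > 0")
  case True
  have "(1 / t / real (k + 2)) ^ (k + 2) \<le> (1 + 1 / t / real (k + 2)) ^ (k + 2)"
    using True by (intro power_mono) auto
  also have "\<dots> \<le> exp (1 / t)"
    using True by (intro exp_ge_one_plus_x_over_n_power_n) (auto intro: order_trans[of _ 0])
  finally have "1 / (t ^ (k + 2) * real (k + 2) ^ (k + 2)) \<le> exp (1 / t)"
    by (simp only: power_divide power_one divide_divide_eq_left power_mult_distrib)
  moreover define X where "X = t ^ (k + 2) * real (k + 2) ^ (k + 2)"
  moreover have X: "X > 0"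
    unfolding X_def by (intro mult_pos_pos zero_less_power) (use True in simp_all)
  ultimately have "1 \<le> exp (1 / t) * X" by (simp only: pos_divide_le_eq)
  then have "exp (- (1 / t)) * 1 \<le> exp (- (1 / t)) * (exp (1 / t) * X)" by (intro mult_left_mono) auto
  then have "exp (- (1 / t)) \<le> t ^ (k + 2) * real (k + 2) ^ (k + 2)"
  proof -
    have "exp (- (1 / t)) * exp (1 / t) = 1" by (simp flip: exp_add)
    moreover assume "exp (- (1 / t)) * 1 \<le> exp (- (1 / t)) * (exp (1 / t) * X)"
    ultimately show ?thesis by (simp only: X_def mult.assoc[symmetric] mult_1_left mult_1_right)
  qed
  then have "exp (- (1 / t)) / t ^ k \<le> t ^ (k + 2) * real (k + 2) ^ (k + 2) / t ^ k"
    using True by (intro divide_right_mono) auto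
  moreover have "t ^ (k + 2) * real (k + 2) ^ (k + 2) / t ^ k = real (k + 2) ^ (k + 2) * t ^ 2"
    using True by (simp only: power_add) simp
  ultimately show ?thesis using True by (simp only: flat_exp_def if_True)
qed (simp add: flat_exp_def)

lemma has_field_derivative_flat_exp:
  "(flat_exp k has_field_derivative flat_exp (k + 2) t * (1 - k * t)) (at t)"
proof -
  consider "t > 0" | "t < 0" | "t = 0" by linarith
  then show ?thesis
  proof cases
    case 1
    have "((\<lambda>t. exp (- (1 / t)) / t ^ k) has_field_derivative flat_exp (k + 2) t * (1 - k * t)) (at t)"
    proof -
      have "((\<lambda>t. exp (- (1 / t)) / t ^ k) has_field_derivative
          (exp (- (1 / t)) * (1 / t^2) * t ^ k - exp (- (1 / t)) * (k * t ^ (k - 1))) / (t ^ k * t ^ k)) (at t)"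
        using 1 by (auto intro!: derivative_eq_intros simp: power2_eq_square)
      also have "(exp (- (1 / t)) * (1 / t^2) * t ^ k - exp (- (1 / t)) * (k * t ^ (k - 1))) / (t ^ k * t ^ k)
          = flat_exp (k + 2) t * (1 - k * t)"
        using 1 by (cases k) (simp_all add: flat_exp_def field_simps power2_eq_square)
      finally show ?thesis .
    qed
    then show ?thesis
      by (rule has_field_derivative_transform_within_open[of _ _ _ "{0<..}"]) (use 1 in \<open>auto simp: flat_exp_def\<close>)
  next
    case 2
    have "((\<lambda>t. 0) has_field_derivative flat_exp (k + 2) t * (1 - k * t)) (at t)"
      using 2 by (simp add: flat_exp_def)
    then show ?thesis
      by (rule has_field_derivative_transform_within_open[of _ _ _ "{..<0}"]) (use 2 in \<open>auto simp: flat_exp_def\<close>)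
  next
    case 3
    have "((\<lambda>h. flat_exp k h / h) \<longlongrightarrow> 0) (at 0)"
    proof (rule Lim_null_comparison)
      show "eventually (\<lambda>h. norm (flat_exp k h / h) \<le> real (k + 2) ^ (k + 2) * \<bar>h\<bar>) (at 0)"
      proof (rule always_eventually, rule allI)
        fix h :: real
        show "norm (flat_exp k h / h) \<le> real (k + 2) ^ (k + 2) * \<bar>h\<bar>"
          using flat_exp_le[of k h] flat_exp_nonneg[of k h]
          by (cases "h = 0") (auto simp: divide_le_eq power2_eq_square mult.assoc)
      qed
      show "((\<lambda>h. real (k + 2) ^ (k + 2) * \<bar>h\<bar>) \<longlongrightarrow> 0) (at 0)"
        by (intro tendsto_mult_right_zero tendsto_rabs_zero tendsto_ident_at)
    qed
    then show ?thesis using 3 by (simp add: DERIV_def flat_exp_def)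
  qed
qed

lemma continuous_on_flat_exp [continuous_intros]:
  "continuous_on S q \<Longrightarrow> continuous_on S (\<lambda>x. flat_exp k (q x))"
  by (rule continuous_on_compose2[of UNIV "flat_exp k"])
    (auto intro!: continuous_at_imp_continuous_on DERIV_isCont has_field_derivative_flat_exp)

lemma real_polynomial_function_partial_derivative:
  fixes p :: "real^'n \<Rightarrow> real"
  assumes "real_polynomial_function p"
  shows "\<exists>p'. real_polynomial_function p' \<and>
    (\<forall>x. \<exists>D. (p has_derivative D) (at x) \<and> D (axis i 1) = p' x)"
  using assms
proof induction
  case (linear f)
  then show ?case
    by (intro exI[of _ "\<lambda>_. f (axis i 1)"]) (auto intro: bounded_linear_imp_has_derivative)
next
  case (const c)
  show ?case by (intro exI[of _ "\<lambda>_. 0"]) (auto intro!: exI[of _ "\<lambda>_. 0"])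
next
  case (add f g)
  then obtain f' g' where *:
    "real_polynomial_function f'" "\<And>x. \<exists>D. (f has_derivative D) (at x) \<and> D (axis i 1) = f' x"
    "real_polynomial_function g'" "\<And>x. \<exists>D. (g has_derivative D) (at x) \<and> D (axis i 1) = g' x"
    by blast
  show ?case
  proof (rule exI[of _ "\<lambda>x. f' x + g' x"], intro conjI allI)
    show "real_polynomial_function (\<lambda>x. f' x + g' x)" using * by blast
    fix x
    obtain Df Dg where "(f has_derivative Df) (at x)" "Df (axis i 1) = f' x"
      "(g has_derivative Dg) (at x)" "Dg (axis i 1) = g' x" using *(2,4) by blast
    then show "\<exists>D. ((\<lambda>x. f x + g x) has_derivative D) (at x) \<and> D (axis i 1) = f' x + g' x"
      by (intro exI[of _ "\<lambda>h. Df h + Dg h"]) (auto intro: has_derivative_add)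
  qed
next
  case (mult f g)
  then obtain f' g' where *:
    "real_polynomial_function f'" "\<And>x. \<exists>D. (f has_derivative D) (at x) \<and> D (axis i 1) = f' x"
    "real_polynomial_function g'" "\<And>x. \<exists>D. (g has_derivative D) (at x) \<and> D (axis i 1) = g' x"
    by blast
  show ?case
  proof (rule exI[of _ "\<lambda>x. f x * g' x + f' x * g x"], intro conjI allI)
    show "real_polynomial_function (\<lambda>x. f x * g' x + f' x * g x)" by (intro real_polynomial_function.intros(3,4)) (use *(1,3) mult(1,2) in auto)
    fix x
    obtain Df Dg where "(f has_derivative Df) (at x)" "Df (axis i 1) = f' x"
      "(g has_derivative Dg) (at x)" "Dg (axis i 1) = g' x" using * by blast
    then show "\<exists>D. ((\<lambda>x. f x * g x) has_derivative D) (at x) \<and> D (axis i 1) = f x * g' x + f' x * g x"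
      by (intro exI[of _ "\<lambda>h. f x * Dg h + Df h * g x"]) (auto intro: has_derivative_mult)
  qed
qed

lemma has_derivative_flat_exp_comp:
  fixes p q :: "'a::real_normed_vector \<Rightarrow> real"
  assumes "(p has_derivative Dp) (at x)" "(q has_derivative Dq) (at x)"
  shows "((\<lambda>x. p x * flat_exp k (q x)) has_derivative
    (\<lambda>h. p x * (flat_exp (k + 2) (q x) * (1 - k * q x) * Dq h) + Dp h * flat_exp k (q x))) (at x)"
proof -
  have "(flat_exp k has_derivative (\<lambda>h. flat_exp (k + 2) (q x) * (1 - k * q x) * h)) (at (q x))"
    using has_field_derivative_flat_exp by (simp only: has_field_derivative_def)
  from has_derivative_compose[OF assms(2) this] assms(1) show ?thesis
    by (intro has_derivative_mult) auto
qed

lemmas poly_const = real_polynomial_function.intros(2)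
  and poly_add = real_polynomial_function.intros(3)
  and poly_mult = real_polynomial_function.intros(4)

text \<open>The products of a polynomial with some \<open>flat_exp k\<close> of a polynomial are
  closed under partial derivatives: differentiation produces orders \<open>k\<close> and
  \<open>k + 2\<close>, and \<open>flat_exp_add\<close> raises the first to the second. This class
  is the coinductive invariant; allowing only \<open>k = 0\<close> would not be enough.\<close>

lemma smooth_fun_polynomial_flat_exp:
  fixes p q :: "real^'n \<Rightarrow> real"
  assumes "real_polynomial_function p" "real_polynomial_function q"
  shows "smooth_fun (\<lambda>x. p x * flat_exp k (q x))"
proof -
  define X where "X \<psi> \<longleftrightarrow> (\<exists>p q k. real_polynomial_function p \<and> real_polynomial_function q \<and>
      \<psi> = (\<lambda>x::real^'n. p x * flat_exp k (q x)))" for \<psi>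
  have "X (\<lambda>x. p x * flat_exp k (q x))" using assms unfolding X_def by blast
  then show ?thesis
  proof (rule smooth_fun.coinduct)
    fix \<psi> :: "real^'n \<Rightarrow> real" assume "X \<psi>"
    then obtain p q k where pq: "real_polynomial_function p" "real_polynomial_function q"
      and \<psi>: "\<psi> = (\<lambda>x. p x * flat_exp k (q x))" unfolding X_def by blast
    have diff: "\<psi> differentiable (at x)" for x
    proof -
      obtain Dp Dq where "(p has_derivative Dp) (at x)" "(q has_derivative Dq) (at x)"
        using real_polynomial_function_partial_derivative[OF pq(1)]
          real_polynomial_function_partial_derivative[OF pq(2)] by blast
      from has_derivative_flat_exp_comp[OF this] show ?thesis
        unfolding \<psi> differentiable_def by blast
    qed
    have "X (\<lambda>x. frechet_derivative \<psi> (at x) (axis i 1))" for i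
    proof -
      obtain p' where p': "real_polynomial_function p'"
        "\<And>x. \<exists>D. (p has_derivative D) (at x) \<and> D (axis i 1) = p' x"
        using real_polynomial_function_partial_derivative[OF pq(1), of i] by blast
      obtain q' where q': "real_polynomial_function q'"
        "\<And>x. \<exists>D. (q has_derivative D) (at x) \<and> D (axis i 1) = q' x"
        using real_polynomial_function_partial_derivative[OF pq(2), of i] by blast
      have eq: "frechet_derivative \<psi> (at x) (axis i 1)
          = (p x * ((1 + (- real k) * q x) * q' x) + p' x * (q x * q x)) * flat_exp (k + 2) (q x)" for x
      proof -
        obtain Dp Dq where D: "(p has_derivative Dp) (at x)" "Dp (axis i 1) = p' x"
          "(q has_derivative Dq) (at x)" "Dq (axis i 1) = q' x" using p' q' by blast
        have "frechet_derivative \<psi> (at x) (axis i 1)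
            = p x * (flat_exp (k + 2) (q x) * (1 - k * q x) * q' x) + p' x * flat_exp k (q x)"
          unfolding \<psi> frechet_derivative_at[OF has_derivative_flat_exp_comp[OF D(1,3), of k], symmetric] D(2,4) ..
        also have "flat_exp k (q x) = q x ^ 2 * flat_exp (k + 2) (q x)" by (rule flat_exp_add)
        finally show ?thesis by (simp add: algebra_simps power2_eq_square)
      qed
      have "real_polynomial_function (\<lambda>x. p x * ((1 + (- real k) * q x) * q' x) + p' x * (q x * q x))"
        by (rule poly_add[OF poly_mult[OF pq(1) poly_mult[OF poly_add[OF poly_const poly_mult[OF poly_const pq(2)]] q'(1)]]
          poly_mult[OF p'(1) poly_mult[OF pq(2) pq(2)]]])
      then show ?thesis unfolding X_def eq using pq(2) by blast
    qed
    with diff show "\<exists>\<psi>'. \<psi> = \<psi>' \<and> (\<forall>x. \<psi>' differentiable at x) \<and>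
        (\<forall>i. X (\<lambda>x. frechet_derivative \<psi>' (at x) (axis i 1)) \<or>
          smooth_fun (\<lambda>x. frechet_derivative \<psi>' (at x) (axis i 1)))"
      by (intro exI[of _ \<psi>]) simp
  qed
qed

text \<open>Up to scaling, \<open>bump_kernel z e s\<close> is a bump supported in the ball of radius \<open>s / 2\<close> about \<open>z + (s / 2) e\<close>. Its
  \<open>s\<close>-derivative is minus the divergence of the moments \<open>bump_moment z e s i\<close>, which are test functions; so the weak
  derivatives of \<open>f\<close> control the \<open>s\<close>-derivative of the averages of \<open>f\<close>.\<close>
definition bump_arg :: "real^'n \<Rightarrow> real^'n \<Rightarrow> real \<Rightarrow> real^'n \<Rightarrow> real" where
  "bump_arg z e s w = 1 - 4 * ((w - z) \<bullet> (w - z)) / s\<^sup>2 + 4 * ((w - z) \<bullet> e) / s - e \<bullet> e"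

definition bump_kernel :: "real^'n \<Rightarrow> real^'n \<Rightarrow> real \<Rightarrow> real^'n \<Rightarrow> real" where
  "bump_kernel z e s w = flat_exp 0 (bump_arg z e s w) / s ^ CARD('n)"

definition bump_moment :: "real^'n \<Rightarrow> real^'n \<Rightarrow> real \<Rightarrow> 'n \<Rightarrow> real^'n \<Rightarrow> real" where
  "bump_moment z e s i w = (w - z) $ i / s ^ (CARD('n) + 1) * flat_exp 0 (bump_arg z e s w)"

definition bump_kernel_deriv :: "real^'n \<Rightarrow> real^'n \<Rightarrow> real \<Rightarrow> real^'n \<Rightarrow> real" where
  "bump_kernel_deriv z e s w =
     flat_exp 2 (bump_arg z e s w) * (8 * ((w - z) \<bullet> (w - z)) / s ^ 3 - 4 * ((w - z) \<bullet> e) / s\<^sup>2) / s ^ CARD('n)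
     - CARD('n) * flat_exp 0 (bump_arg z e s w) / s ^ (CARD('n) + 1)"

text \<open>Completing the square exhibits the kernel as one fixed radial bump in the variable
  \<open>(2 / s) *\<^sub>R (w - z) - e\<close>. The definition keeps the expanded form because that
  is visibly a polynomial in \<open>w\<close>.\<close>

lemma bump_arg_eq:
  "s \<noteq> 0 \<Longrightarrow> bump_arg z e s w = 1 - (norm ((2 / s) *\<^sub>R (w - z) - e))\<^sup>2"
proof -
  define u where "u = w - z"
  have "(norm ((2 / s) *\<^sub>R u - e))\<^sup>2 = (2 / s)\<^sup>2 * (u \<bullet> u) - 2 * (2 / s) * (u \<bullet> e) + e \<bullet> e"
    unfolding power2_norm_eq_inner
    by (simp add: inner_diff_left inner_diff_right inner_commute power2_eq_square)
  then show ?thesis unfolding bump_arg_def u_def[symmetric] by (simp add: power_divide)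
qed

text \<open>Outside the ball the vector \<open>(2 / s) *\<^sub>R (w - z)\<close> has norm at least
  2, and subtracting \<open>e\<close> takes away at most 1. So all kernels of a cone live in the
  balls about its apex \<open>z\<close>.\<close>

lemma bump_arg_nonpos:
  assumes "norm e \<le> 1" "s > 0" "w \<notin> ball z s"
  shows "bump_arg z e s w \<le> 0"
proof -
  have "s \<le> norm (w - z)" using assms(3) by (simp add: dist_norm norm_minus_commute)
  then have "2 \<le> 2 / s * norm (w - z)" using assms(2) by (simp add: field_simps)
  also have "\<dots> = norm ((2 / s) *\<^sub>R (w - z))" using assms(2) by (simp only: norm_scaleR) simp
  also have "\<dots> \<le> norm ((2 / s) *\<^sub>R (w - z) - e) + norm e"
    using norm_triangle_ineq[of "(2 / s) *\<^sub>R (w - z) - e" e] by (simp only: diff_add_cancel)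
  finally have "1 \<le> norm ((2 / s) *\<^sub>R (w - z) - e)" using assms(1) by linarith
  then have "1\<^sup>2 \<le> (norm ((2 / s) *\<^sub>R (w - z) - e))\<^sup>2" by (rule power_mono) simp
  then show ?thesis using assms(2) by (simp add: bump_arg_eq)
qed

lemma flat_exp_bump_arg_eq_0:
  "norm e \<le> 1 \<Longrightarrow> s > 0 \<Longrightarrow> w \<notin> ball z s \<Longrightarrow> flat_exp k (bump_arg z e s w) = 0"
  using bump_arg_nonpos[of e s w z] by (simp add: flat_exp_def)

lemma polynomial_bump_arg:
  fixes z :: "real^'n"
  shows "real_polynomial_function (bump_arg z e s)"
proof -
  have c: "real_polynomial_function (\<lambda>w::real^'n. w $ j)" for j
    by (rule real_polynomial_function.intros(1)) (rule bounded_linear_vec_nth)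
  have d: "real_polynomial_function (\<lambda>w::real^'n. w $ j - z $ j)" for j
    by (rule real_polynomial_function_diff[OF c poly_const])
  have "bump_arg z e s = (\<lambda>w. (1 - e \<bullet> e) + ((- 4 / s\<^sup>2) * (\<Sum>j\<in>UNIV. (w $ j - z $ j) * (w $ j - z $ j))
      + (4 / s) * (\<Sum>j\<in>UNIV. (w $ j - z $ j) * e $ j)))"
    by (simp add: bump_arg_def inner_vec_def fun_eq_iff)
  moreover have "real_polynomial_function (\<lambda>w. (1 - e \<bullet> e) + ((- 4 / s\<^sup>2) * (\<Sum>j\<in>UNIV. (w $ j - z $ j) * (w $ j - z $ j))
      + (4 / s) * (\<Sum>j\<in>UNIV. (w $ j - z $ j) * e $ j)))"
    by (rule poly_add[OF poly_const poly_add[OF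
        poly_mult[OF poly_const real_polynomial_function_sum[OF finite_class.finite_UNIV poly_mult[OF d d]]]
        poly_mult[OF poly_const real_polynomial_function_sum[OF finite_class.finite_UNIV poly_mult[OF d poly_const]]]]])
  ultimately show ?thesis by (simp only:)
qed

lemma test_fun_bump_moment:
  fixes z :: "real^'n"
  assumes "norm e \<le> 1" "s > 0" "cball z s \<subseteq> \<Omega>"
  shows "test_fun \<Omega> (bump_moment z e s i)"
proof -
  have c: "real_polynomial_function (\<lambda>w::real^'n. w $ i)"
    by (rule real_polynomial_function.intros(1)) (rule bounded_linear_vec_nth)
  have "real_polynomial_function (\<lambda>w::real^'n. (1 / s ^ (CARD('n) + 1)) * (w $ i - z $ i))"
    by (rule poly_mult[OF poly_const real_polynomial_function_diff[OF c poly_const]])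
  then have "real_polynomial_function (\<lambda>w. (w - z) $ i / s ^ (CARD('n) + 1))" by simp
  then have "smooth_fun (bump_moment z e s i)"
    unfolding bump_moment_def[abs_def] by (rule smooth_fun_polynomial_flat_exp[OF _ polynomial_bump_arg])
  moreover have "{w. bump_moment z e s i w \<noteq> 0} \<subseteq> cball z s"
  proof
    fix w assume "w \<in> {w. bump_moment z e s i w \<noteq> 0}"
    then have "flat_exp 0 (bump_arg z e s w) \<noteq> 0" by (auto simp: bump_moment_def)
    then show "w \<in> cball z s"
      using flat_exp_bump_arg_eq_0[OF assms(1,2), of w z 0] by (meson ball_subset_cball subsetD)
  qed
  then have cl: "closure {w. bump_moment z e s i w \<noteq> 0} \<subseteq> cball z s"
    by (rule closure_minimal) simp
  moreover have "compact (closure {w. bump_moment z e s i w \<noteq> 0})"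
    using bounded_subset[OF bounded_cball cl] by (simp add: compact_eq_bounded_closed)
  ultimately show ?thesis using assms(3) unfolding test_fun_def by blast
qed

lemma partial_deriv_bump_moment:
  fixes z :: "real^'n"
  assumes "s > 0"
  shows "partial_deriv i (bump_moment z e s i) w = flat_exp 0 (bump_arg z e s w) / s ^ (CARD('n) + 1)
     + (w - z) $ i / s ^ (CARD('n) + 1) * (flat_exp 2 (bump_arg z e s w) *
        (4 * e $ i / s - 8 * (w - z) $ i / s\<^sup>2))"
proof -
  have p: "((\<lambda>w. (w - z) $ i / s ^ (CARD('n) + 1)) has_derivative (\<lambda>h. h $ i / s ^ (CARD('n) + 1))) (at w)"
    using assms by (auto intro!: derivative_eq_intros bounded_linear.has_derivative[OF bounded_linear_vec_nth])
  have q: "(bump_arg z e s has_derivative (\<lambda>h. 4 * (h \<bullet> e) / s - 8 * ((w - z) \<bullet> h) / s\<^sup>2)) (at w)"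
    unfolding bump_arg_def[abs_def]
    using assms
    by (auto intro!: derivative_eq_intros simp: fun_eq_iff inner_commute power2_eq_square)
  show ?thesis
    unfolding partial_deriv_def bump_moment_def[abs_def]
      frechet_derivative_at[OF has_derivative_flat_exp_comp[OF p q], symmetric]
    by (simp add: inner_axis inner_axis' numeral_2_eq_2)
qed

lemma sum_partial_deriv_bump_moment:
  fixes z :: "real^'n"
  assumes "s > 0"
  shows "(\<Sum>i\<in>UNIV. partial_deriv i (bump_moment z e s i) w) = - bump_kernel_deriv z e s w"
proof -
  let ?n = "CARD('n)" and ?b = "\<lambda>k. flat_exp k (bump_arg z e s w)"
  have "(\<Sum>i\<in>UNIV. partial_deriv i (bump_moment z e s i) w)
      = ?n * ?b 0 / s ^ (?n + 1) + (\<Sum>i\<in>UNIV. (w - z) $ i / s ^ (?n + 1) * (?b 2 *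
        (4 * e $ i / s - 8 * (w - z) $ i / s\<^sup>2)))"
    unfolding partial_deriv_bump_moment[OF assms] sum.distrib by simp
  also have "(\<Sum>i\<in>UNIV. (w - z) $ i / s ^ (?n + 1) * (?b 2 * (4 * e $ i / s - 8 * (w - z) $ i / s\<^sup>2)))
      = (\<Sum>i\<in>UNIV. ?b 2 / s ^ (?n + 1) * (4 / s * ((w - z) $ i * e $ i) - 8 / s\<^sup>2 * ((w - z) $ i * (w - z) $ i)))"
  proof (intro sum.cong refl)
    fix i
    have "u / c * (b * (4 * d / s - 8 * u / s\<^sup>2)) = b / c * (4 / s * (u * d) - 8 / s\<^sup>2 * (u * u))" for u b c d :: real
      by (simp add: algebra_simps)
    then show "(w - z) $ i / s ^ (?n + 1) * (?b 2 * (4 * e $ i / s - 8 * (w - z) $ i / s\<^sup>2))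
        = ?b 2 / s ^ (?n + 1) * (4 / s * ((w - z) $ i * e $ i) - 8 / s\<^sup>2 * ((w - z) $ i * (w - z) $ i))" .
  qed
  also have "\<dots> = ?b 2 / s ^ (?n + 1) * (4 / s * ((w - z) \<bullet> e) - 8 / s\<^sup>2 * ((w - z) \<bullet> (w - z)))"
    by (simp only: inner_vec_def inner_real_def sum_distrib_left[symmetric] sum_subtractf)
  also have "\<dots> = - (?b 2 * (8 * ((w - z) \<bullet> (w - z)) / s ^ 3 - 4 * ((w - z) \<bullet> e) / s\<^sup>2) / s ^ ?n)"
    using assms by (simp add: field_simps power2_eq_square power3_eq_cube)
  finally show ?thesis by (simp add: bump_kernel_deriv_def)
qed

lemma has_field_derivative_bump_kernel:
  fixes z :: "real^'n"
  assumes "s > 0"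
  shows "((\<lambda>s. bump_kernel z e s w) has_field_derivative bump_kernel_deriv z e s w) (at s within S)"
proof -
  let ?n = "CARD('n)"
  have q: "((\<lambda>s. bump_arg z e s w) has_field_derivative
      (8 * ((w - z) \<bullet> (w - z)) / s ^ 3 - 4 * ((w - z) \<bullet> e) / s\<^sup>2)) (at s within S)"
    unfolding bump_arg_def using assms
    by (auto intro!: derivative_eq_intros simp: field_simps power2_eq_square power3_eq_cube)
  have b: "((\<lambda>s. flat_exp 0 (bump_arg z e s w)) has_field_derivative
      flat_exp 2 (bump_arg z e s w) * (8 * ((w - z) \<bullet> (w - z)) / s ^ 3 - 4 * ((w - z) \<bullet> e) / s\<^sup>2)) (at s within S)"
    using DERIV_chain2[OF has_field_derivative_flat_exp[of 0] q] by (simp add: numeral_2_eq_2)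
  have p: "((\<lambda>s. 1 / s ^ ?n) has_field_derivative - (?n / s ^ (?n + 1))) (at s within S)"
  proof -
    have "Suc (?n - 1) = ?n" by simp
    then have "s ^ ?n = s * s ^ (?n - 1)" by (metis power_Suc)
    then show ?thesis using assms
      by (auto intro!: derivative_eq_intros simp: field_simps)
  qed
  show ?thesis
    using DERIV_mult[OF b p] unfolding bump_kernel_def bump_kernel_deriv_def
    by (simp add: mult.commute)
qed

lemma continuous_on_bump_arg:
  "continuous_on S (bump_arg z e s)"
  unfolding bump_arg_def[abs_def] divide_inverse by (intro continuous_intros)

lemma continuous_on_bump_kernel: "continuous_on S (bump_kernel z e s)"
  for z :: "real^'n"
  unfolding bump_kernel_def[abs_def] divide_inverse
  by (intro continuous_intros continuous_on_bump_arg)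

lemma continuous_on_partial_deriv_bump_moment:
  fixes z :: "real^'n"
  assumes "s > 0"
  shows "continuous_on S (partial_deriv i (bump_moment z e s i))"
proof -
  have "continuous_on S (\<lambda>w. flat_exp 0 (bump_arg z e s w) / s ^ (CARD('n) + 1)
     + (w - z) $ i / s ^ (CARD('n) + 1) * (flat_exp 2 (bump_arg z e s w) *
        (4 * e $ i / s - 8 * (w - z) $ i / s\<^sup>2)))"
    by (intro continuous_intros continuous_on_bump_arg continuous_on_component) (use assms in auto)
  also have "(\<lambda>w. flat_exp 0 (bump_arg z e s w) / s ^ (CARD('n) + 1)
     + (w - z) $ i / s ^ (CARD('n) + 1) * (flat_exp 2 (bump_arg z e s w) *
        (4 * e $ i / s - 8 * (w - z) $ i / s\<^sup>2))) = partial_deriv i (bump_moment z e s i)"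
    by (rule ext) (rule partial_deriv_bump_moment[OF assms, symmetric])
  finally show ?thesis .
qed

lemma bump_kernel_bounds:
  fixes z :: "real^'n"
  assumes "s > 0"
  shows "0 \<le> bump_kernel z e s w"
  using assms flat_exp_nonneg by (simp add: bump_kernel_def)

lemma bump_moment_le:
  fixes z :: "real^'n"
  assumes "norm e \<le> 1" "s > 0"
  shows "\<bar>bump_moment z e s i w\<bar> \<le> indicator (ball z s) w / s ^ CARD('n)"
proof (cases "w \<in> ball z s")
  case True
  have "\<bar>(w - z) $ i\<bar> \<le> s"
    using component_le_norm_cart[of "w - z" i] True by (simp add: dist_norm norm_minus_commute)
  then have "\<bar>(w - z) $ i\<bar> / s ^ (CARD('n) + 1) * flat_exp 0 (bump_arg z e s w) \<le> s / s ^ (CARD('n) + 1) * 1"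
    using assms(2) flat_exp_nonneg flat_exp_0_le_1 by (intro mult_mono divide_right_mono) auto
  then show ?thesis using True assms(2) flat_exp_nonneg by (simp add: bump_moment_def abs_mult)
next
  case False
  then show ?thesis using flat_exp_bump_arg_eq_0[OF assms False] by (simp add: bump_moment_def)
qed

text \<open>Since \<open>f\<close> is continuous only on \<Omega>, it is composed with the
  projection to the closed ball: this is continuous everywhere and agrees with \<open>f\<close>
  where \<open>h\<close> does not vanish. The Lebesgue integral over \<Omega> becomes an integral
  over a box, to which the Leibniz rule applies.\<close>

lemma set_integral_continuous_kernel:
  fixes f :: "real^'n \<Rightarrow> real^'d" and h :: "real^'n \<Rightarrow> real"
  assumes h: "continuous_on UNIV h" "\<And>w. w \<notin> cball z r \<Longrightarrow> h w = 0"
    and f: "continuous_on \<Omega> f" and r: "r > 0" "cball z r \<subseteq> \<Omega>" and ab: "cball z r \<subseteq> cbox a b"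
  shows "set_integrable lebesgue \<Omega> (\<lambda>w. h w *\<^sub>R f w)"
    and "(LINT w:\<Omega>|lebesgue. h w *\<^sub>R f w) = integral (cbox a b) (\<lambda>w. h w *\<^sub>R f (closest_point (cball z r) w))"
proof -
  let ?F = "\<lambda>w. f (closest_point (cball z r) w)"
  have F: "continuous_on S ?F" for S
  proof -
    have "continuous_on S (closest_point (cball z r))"
      using r(1) by (intro continuous_on_closest_point) auto
    then show ?thesis
      using r closest_point_in_set[of "cball z r"]
      by (intro continuous_on_compose2[OF continuous_on_subset[OF f r(2)]]) auto
  qed
  have ai: "set_integrable lebesgue (cbox a b) (\<lambda>w. h w *\<^sub>R ?F w)"
    by (intro absolutely_integrable_continuous continuous_intros continuous_on_subset[OF h(1)] F) auto
  have eq: "indicator \<Omega> w *\<^sub>R (h w *\<^sub>R f w) = indicator (cbox a b) w *\<^sub>R (h w *\<^sub>R ?F w)" for w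
  proof (cases "w \<in> cball z r")
    case True
    then have "closest_point (cball z r) w = w" by (rule closest_point_self)
    then show ?thesis using True r(2) ab by (auto simp: indicator_def)
  next
    case False
    then show ?thesis using h(2) by simp
  qed
  show "set_integrable lebesgue \<Omega> (\<lambda>w. h w *\<^sub>R f w)"
    using ai unfolding set_integrable_def eq .
  have "(LINT w:\<Omega>|lebesgue. h w *\<^sub>R f w) = (LINT w:cbox a b|lebesgue. h w *\<^sub>R ?F w)"
    unfolding set_lebesgue_integral_def eq ..
  also have "\<dots> = integral (cbox a b) (\<lambda>w. h w *\<^sub>R ?F w)"
    by (rule set_lebesgue_integral_eq_integral(2)[OF ai])
  finally show "(LINT w:\<Omega>|lebesgue. h w *\<^sub>R f w) = integral (cbox a b) (\<lambda>w. h w *\<^sub>R ?F w)" .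
qed

section \<open>Differentiation of the averages in the scale\<close>

lemma bump_average_has_vector_derivative:
  fixes f :: "real^'n \<Rightarrow> real^'d" and g :: "'n \<Rightarrow> real^'n \<Rightarrow> real^'d"
  assumes f: "continuous_on \<Omega> f" and w: "\<And>i. weak_partial \<Omega> i f (g i)"
    and r: "cball z r \<subseteq> \<Omega>" and e: "norm e \<le> 1" and s: "0 < s0" "s \<in> {s0..r}"
  shows "((\<lambda>s. LINT w:\<Omega>|lebesgue. bump_kernel z e s w *\<^sub>R f w) has_vector_derivative
    (\<Sum>i\<in>UNIV. LINT w:\<Omega>|lebesgue. bump_moment z e s i w *\<^sub>R g i w)) (at s within {s0..r})"
proof -
  have r0: "r > 0" using s by auto
  obtain a b where ab: "cball z r \<subseteq> cbox a b"
    using bounded_subset_cbox_symmetric[OF bounded_cball, of z r] by metis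
  let ?F = "\<lambda>w. f (closest_point (cball z r) w)"
  have F: "continuous_on S ?F" for S
  proof -
    have "continuous_on S (closest_point (cball z r))"
      using r0 by (intro continuous_on_closest_point) auto
    then show ?thesis
      using r0 closest_point_in_set[of "cball z r"]
      by (intro continuous_on_compose2[OF continuous_on_subset[OF f r]]) auto
  qed
  have sub: "cball z t \<subseteq> cball z r" if "t \<in> {s0..r}" for t using that by auto
  have zero: "flat_exp k (bump_arg z e t w) = 0" if "t \<in> {s0..r}" "w \<notin> cball z r" for t w k
    by (rule flat_exp_bump_arg_eq_0[OF e]) (use that s(1) in auto)
  have K: "(LINT w:\<Omega>|lebesgue. bump_kernel z e t w *\<^sub>R f w) = integral (cbox a b) (\<lambda>w. bump_kernel z e t w *\<^sub>R ?F w)"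
    if "t \<in> {s0..r}" for t
    by (rule set_integral_continuous_kernel[OF continuous_on_bump_kernel _ f r0 r ab])
      (use zero[OF that] in \<open>auto simp: bump_kernel_def\<close>)
  have "((\<lambda>t. integral (cbox a b) (\<lambda>w. bump_kernel z e t w *\<^sub>R ?F w)) has_vector_derivative
      integral (cbox a b) (\<lambda>w. bump_kernel_deriv z e s w *\<^sub>R ?F w)) (at s within {s0..r})"
  proof (rule leibniz_rule_vector_derivative)
    fix t w assume t: "t \<in> {s0..r}"
    have "((\<lambda>t. bump_kernel z e t w) has_vector_derivative bump_kernel_deriv z e t w) (at t within {s0..r})"
      using has_field_derivative_bump_kernel[of t z e w "{s0..r}"] t s(1)
      by (simp add: has_real_derivative_iff_has_vector_derivative)
    from bounded_linear.has_vector_derivative[OF bounded_linear_scaleR_left this]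
    show "((\<lambda>t. bump_kernel z e t w *\<^sub>R ?F w) has_vector_derivative bump_kernel_deriv z e t w *\<^sub>R ?F w) (at t within {s0..r})" .
  next
    fix t assume t: "t \<in> {s0..r}"
    show "(\<lambda>w. bump_kernel z e t w *\<^sub>R ?F w) integrable_on cbox a b"
      by (intro integrable_continuous continuous_intros continuous_on_bump_kernel F)
  next
    have "continuous_on ({s0..r} \<times> cbox a b) (\<lambda>x. bump_kernel_deriv z e (fst x) (snd x))"
      unfolding bump_kernel_deriv_def bump_arg_def
      by (intro continuous_on_diff continuous_on_divide continuous_on_mult continuous_on_flat_exp
          continuous_on_add continuous_on_power continuous_on_inner continuous_on_const
          continuous_on_fst continuous_on_snd continuous_on_id ballI power_not_zero)
        (use s(1) in \<open>simp_all add: mem_Times_iff\<close>)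
    moreover have "continuous_on ({s0..r} \<times> cbox a b) (\<lambda>x. ?F (snd x))"
      by (rule continuous_on_compose2[OF F[of UNIV] continuous_on_snd[OF continuous_on_id]]) simp
    ultimately show "continuous_on ({s0..r} \<times> cbox a b) (\<lambda>(t, w). bump_kernel_deriv z e t w *\<^sub>R ?F w)"
      unfolding case_prod_beta by (intro continuous_intros)
  qed (use s in auto)
  moreover have "integral (cbox a b) (\<lambda>w. bump_kernel_deriv z e s w *\<^sub>R ?F w)
      = (\<Sum>i\<in>UNIV. LINT w:\<Omega>|lebesgue. bump_moment z e s i w *\<^sub>R g i w)"
  proof -
    have s0: "s > 0" using s by auto
    let ?p = "\<lambda>i. partial_deriv i (bump_moment z e s i)"
    have supp: "?p i w = 0" if "w \<notin> cball z r" for i w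
      using zero[OF s(2) that] by (simp add: partial_deriv_bump_moment[OF s0])
    note * = set_integral_continuous_kernel[OF continuous_on_partial_deriv_bump_moment[OF s0] supp f r0 r ab]
    have eq: "(LINT w:\<Omega>|lebesgue. bump_moment z e s i w *\<^sub>R g i w) = - integral (cbox a b) (\<lambda>w. ?p i w *\<^sub>R ?F w)" for i
    proof -
      have "test_fun \<Omega> (bump_moment z e s i)"
        using test_fun_bump_moment[OF e s0] sub[OF s(2)] r by blast
      then have "(LINT w:\<Omega>|lebesgue. ?p i w *\<^sub>R f w) = - (LINT w:\<Omega>|lebesgue. bump_moment z e s i w *\<^sub>R g i w)"
        using w[of i] unfolding weak_partial_def by blast
      then have "(LINT w:\<Omega>|lebesgue. bump_moment z e s i w *\<^sub>R g i w) = - (LINT w:\<Omega>|lebesgue. ?p i w *\<^sub>R f w)"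
        by simp
      also have "(LINT w:\<Omega>|lebesgue. ?p i w *\<^sub>R f w) = integral (cbox a b) (\<lambda>w. ?p i w *\<^sub>R ?F w)"
        by (rule *(2))
      finally show ?thesis .
    qed
    have "(\<Sum>i\<in>UNIV. LINT w:\<Omega>|lebesgue. bump_moment z e s i w *\<^sub>R g i w)
        = - integral (cbox a b) (\<lambda>w. \<Sum>i\<in>UNIV. ?p i w *\<^sub>R ?F w)"
    proof -
      have "(\<lambda>w. ?p i w *\<^sub>R ?F w) integrable_on cbox a b" for i
        by (intro integrable_continuous continuous_on_scaleR continuous_on_partial_deriv_bump_moment[OF s0] F)
      then show ?thesis unfolding eq sum_negf by (subst integral_sum) auto
    qed
    also have "\<dots> = - integral (cbox a b) (\<lambda>w. - (bump_kernel_deriv z e s w *\<^sub>R ?F w))"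
      by (simp only: scaleR_sum_left[symmetric] sum_partial_deriv_bump_moment[OF s0] scaleR_minus_left)
    finally show ?thesis by (simp only: integral_neg minus_minus)
  qed
  ultimately have "((\<lambda>t. integral (cbox a b) (\<lambda>w. bump_kernel z e t w *\<^sub>R ?F w)) has_vector_derivative
      (\<Sum>i\<in>UNIV. LINT w:\<Omega>|lebesgue. bump_moment z e s i w *\<^sub>R g i w)) (at s within {s0..r})" by (simp only:)
  then show ?thesis
    by (rule has_vector_derivative_transform[OF s(2), rotated]) (rule K)
qed

section \<open>Normalization, increments and limits of the averages\<close>

definition unit_bump :: "real^'n \<Rightarrow> real" where
  "unit_bump x = flat_exp 0 (1 - x \<bullet> x)"

lemma unit_bump_nonneg: "0 \<le> unit_bump x"
  by (simp add: unit_bump_def flat_exp_nonneg)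

lemma continuous_on_unit_bump: "continuous_on S unit_bump"
  unfolding unit_bump_def[abs_def] by (intro continuous_intros)

lemma borel_measurable_unit_bump [measurable]: "unit_bump \<in> borel_measurable borel"
  by (rule borel_measurable_continuous_onI) (rule continuous_on_unit_bump)

lemma integrable_unit_bump: "integrable lborel (unit_bump :: real^'n \<Rightarrow> real)"
proof (rule Bochner_Integration.integrable_bound)
  show "integrable lborel (indicator (cball (0::real^'n) 1) :: _ \<Rightarrow> real)"
    using emeasure_lborel_cball_finite[of "0::real^'n" 1] by (simp add: integrable_indicator_iff less_top)
  show "AE x in lborel. norm (unit_bump x) \<le> norm (indicator (cball (0::real^'n) 1) x :: real)"
  proof (intro AE_I2)
    fix x :: "real^'n"
    show "norm (unit_bump x) \<le> norm (indicator (cball (0::real^'n) 1) x :: real)"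
    proof (cases "norm x \<le> 1")
      case True
      then show ?thesis using flat_exp_0_le_1 flat_exp_nonneg by (simp add: unit_bump_def)
    next
      case False
      then have "1\<^sup>2 \<le> (norm x)\<^sup>2" by (intro power_mono) auto
      then show ?thesis by (simp add: unit_bump_def flat_exp_def power2_norm_eq_inner)
    qed
  qed
qed simp

lemma integral_unit_bump_pos: "0 < (LINT x|lborel. unit_bump (x :: real^'n))"
proof -
  have int: "integrable lborel (\<lambda>x. exp (-2 :: real) * indicator (ball (0::real^'n) (1/2)) x)"
    using emeasure_lborel_ball_finite[of "0::real^'n" "1/2"] by (simp add: integrable_indicator_iff less_top)
  have "0 < exp (-2 :: real) * measure lborel (ball (0::real^'n) (1/2))"
    using content_ball_pos[of "1/2" "0::real^'n"] by simp
  also have "\<dots> = (LINT x|lborel. exp (-2 :: real) * indicator (ball (0::real^'n) (1/2)) x)" by simp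
  also have "\<dots> \<le> (LINT x|lborel. unit_bump (x :: real^'n))"
  proof (rule integral_mono[OF int integrable_unit_bump])
    fix x :: "real^'n"
    show "exp (-2) * indicator (ball 0 (1/2)) x \<le> unit_bump x"
    proof (cases "x \<in> ball 0 (1/2)")
      case True
      then have "(norm x)\<^sup>2 \<le> (1/2)\<^sup>2" by (intro power_mono) auto
      then have x: "1 - x \<bullet> x \<ge> 3/4" by (simp add: power2_norm_eq_inner power_divide)
      then have "1 / (1 - x \<bullet> x) \<le> 1 / (3/4)" by (intro divide_left_mono) auto
      then have "exp (-2) \<le> exp (- (1 / (1 - x \<bullet> x)))" by simp
      then show ?thesis using x True by (simp add: unit_bump_def flat_exp_def)
    qed (simp add: unit_bump_nonneg)
  qed
  finally show ?thesis .
qed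

text \<open>The substitution \<open>w = z + (s / 2) *\<^sub>R (e + x)\<close> removes all
  parameters. Every kernel has the same integral, so one normalizing constant serves for the whole
  cone.\<close>

lemma integral_bump_kernel:
  fixes z :: "real^'n"
  assumes s: "s > 0"
  shows "integrable lborel (bump_kernel z e s)"
    and "(LINT w|lborel. bump_kernel z e s w) = (LINT x|lborel. unit_bump (x :: real^'n)) / 2 ^ CARD('n)"
proof -
  define T where "T = z + (s / 2) *\<^sub>R e"
  let ?D = "distr lborel borel (\<lambda>x. T + (s / 2) *\<^sub>R x)"
  have eq: "bump_kernel z e s (T + (s / 2) *\<^sub>R x) = unit_bump x / s ^ CARD('n)" for x
  proof -
    have "(2 / s) *\<^sub>R (T + (s / 2) *\<^sub>R x - z) - e = x"
      using s by (simp add: T_def scaleR_add_right)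
    then show ?thesis using s
      by (simp add: bump_kernel_def bump_arg_eq unit_bump_def power2_norm_eq_inner)
  qed
  have m [measurable]: "bump_kernel z e s \<in> borel_measurable borel"
    by (rule borel_measurable_continuous_onI) (rule continuous_on_bump_kernel)
  have D: "(lborel :: (real^'n) measure) = density ?D (\<lambda>_. ennreal (\<bar>s / 2\<bar> ^ DIM(real^'n)))"
    using s by (intro lborel_affine) simp
  have iD: "integrable ?D (bump_kernel z e s)"
    by (subst integrable_distr_eq) (use integrable_unit_bump in \<open>auto simp: eq\<close>)
  have "integrable (density ?D (\<lambda>_. ennreal (\<bar>s / 2\<bar> ^ DIM(real^'n)))) (bump_kernel z e s)"
    by (subst integrable_density) (use iD in auto)
  then show "integrable lborel (bump_kernel z e s)" by (simp only: D[symmetric])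
  have "(LINT w|density ?D (\<lambda>_. ennreal (\<bar>s / 2\<bar> ^ DIM(real^'n))). bump_kernel z e s w)
      = \<bar>s / 2\<bar> ^ DIM(real^'n) * (LINT w|?D. bump_kernel z e s w)"
    by (subst integral_density) auto
  also have "(LINT w|?D. bump_kernel z e s w) = (LINT x|lborel. unit_bump (x :: real^'n) / s ^ CARD('n))"
    by (subst integral_distr) (auto simp: eq)
  also have "\<bar>s / 2\<bar> ^ DIM(real^'n) * \<dots> = (LINT x|lborel. unit_bump (x :: real^'n)) / 2 ^ CARD('n)"
    using s by (simp add: power_divide)
  finally show "(LINT w|lborel. bump_kernel z e s w) = (LINT x|lborel. unit_bump (x :: real^'n)) / 2 ^ CARD('n)"
    by (simp only: D[symmetric])
qed

lemma norm_bump_moment_integral_le: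
  fixes g :: "'n \<Rightarrow> real^'n \<Rightarrow> real^'d"
  assumes e: "norm e \<le> 1" and s: "s > 0"
    and g: "\<And>i. set_integrable lebesgue (ball z s) (\<lambda>w. norm (g i w))"
  shows "norm (\<Sum>i\<in>UNIV. LINT w:\<Omega>|lebesgue. bump_moment z e s i w *\<^sub>R g i w)
    \<le> (\<Sum>i\<in>UNIV. LINT w:ball z s|lebesgue. norm (g i w)) / s ^ CARD('n)"
proof -
  have "norm (LINT w:\<Omega>|lebesgue. bump_moment z e s i w *\<^sub>R g i w)
      \<le> (LINT w:ball z s|lebesgue. norm (g i w)) / s ^ CARD('n)" for i
  proof -
    have int: "integrable lebesgue (\<lambda>w. indicator (ball z s) w * norm (g i w) / s ^ CARD('n))"
      using g[of i] unfolding set_integrable_def by simp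
    have "norm (LINT w:\<Omega>|lebesgue. bump_moment z e s i w *\<^sub>R g i w)
        \<le> (LINT w|lebesgue. norm (indicator \<Omega> w *\<^sub>R (bump_moment z e s i w *\<^sub>R g i w)))"
      unfolding set_lebesgue_integral_def by (rule integral_norm_bound)
    also have "\<dots> \<le> (LINT w|lebesgue. indicator (ball z s) w * norm (g i w) / s ^ CARD('n))"
    proof (rule integral_mono'[OF int])
      fix w
      have "\<bar>indicator \<Omega> w\<bar> * (\<bar>bump_moment z e s i w\<bar> * norm (g i w))
          \<le> 1 * (indicator (ball z s) w / s ^ CARD('n) * norm (g i w))"
        using s by (intro mult_mono bump_moment_le[OF e s] mult_right_mono) (auto simp: indicator_def)
      then show "norm (indicator \<Omega> w *\<^sub>R (bump_moment z e s i w *\<^sub>R g i w))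
          \<le> indicator (ball z s) w * norm (g i w) / s ^ CARD('n)" by (simp add: abs_mult mult.assoc)
    qed (use s in auto)
    finally show ?thesis by (simp add: set_lebesgue_integral_def)
  qed
  then show ?thesis
    unfolding sum_divide_distrib by (intro order_trans[OF norm_sum] sum_mono)
qed

text \<open>Mean value inequality on the interval from \<open>r / 2\<close> to \<open>r\<close>: the
  derivative is bounded by the integral over the largest ball divided by \<open>(r / 2) ^ n\<close>,
  and the interval has length \<open>r / 2\<close>.\<close>

lemma bump_average_halve:
  fixes f :: "real^'n \<Rightarrow> real^'d" and g :: "'n \<Rightarrow> real^'n \<Rightarrow> real^'d"
  assumes f: "continuous_on \<Omega> f" and w: "\<And>i. weak_partial \<Omega> i f (g i)"
    and r: "cball z r \<subseteq> \<Omega>" "r > 0" and e: "norm e \<le> 1"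
    and g: "\<And>i. set_integrable lebesgue (ball z r) (\<lambda>w. norm (g i w))"
  shows "norm ((LINT w:\<Omega>|lebesgue. bump_kernel z e r w *\<^sub>R f w) - (LINT w:\<Omega>|lebesgue. bump_kernel z e (r / 2) w *\<^sub>R f w))
    \<le> 2 ^ (CARD('n) - 1) * ((\<Sum>i\<in>UNIV. LINT w:ball z r|lebesgue. norm (g i w)) / r ^ (CARD('n) - 1))"
proof -
  let ?\<Phi> = "\<lambda>s. LINT w:\<Omega>|lebesgue. bump_kernel z e s w *\<^sub>R f w"
  let ?d = "\<lambda>s. \<Sum>i\<in>UNIV. LINT w:\<Omega>|lebesgue. bump_moment z e s i w *\<^sub>R g i w"
  let ?S = "\<Sum>i\<in>UNIV. LINT w:ball z r|lebesgue. norm (g i w)"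
  let ?B = "?S / (r / 2) ^ CARD('n)"
  have S0: "?S \<ge> 0" by (intro sum_nonneg) (auto simp: set_lebesgue_integral_def intro!: integral_nonneg_AE)
  have d: "(?\<Phi> has_derivative (\<lambda>h. h *\<^sub>R ?d s)) (at s within {r/2..r})" if "s \<in> {r/2..r}" for s
    using bump_average_has_vector_derivative[OF f w r(1) e, of "r/2" s] that r(2)
    unfolding has_vector_derivative_def by simp
  have b: "onorm (\<lambda>h. h *\<^sub>R ?d s) \<le> ?B" if s: "s \<in> {r/2..r}" for s
  proof -
    have s0: "s > 0" using s r(2) by auto
    have gs: "set_integrable lebesgue (ball z s) (\<lambda>w. norm (g i w))" for i
      by (rule set_integrable_subset[OF g]) (use s in auto)
    have "norm (?d s) \<le> (\<Sum>i\<in>UNIV. LINT w:ball z s|lebesgue. norm (g i w)) / s ^ CARD('n)"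
      by (rule norm_bump_moment_integral_le[OF e s0 gs])
    also have "\<dots> \<le> ?S / s ^ CARD('n)"
    proof (intro divide_right_mono sum_mono)
      fix i
      show "(LINT w:ball z s|lebesgue. norm (g i w)) \<le> (LINT w:ball z r|lebesgue. norm (g i w))"
        unfolding set_lebesgue_integral_def
        by (rule integral_mono) (use g gs s in \<open>auto simp: set_integrable_def indicator_def\<close>)
    qed (use s0 in auto)
    also have "\<dots> \<le> ?B"
      using s r(2) S0 s0 by (intro divide_left_mono power_mono) auto
    finally have n: "norm (?d s) \<le> ?B" .
    show ?thesis
    proof (rule onorm_le)
      fix h :: real
      show "norm (h *\<^sub>R ?d s) \<le> ?B * norm h" using mult_right_mono[OF n, of "norm h"] by (simp add: mult.commute)
    qed
  qed
  have "norm (?\<Phi> r - ?\<Phi> (r / 2)) \<le> ?B * norm (r - r / 2)"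
    by (rule differentiable_bound[OF _ d b]) (use r in auto)
  also have "\<dots> = ?S * ((r / 2) / (r / 2) ^ CARD('n))" using r by simp
  also have "(r / 2) / (r / 2) ^ CARD('n) = 1 / (r / 2) ^ (CARD('n) - 1)"
  proof -
    have "(r / 2) ^ CARD('n) = (r / 2) * (r / 2) ^ (CARD('n) - 1)"
      using power_eq_if[of "r / 2" "CARD('n)"] by simp
    then show ?thesis using r(2) by (simp only: nonzero_divide_mult_cancel_left)
  qed
  also have "?S * (1 / (r / 2) ^ (CARD('n) - 1)) = 2 ^ (CARD('n) - 1) * (?S / r ^ (CARD('n) - 1))"
    by (simp add: power_divide)
  finally show ?thesis .
qed

lemma bump_average_tendsto:
  fixes f :: "real^'n \<Rightarrow> real^'d"
  assumes f: "continuous_on \<Omega> f" and r: "cball z r \<subseteq> \<Omega>" "r > 0" and e: "norm e \<le> 1"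
    and \<epsilon>: "\<epsilon> > 0"
  defines "I \<equiv> (LINT x|lborel. unit_bump (x :: real^'n)) / 2 ^ CARD('n)"
  shows "\<exists>\<delta>>0. \<forall>s. 0 < s \<longrightarrow> s \<le> \<delta> \<longrightarrow> norm ((LINT w:\<Omega>|lebesgue. bump_kernel z e s w *\<^sub>R f w) - I *\<^sub>R f z) \<le> \<epsilon> * I"
proof -
  have "z \<in> \<Omega>" using r by auto
  then obtain d where d: "d > 0" "\<And>w. w \<in> \<Omega> \<Longrightarrow> dist w z < d \<Longrightarrow> dist (f w) (f z) < \<epsilon>"
    using f \<epsilon> unfolding continuous_on_iff by metis
  show ?thesis
  proof (intro exI[of _ "min d r"] conjI allI impI)
    show "min d r > 0" using d r by simp
    fix s assume s: "0 < s" "s \<le> min d r"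
    have zero: "bump_kernel z e s w = 0" if "w \<notin> ball z s" for w
      using flat_exp_bump_arg_eq_0[OF e s(1) that] by (simp add: bump_kernel_def)
    have K: "integrable lebesgue (bump_kernel z e s)" "(LINT w|lebesgue. bump_kernel z e s w) = I"
    proof -
      have m: "bump_kernel z e s \<in> borel_measurable lborel"
        using borel_measurable_continuous_onI[OF continuous_on_bump_kernel] by simp
      show "integrable lebesgue (bump_kernel z e s)"
        using integral_bump_kernel(1)[OF s(1)] by (simp add: integrable_completion[OF m])
      show "(LINT w|lebesgue. bump_kernel z e s w) = I"
        using integral_bump_kernel(2)[OF s(1)] by (simp add: integral_completion[OF m] I_def)
    qed
    have ind: "indicator \<Omega> w *\<^sub>R (bump_kernel z e s w *\<^sub>R y) = bump_kernel z e s w *\<^sub>R y" for w and y :: "real^'d"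
      using zero[of w] s r by (cases "w \<in> ball z s") (auto simp: indicator_def)
    have i1: "integrable lebesgue (\<lambda>w. bump_kernel z e s w *\<^sub>R f w)"
    proof -
      obtain a b where ab: "cball z r \<subseteq> cbox a b"
        using bounded_subset_cbox_symmetric[OF bounded_cball, of z r] by metis
      have "set_integrable lebesgue \<Omega> (\<lambda>w. bump_kernel z e s w *\<^sub>R f w)"
        by (rule set_integral_continuous_kernel(1)[OF continuous_on_bump_kernel _ f r(2,1) ab])
          (use zero s in auto)
      then show ?thesis unfolding set_integrable_def ind .
    qed
    have i2: "integrable lebesgue (\<lambda>w. bump_kernel z e s w *\<^sub>R f z)"
      using K(1) by (rule integrable_scaleR_left)
    have "(LINT w:\<Omega>|lebesgue. bump_kernel z e s w *\<^sub>R f w) - I *\<^sub>R f z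
        = (LINT w|lebesgue. bump_kernel z e s w *\<^sub>R f w) - (LINT w|lebesgue. bump_kernel z e s w *\<^sub>R f z)"
      using K unfolding set_lebesgue_integral_def ind by simp
    also have "\<dots> = (LINT w|lebesgue. bump_kernel z e s w *\<^sub>R f w - bump_kernel z e s w *\<^sub>R f z)"
      by (rule Bochner_Integration.integral_diff[OF i1 i2, symmetric])
    also have "norm \<dots> \<le> (LINT w|lebesgue. norm (bump_kernel z e s w *\<^sub>R f w - bump_kernel z e s w *\<^sub>R f z))"
      by (rule integral_norm_bound)
    also have "\<dots> \<le> (LINT w|lebesgue. bump_kernel z e s w * \<epsilon>)"
    proof (rule integral_mono')
      fix w
      have K0: "bump_kernel z e s w \<ge> 0" by (rule bump_kernel_bounds[OF s(1)])
      show "0 \<le> bump_kernel z e s w * \<epsilon>" using K0 \<epsilon> by simp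
      show "norm (bump_kernel z e s w *\<^sub>R f w - bump_kernel z e s w *\<^sub>R f z) \<le> bump_kernel z e s w * \<epsilon>"
      proof (cases "w \<in> ball z s")
        case True
        then have "norm (f w - f z) \<le> \<epsilon>"
          using d(2)[of w] s r by (force simp: dist_norm norm_minus_commute)
        then have "bump_kernel z e s w * norm (f w - f z) \<le> bump_kernel z e s w * \<epsilon>"
          using K0 by (rule mult_left_mono)
        then show ?thesis using K0 by (simp flip: scaleR_diff_right)
      qed (simp add: zero)
    qed (use K in simp_all)
    also have "\<dots> = \<epsilon> * I" using K by simp
    finally show "norm ((LINT w:\<Omega>|lebesgue. bump_kernel z e s w *\<^sub>R f w) - I *\<^sub>R f z) \<le> \<epsilon> * I" .
  qed
qed

text \<open>The averages over the balls of radius \<open>s / 2\<close> about \<open>z + (s / 2) e\<close> lead along a cone from \<open>f z\<close> to the average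
  about \<open>x\<close>, which no longer depends on \<open>z\<close>.\<close>
lemma potential_estimate:
  fixes f :: "real^'n \<Rightarrow> real^'d" and g :: "'n \<Rightarrow> real^'n \<Rightarrow> real^'d"
  assumes f: "continuous_on \<Omega> f" and w: "\<And>i. weak_partial \<Omega> i f (g i)"
    and g: "\<And>i z r. ball z r \<subseteq> \<Omega> \<Longrightarrow> set_integrable lebesgue (ball z r) (\<lambda>w. norm (g i w))"
  defines "P \<equiv> \<lambda>z l. 2 ^ (l * (CARD('n) - 1)) * (\<Sum>i\<in>UNIV. LINT w:ball z ((1/2) ^ l)|lebesgue. norm (g i w))"
  shows "\<exists>C0>0. \<exists>c. \<forall>z m x. cball z ((1/2) ^ m) \<subseteq> \<Omega> \<longrightarrow> dist z x \<le> (1/2) ^ (m + 1) \<longrightarrow> summable (P z) \<longrightarrow>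
    norm (f z - c m x) \<le> C0 * (\<Sum>l. P z (l + m))"
proof -
  define I where "I = (LINT x|lborel. unit_bump (x :: real^'n)) / 2 ^ CARD('n)"
  have I: "I > 0" unfolding I_def by (intro divide_pos_pos integral_unit_bump_pos) simp
  define c where "c m x = (1 / I) *\<^sub>R (LINT w:\<Omega>|lebesgue.
    (flat_exp 0 (1 - (norm (2 ^ (m + 1) *\<^sub>R (w - x)))\<^sup>2) / ((1/2) ^ m) ^ CARD('n)) *\<^sub>R f w)" for m x
  have "norm (f z - c m x) \<le> 2 ^ (CARD('n) - 1) / I * (\<Sum>l. P z (l + m))"
    if z: "cball z ((1/2) ^ m) \<subseteq> \<Omega>" "dist z x \<le> (1/2) ^ (m + 1)" and sum: "summable (P z)" for z m x
  proof -
    \<comment> \<open>With this direction the ball of the kernel at \<open>s = (1/2) ^ m\<close> is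
      centred at \<open>x\<close>, and the assumption on \<open>dist z x\<close> says exactly that
      \<open>e\<close> has norm at most 1.\<close>
    define e where "e = 2 ^ (m + 1) *\<^sub>R (x - z)"
    have e: "norm e \<le> 1"
    proof -
      have "norm e = 2 ^ (m + 1) * dist z x" by (simp add: e_def dist_norm norm_minus_commute)
      also have "\<dots> \<le> 2 ^ (m + 1) * (1/2) ^ (m + 1)" by (rule mult_left_mono[OF z(2)]) simp
      also have "\<dots> = 1" by (simp only: power_mult_distrib[symmetric]) simp
      finally show ?thesis .
    qed
    define \<Phi> where "\<Phi> s = (LINT w:\<Omega>|lebesgue. bump_kernel z e s w *\<^sub>R f w)" for s
    have c: "\<Phi> ((1/2) ^ m) = I *\<^sub>R c m x"
    proof -
      have "(2 / (1/2) ^ m) *\<^sub>R (w - z) - e = 2 ^ (m + 1) *\<^sub>R (w - x)" for w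
        by (simp add: e_def power_divide algebra_simps)
      then have "bump_kernel z e ((1/2) ^ m) w
          = flat_exp 0 (1 - (norm (2 ^ (m + 1) *\<^sub>R (w - x)))\<^sup>2) / ((1/2) ^ m) ^ CARD('n)" for w
        unfolding bump_kernel_def by (subst bump_arg_eq) auto
      then show ?thesis using I by (simp add: \<Phi>_def c_def)
    qed
    have P0: "P z l \<ge> 0" for l
      unfolding P_def by (intro mult_nonneg_nonneg sum_nonneg) (auto simp: set_lebesgue_integral_def intro!: integral_nonneg_AE)
    have step: "norm (\<Phi> ((1/2) ^ l) - \<Phi> ((1/2) ^ Suc l)) \<le> 2 ^ (CARD('n) - 1) * P z l" if "m \<le> l" for l
    proof -
      have le: "(1/2::real) ^ l \<le> (1/2) ^ m" using that by (rule power_decreasing) auto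
      then have sub: "cball z ((1/2) ^ l) \<subseteq> \<Omega>" using z(1) by (meson subset_cball subset_trans)
      have "norm (\<Phi> ((1/2) ^ l) - \<Phi> ((1/2) ^ l / 2))
          \<le> 2 ^ (CARD('n) - 1) * ((\<Sum>i\<in>UNIV. LINT w:ball z ((1/2) ^ l)|lebesgue. norm (g i w)) / ((1/2) ^ l) ^ (CARD('n) - 1))"
        unfolding \<Phi>_def
      proof (rule bump_average_halve[OF f w sub _ e])
        show "set_integrable lebesgue (ball z ((1/2) ^ l)) (\<lambda>w. norm (g i w))" for i
          by (rule g) (use sub ball_subset_cball in blast)
      qed simp
      then show ?thesis by (simp add: P_def power_divide mult_ac flip: power_mult)
    qed
    have tele: "norm (\<Phi> ((1/2) ^ m) - \<Phi> ((1/2) ^ (m + k))) \<le> 2 ^ (CARD('n) - 1) * (\<Sum>l<k. P z (l + m))" for k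
    proof (induction k)
      case (Suc k)
      have "norm (\<Phi> ((1/2) ^ m) - \<Phi> ((1/2) ^ (m + Suc k)))
          \<le> norm (\<Phi> ((1/2) ^ m) - \<Phi> ((1/2) ^ (m + k))) + norm (\<Phi> ((1/2) ^ (m + k)) - \<Phi> ((1/2) ^ Suc (m + k)))"
        using norm_triangle_ineq[of "\<Phi> ((1/2) ^ m) - \<Phi> ((1/2) ^ (m + k))" "\<Phi> ((1/2) ^ (m + k)) - \<Phi> ((1/2) ^ Suc (m + k))"]
        by (simp only: add_Suc_right diff_add_cancel add_diff_eq)
      also have "\<dots> \<le> 2 ^ (CARD('n) - 1) * (\<Sum>l<k. P z (l + m)) + 2 ^ (CARD('n) - 1) * P z (m + k)"
        by (rule add_mono[OF Suc step]) simp
      finally show ?case by (simp add: distrib_left add.commute)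
    qed simp
    have sm: "summable (\<lambda>l. P z (l + m))" by (rule summable_ignore_initial_segment[OF sum])
    have bound: "norm (\<Phi> ((1/2) ^ m) - \<Phi> ((1/2) ^ (m + k))) \<le> 2 ^ (CARD('n) - 1) * (\<Sum>l. P z (l + m))" for k
      by (rule order_trans[OF tele mult_left_mono[OF sum_le_suminf[OF sm]]]) (use P0 in auto)
    have "norm (I *\<^sub>R f z - \<Phi> ((1/2) ^ m)) \<le> 2 ^ (CARD('n) - 1) * (\<Sum>l. P z (l + m))"
    proof (rule field_le_epsilon)
      fix \<epsilon> :: real assume \<epsilon>: "\<epsilon> > 0"
      have "\<exists>\<delta>>0. \<forall>s. 0 < s \<longrightarrow> s \<le> \<delta> \<longrightarrow> norm (\<Phi> s - I *\<^sub>R f z) \<le> \<epsilon> / I * I"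
        unfolding \<Phi>_def unfolding I_def
        by (rule bump_average_tendsto[OF f z(1) _ e divide_pos_pos[OF \<epsilon> I[unfolded I_def]]]) simp
      then obtain \<delta> where \<delta>: "\<delta> > 0" "\<And>s. 0 < s \<Longrightarrow> s \<le> \<delta> \<Longrightarrow> norm (\<Phi> s - I *\<^sub>R f z) \<le> \<epsilon> / I * I"
        by blast
      obtain k where k: "(1/2) ^ k < \<delta>" using real_arch_pow_inv[OF \<delta>(1), of "1/2"] by auto
      have "(1/2::real) ^ (m + k) \<le> (1/2) ^ k" by (rule power_decreasing) auto
      with k have "(1/2) ^ (m + k) \<le> \<delta>" by linarith
      then have "norm (\<Phi> ((1/2) ^ (m + k)) - I *\<^sub>R f z) \<le> \<epsilon>"
        using \<delta>(2)[of "(1/2) ^ (m + k)"] I by simp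
      then show "norm (I *\<^sub>R f z - \<Phi> ((1/2) ^ m)) \<le> 2 ^ (CARD('n) - 1) * (\<Sum>l. P z (l + m)) + \<epsilon>"
        using bound[of k] norm_triangle_ineq[of "\<Phi> ((1/2) ^ m) - \<Phi> ((1/2) ^ (m + k))" "\<Phi> ((1/2) ^ (m + k)) - I *\<^sub>R f z"]
        by (simp add: norm_minus_commute)
    qed
    moreover have "norm (I *\<^sub>R f z - \<Phi> ((1/2) ^ m)) = I * norm (f z - c m x)"
      using I by (simp add: c flip: scaleR_diff_right)
    ultimately show ?thesis using I by (simp add: field_simps)
  qed
  then show ?thesis using I by (intro exI[of _ "2 ^ (CARD('n) - 1) / I"] conjI exI[of _ c]) auto
qed

section \<open>Images of points of fast energy decay\<close>

definition energy_density :: "nat \<Rightarrow> real \<Rightarrow> real \<Rightarrow> real" where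
  "energy_density n lam G = G ^ n * ln (exp 1 + G) powr lam"

lemma one_le_ln_exp_add: "G \<ge> 0 \<Longrightarrow> 1 \<le> ln (exp 1 + G)" for G :: real
  by (subst ln_ge_iff) (auto intro: add_pos_nonneg)

lemma power_le_energy_density:
  assumes "G \<ge> 0" "lam \<ge> 0"
  shows "G ^ n \<le> energy_density n lam G"
proof -
  have "1 \<le> ln (exp 1 + G) powr lam"
    using one_le_ln_exp_add[OF assms(1)] assms(2) by (rule ge_one_powr_ge_zero)
  then have "G ^ n * 1 \<le> G ^ n * ln (exp 1 + G) powr lam"
    using assms by (intro mult_left_mono) auto
  then show ?thesis by (simp add: energy_density_def)
qed

lemma energy_density_nonneg: "G \<ge> 0 \<Longrightarrow> 0 \<le> energy_density n lam G"
  by (simp add: energy_density_def)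

text \<open>Pointwise form of the Hoelder inequality with a free level \<open>t\<close>: a value
  above the level is at most its n-th power divided by \<open>t ^ (n - 1)\<close>.\<close>

lemma le_add_power_div:
  fixes G t :: real
  assumes "G \<ge> 0" "t > 0" "n \<ge> 1"
  shows "G \<le> t + G ^ n / t ^ (n - 1)"
proof (cases "G \<le> t")
  case True
  moreover have "0 \<le> G ^ n / t ^ (n - 1)" using assms by simp
  ultimately show ?thesis by linarith
next
  case False
  have "G * t ^ (n - 1) \<le> G * G ^ (n - 1)"
    using False assms by (intro mult_left_mono power_mono) auto
  also have "\<dots> = G ^ n" using power_eq_if[of G n] assms by simp
  finally have "G \<le> G ^ n / t ^ (n - 1)" using assms by (simp add: le_divide_eq)
  then show ?thesis using assms by linarith
qed

text \<open>The level \<open>sqrt 2 ^ m\<close> separates two cases. Values below it contribute only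
  of the order of \<open>(1 / sqrt 2) ^ m\<close> to the scaled mass at scale \<open>m\<close>. For
  values above it the logarithm is at least \<open>m / 4\<close>, which yields the gain
  \<open>m powr (- lam)\<close>.\<close>

lemma le_add_energy_density_log:
  assumes G: "G \<ge> 0" and t: "t > 0" and n: "n \<ge> 1" and m: "m \<ge> 1" and lam: "lam \<ge> 0"
  shows "G \<le> (sqrt 2 ^ m + t) + 4 powr lam * real m powr (- lam) / t ^ (n - 1) * energy_density n lam G"
proof (cases "G \<le> sqrt 2 ^ m")
  case True
  have "0 \<le> 4 powr lam * real m powr (- lam) / t ^ (n - 1) * energy_density n lam G"
    using t energy_density_nonneg[OF G] by simp
  then show ?thesis using True t by linarith
next
  case False
  have "real m * (1 / 4) \<le> m * ln (sqrt 2)"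
    using ln2_ge_two_thirds by (intro mult_left_mono) (simp_all add: ln_sqrt)
  also have "\<dots> = ln (sqrt 2 ^ m)" by (simp add: ln_realpow)
  also have "\<dots> \<le> ln (exp 1 + G)"
  proof -
    have "sqrt 2 ^ m \<le> exp 1 + G" using False using exp_gt_zero[of "1::real"] by linarith
    moreover have "0 < sqrt 2 ^ m" "0 < exp 1 + G" using G by (simp_all add: add_pos_nonneg)
    ultimately show ?thesis by (simp only: ln_le_cancel_iff)
  qed
  finally have "(real m / 4) powr lam \<le> ln (exp 1 + G) powr lam"
    using lam by (intro powr_mono2) auto
  then have "G ^ n * (real m / 4) powr lam \<le> energy_density n lam G"
    unfolding energy_density_def using G by (intro mult_left_mono) auto
  then have "G ^ n \<le> energy_density n lam G / (real m / 4) powr lam"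
    using m by (simp add: le_divide_eq)
  also have "\<dots> = 4 powr lam * real m powr (- lam) * energy_density n lam G"
  proof -
    have "(real m / 4) powr lam = real m powr lam / 4 powr lam" by (simp add: powr_divide)
    then show ?thesis by (simp only: powr_minus_divide) simp
  qed
  finally have "G ^ n / t ^ (n - 1) \<le> 4 powr lam * real m powr (- lam) * energy_density n lam G / t ^ (n - 1)"
    using t by (intro divide_right_mono) auto
  moreover have "G \<le> t + G ^ n / t ^ (n - 1)" by (rule le_add_power_div[OF G t n])
  moreover have "0 \<le> sqrt 2 ^ m" by simp
  ultimately show ?thesis unfolding times_divide_eq_left by linarith
qed

lemma measure_density_eq_integral:
  assumes h: "integrable M h" "\<And>x. h x \<ge> 0" and B: "B \<in> sets M"
  shows "measure (density M (\<lambda>x. ennreal (h x))) B = (LINT x|M. h x * indicator B x)"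
proof -
  have "emeasure (density M (\<lambda>x. ennreal (h x))) B = (\<integral>\<^sup>+x. ennreal (h x) * indicator B x \<partial>M)"
    using h B by (intro emeasure_density) auto
  also have "\<dots> = (\<integral>\<^sup>+x. ennreal (h x * indicator B x) \<partial>M)"
    by (intro nn_integral_cong) (auto simp: indicator_def)
  also have "\<dots> = ennreal (LINT x|M. h x * indicator B x)"
    by (rule nn_integral_eq_integral[OF integrable_real_mult_indicator[OF B h(1)]]) (use h(2) in auto)
  finally show ?thesis
    using h by (simp add: measure_def integral_nonneg_AE)
qed

text \<open>The two pointwise inequalities are integrated over balls and annuli at level
  \<open>2 ^ m * s\<close>. The constant collects the volume bound for \<open>U\<close> inside a
  dyadic ball, the coefficient 1 of the plain inequality and the factor \<open>4 powr lam\<close>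
  from the logarithm. Boundedness of \<open>U\<close> matters at scale 0, where the dyadic ball is
  the whole space.\<close>

lemma mass_energy_density:
  fixes G :: "real^'n \<Rightarrow> real" and U :: "(real^'n) set"
  assumes n2: "CARD('n) \<ge> 2" and lam: "lam \<ge> 0" and R: "R \<ge> 0" "U \<subseteq> ball 0 R"
    and U: "open U" "U \<noteq> {}" and G [measurable]: "G \<in> borel_measurable borel" and G1: "\<And>x. G x \<ge> 1"
    and int: "integrable lborel (\<lambda>x. indicator U x * energy_density CARD('n) lam (G x))"
    and small: "(LINT x|lborel. indicator U x * energy_density CARD('n) lam (G x)) \<le> 1/2"
  shows "mass_energy (density lborel (\<lambda>x. ennreal (indicator U x * G x)))
    (density lborel (\<lambda>x. ennreal (indicator U x * energy_density CARD('n) lam (G x))))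
    (\<lambda>m. real m powr (- lam / (real CARD('n) - 1)))
    (1 + unit_ball_vol (real CARD('n)) * (R + 1) ^ CARD('n) + 4 powr lam)" (is "mass_energy ?\<mu> ?\<nu> ?w ?K")
proof -
  let ?n = "CARD('n)" and ?\<rho> = "\<lambda>x. energy_density CARD('n) lam (G x)"
  define C where "C = unit_ball_vol (real ?n) * (R + 1) ^ ?n"
  have C0: "C \<ge> 0" using R by (simp add: C_def)
  have [measurable]: "U \<in> sets borel" using U by simp
  have [measurable]: "?\<rho> \<in> borel_measurable borel"
    unfolding energy_density_def by measurable
  have G0: "G x \<ge> 0" for x using G1[of x] by linarith
  have \<rho>0: "?\<rho> x \<ge> 0" for x by (rule energy_density_nonneg[OF G0])
  have G\<rho>: "G x \<le> ?\<rho> x" for x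
  proof -
    have "G x ^ 1 \<le> G x ^ ?n" using n2 G1 by (intro power_increasing) auto
    then show ?thesis using power_le_energy_density[OF G0 lam, of x ?n] by simp
  qed
  have intG: "integrable lborel (\<lambda>x. indicator U x * G x)"
    by (rule Bochner_Integration.integrable_bound[OF int]) (use G\<rho> G0 \<rho>0 in \<open>auto simp: indicator_def\<close>)
  have mu: "measure ?\<mu> B = (LINT x|lborel. indicator U x * G x * indicator B x)" if "B \<in> sets borel" for B
    by (rule measure_density_eq_integral[OF intG]) (use that G0 in auto)
  have nu: "measure ?\<nu> B = (LINT x|lborel. indicator U x * ?\<rho> x * indicator B x)" if "B \<in> sets borel" for B
    by (rule measure_density_eq_integral[OF int]) (use that \<rho>0 in auto)
  have key: "measure ?\<mu> B \<le> a * measure lborel (U \<inter> B) + b * measure ?\<nu> B"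
    if B: "B \<in> sets borel" and le: "\<And>x. G x \<le> a + b * ?\<rho> x" for B a b
  proof -
    have fin: "emeasure lborel (U \<inter> B) < \<infinity>"
    proof -
      have "emeasure lborel (U \<inter> B) \<le> emeasure lborel (ball (0::real^'n) R)"
        using R(2) by (intro emeasure_mono) auto
      also have "\<dots> < \<infinity>" using emeasure_lborel_ball_finite by (simp add: less_top)
      finally show ?thesis .
    qed
    have i1: "integrable lborel (\<lambda>x. a * indicator (U \<inter> B) x)"
      using fin B by (intro integrable_mult_right) (auto simp: integrable_indicator_iff)
    have i2: "integrable lborel (\<lambda>x. b * (indicator U x * ?\<rho> x * indicator B x))"
      using int B by (intro integrable_mult_right integrable_real_mult_indicator) auto
    have "measure ?\<mu> B \<le> (LINT x|lborel. a * indicator (U \<inter> B) x + b * (indicator U x * ?\<rho> x * indicator B x))"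
      unfolding mu[OF B]
    proof (rule integral_mono)
      show "integrable lborel (\<lambda>x. indicator U x * G x * indicator B x)"
        using intG B by (intro integrable_real_mult_indicator) auto
      show "indicator U x * G x * indicator B x
          \<le> a * indicator (U \<inter> B) x + b * (indicator U x * ?\<rho> x * indicator B x)" for x
        using le[of x] by (auto simp: indicator_def)
    qed (use i1 i2 in auto)
    also have "\<dots> = a * measure lborel (U \<inter> B) + b * measure ?\<nu> B"
      using i1 i2 B by (simp add: nu Bochner_Integration.integral_add)
    finally show ?thesis .
  qed
  have vol: "measure lborel (U \<inter> dyadic_ball m x) \<le> C / 2 ^ (m * ?n)" for m x
  proof (cases "m = 0")
    case True
    have "measure lborel (U \<inter> dyadic_ball m x) \<le> measure lborel (ball (0::real^'n) R)"
      using True R(2) emeasure_lborel_ball_finite[of "0::real^'n" R]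
      by (intro measure_mono_fmeasurable) (auto simp: fmeasurable_def less_top)
    also have "\<dots> = unit_ball_vol (real ?n) * R ^ ?n" using R by (simp add: content_ball)
    also have "\<dots> \<le> C" unfolding C_def using R by (intro mult_left_mono power_mono) auto
    finally show ?thesis using True by simp
  next
    case False
    have "measure lborel (U \<inter> dyadic_ball m x) \<le> measure lborel (ball x ((1/2)^m))"
      using False emeasure_lborel_ball_finite[of x "(1/2)^m"]
      by (intro measure_mono_fmeasurable) (auto simp: fmeasurable_def less_top dyadic_ball_def)
    also have "\<dots> = unit_ball_vol (real ?n) * 1 / 2 ^ (m * ?n)"
      by (simp add: content_ball power_divide power_mult)
    also have "\<dots> \<le> C / 2 ^ (m * ?n)"
      unfolding C_def using R by (intro divide_right_mono mult_left_mono one_le_power) auto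
    finally show ?thesis .
  qed
  have n1: "?n \<ge> 1" using n2 by simp
  \<comment> \<open>Scaling of the level: against the normalization 2^(m(n-1)), the volume 2^(-mn)
    turns a level \<open>a\<close> into \<open>a / 2 ^ m\<close>, and the power of
    \<open>2 ^ m * s\<close> in the denominator loses its powers of 2.\<close>
  have split: "2 ^ (m * (?n - 1)) * (a * (C / 2 ^ (m * ?n)) + c / (2 ^ m * s) ^ (?n - 1) * X)
      = C * (a / 2 ^ m) + c * X / s ^ (?n - 1)" if "s > 0" for a c s X :: real and m :: nat
  proof -
    have "m * ?n = m * (?n - 1) + m" using n1 by (simp add: algebra_simps)
    then have p: "(2::real) ^ (m * ?n) = 2 ^ (m * (?n - 1)) * 2 ^ m" by (simp only: power_add)
    have q: "(2 ^ m * s) ^ (?n - 1) = 2 ^ (m * (?n - 1)) * s ^ (?n - 1)"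
      by (simp add: power_mult_distrib power_mult)
    show ?thesis unfolding p q using that by (simp add: field_simps)
  qed
  show ?thesis
  proof (rule mass_energy.intro)
    show "CARD('n) \<ge> 2" by (rule n2)
    have "emeasure ?\<mu> UNIV = (\<integral>\<^sup>+x. ennreal (indicator U x * G x) \<partial>lborel)"
      by (simp add: emeasure_density)
    also have "\<dots> < \<infinity>" using integrableD(2)[OF intG] G0 by (simp add: less_top)
    finally show "finite_measure ?\<mu>" by (intro finite_measureI) simp
    have "emeasure ?\<nu> UNIV = (\<integral>\<^sup>+x. ennreal (indicator U x * ?\<rho> x) \<partial>lborel)"
      by (simp add: emeasure_density)
    also have "\<dots> < \<infinity>" using integrableD(2)[OF int] \<rho>0 by (simp add: less_top)
    finally show "finite_measure ?\<nu>" by (intro finite_measureI) simp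
    have mU: "0 < (LINT x|lborel. indicator U x * G x)"
    proof -
      obtain y r where y: "r > 0" "ball y r \<subseteq> U" using U by (meson all_not_in_conv open_contains_ball)
      have "0 < measure lborel (ball y r)" using content_ball_pos[OF y(1), of y] by simp
      also have "\<dots> = (LINT x|lborel. indicator (ball y r) x)" by simp
      also have "\<dots> \<le> (LINT x|lborel. indicator U x * G x)"
      proof (rule integral_mono[OF _ intG])
        show "integrable lborel (indicator (ball y r) :: _ \<Rightarrow> real)"
          using emeasure_lborel_ball_finite[of y r] by (simp add: integrable_indicator_iff less_top)
        show "indicator (ball y r) x \<le> indicator U x * G x" for x
          using y(2) G1[of x] G0[of x] by (auto simp: indicator_def)
      qed
      finally show ?thesis .
    qed
    then show "measure ?\<mu> UNIV > 0" by (subst mu) auto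
    have "(LINT x|lborel. indicator U x * G x) \<le> (LINT x|lborel. indicator U x * ?\<rho> x)"
      by (rule integral_mono[OF intG int]) (use G\<rho> in \<open>auto simp: indicator_def\<close>)
    with mU show "measure ?\<nu> UNIV > 0" by (subst nu) auto
    show "measure ?\<nu> UNIV \<le> 1/2" using small by (subst nu) auto
    show "?w m > 0" if "m \<ge> 1" for m using that by simp
    show "?K \<ge> 1" using C0 by (simp add: C_def)
  next
    fix m and x :: "real^'n" and s :: real assume s: "s > 0"
    have "measure ?\<mu> (dyadic_ball m x) \<le> (2 ^ m * s) * measure lborel (U \<inter> dyadic_ball m x)
        + 1 / (2 ^ m * s) ^ (?n - 1) * measure ?\<nu> (dyadic_ball m x)"
    proof (rule key)
      fix y
      have "G y \<le> 2 ^ m * s + G y ^ ?n / (2 ^ m * s) ^ (?n - 1)"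
        using s by (intro le_add_power_div G0 n1) simp
      also have "G y ^ ?n / (2 ^ m * s) ^ (?n - 1) \<le> ?\<rho> y / (2 ^ m * s) ^ (?n - 1)"
        using s by (intro divide_right_mono power_le_energy_density G0 lam) simp
      finally show "G y \<le> 2 ^ m * s + 1 / (2 ^ m * s) ^ (?n - 1) * ?\<rho> y" by simp
    qed simp
    also have "\<dots> \<le> (2 ^ m * s) * (C / 2 ^ (m * ?n)) + 1 / (2 ^ m * s) ^ (?n - 1) * measure ?\<nu> (dyadic_ball m x)"
      using s by (intro add_right_mono mult_left_mono vol) simp
    finally have "scaled_mass ?\<mu> m x
        \<le> 2 ^ (m * (?n - 1)) * ((2 ^ m * s) * (C / 2 ^ (m * ?n)) + 1 / (2 ^ m * s) ^ (?n - 1) * measure ?\<nu> (dyadic_ball m x))"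
      unfolding scaled_mass_def by (intro mult_left_mono) auto
    also have "\<dots> = C * s + 1 * (measure ?\<nu> (dyadic_ball m x) / s ^ (?n - 1))"
      unfolding split[OF s] by simp
    also have "\<dots> \<le> ?K * s + ?K * (measure ?\<nu> (dyadic_ball m x) / s ^ (?n - 1))"
      using s C0 unfolding C_def by (intro add_mono mult_right_mono) auto
    finally show "scaled_mass ?\<mu> m x \<le> ?K * (s + measure ?\<nu> (dyadic_ball m x) / s ^ (?n - 1))"
      by (simp only: distrib_left)
  next
    fix m and x :: "real^'n" and s :: real assume m: "m \<ge> (1::nat)" and s: "s > 0"
    let ?B = "dyadic_ball m x - dyadic_ball (Suc m) x"
    let ?c = "4 powr lam * real m powr (- lam)"
    \<comment> \<open>\<open>w\<close> enters \<open>annulus_le\<close> with exponent n - 1;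
      dividing \<open>lam\<close> by n - 1 makes it match the logarithmic gain.\<close>
    have w: "?w m ^ (?n - 1) = real m powr (- lam)"
    proof -
      have "?w m ^ (?n - 1) = real m powr (- lam / (real ?n - 1) * real (?n - 1))"
        using m by (simp add: powr_powr flip: powr_realpow)
      also have "- lam / (real ?n - 1) * real (?n - 1) = - lam" using n2 by (simp add: of_nat_diff)
      finally show ?thesis .
    qed
    have "measure ?\<mu> ?B \<le> (sqrt 2 ^ m + 2 ^ m * s) * measure lborel (U \<inter> ?B) + ?c / (2 ^ m * s) ^ (?n - 1) * measure ?\<nu> ?B"
    proof (rule key)
      show "G y \<le> (sqrt 2 ^ m + 2 ^ m * s) + ?c / (2 ^ m * s) ^ (?n - 1) * ?\<rho> y" for y
        using s by (intro le_add_energy_density_log G0 n1 m lam) simp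
    qed simp
    also have "\<dots> \<le> (sqrt 2 ^ m + 2 ^ m * s) * (C / 2 ^ (m * ?n)) + ?c / (2 ^ m * s) ^ (?n - 1) * measure ?\<nu> ?B"
    proof (intro add_right_mono mult_left_mono)
      have "measure lborel (U \<inter> ?B) \<le> measure lborel (U \<inter> dyadic_ball m x)"
      proof (rule measure_mono_fmeasurable)
        have "emeasure lborel (U \<inter> dyadic_ball m x) \<le> emeasure lborel (ball (0::real^'n) R)"
          using R(2) by (intro emeasure_mono) auto
        then show "U \<inter> dyadic_ball m x \<in> fmeasurable lborel"
          using emeasure_lborel_ball_finite[of "0::real^'n" R] by (auto simp: fmeasurable_def less_top[symmetric] top_unique)
      qed auto
      also have "\<dots> \<le> C / 2 ^ (m * ?n)" by (rule vol)
      finally show "measure lborel (U \<inter> ?B) \<le> C / 2 ^ (m * ?n)" .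
    qed (use s in auto)
    finally have "2 ^ (m * (?n - 1)) * measure ?\<mu> ?B
        \<le> 2 ^ (m * (?n - 1)) * ((sqrt 2 ^ m + 2 ^ m * s) * (C / 2 ^ (m * ?n)) + ?c / (2 ^ m * s) ^ (?n - 1) * measure ?\<nu> ?B)"
      by (intro mult_left_mono) auto
    also have "\<dots> = C * ((sqrt 2 ^ m + 2 ^ m * s) / 2 ^ m) + ?c * measure ?\<nu> ?B / s ^ (?n - 1)"
      by (rule split[OF s])
    also have "(sqrt 2 ^ m + 2 ^ m * s) / 2 ^ m = (1 / sqrt 2) ^ m + s"
    proof -
      have "sqrt 2 / 2 = 1 / sqrt 2" by (simp add: field_simps)
      then have "sqrt 2 ^ m / 2 ^ m = (1 / sqrt 2) ^ m" by (metis power_divide)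
      then show ?thesis by (simp add: add_divide_distrib)
    qed
    also have "C * ((1 / sqrt 2) ^ m + s) + ?c * measure ?\<nu> ?B / s ^ (?n - 1)
        = C * ((1 / sqrt 2) ^ m + s) + 4 powr lam * (real m powr (- lam) * measure ?\<nu> ?B / s ^ (?n - 1))" by simp
    also have "\<dots> \<le> ?K * ((1 / sqrt 2) ^ m + s) + ?K * (real m powr (- lam) * measure ?\<nu> ?B / s ^ (?n - 1))"
      using s C0 unfolding C_def by (intro add_mono mult_right_mono) auto
    also have "\<dots> = ?K * ((1 / sqrt 2) ^ m + s + ?w m ^ (?n - 1) * measure ?\<nu> ?B / s ^ (?n - 1))"
      unfolding w by (simp only: distrib_left)
    finally show "2 ^ (m * (?n - 1)) * measure ?\<mu> ?B
        \<le> ?K * ((1 / sqrt 2) ^ m + s + ?w m ^ (?n - 1) * measure ?\<nu> ?B / s ^ (?n - 1))" .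
  qed auto
qed

lemma hausdorff_delta_empty [simp]: "h 0 = 0 \<Longrightarrow> \<delta> \<ge> 0 \<Longrightarrow> hausdorff_delta h \<delta> {} = 0"
  using hausdorff_delta_le_suminf[of "{}" "\<lambda>_. {}" \<delta> h] by simp

text \<open>If \<open>j0\<close> is the first layer containing \<open>x\<close>, then
  \<open>d x\<close> exceeds 2^(-(j0+1)), which is 4 times 2^(-(j0+3)). This excludes all layers
  from \<open>j0 + 3\<close> on, so at most three overlap.\<close>

lemma suminf_indicator_layers_le:
  fixes d :: "'a \<Rightarrow> real"
  defines "U \<equiv> \<lambda>j. {x. (1/2) ^ (j + 1) < d x \<and> (j = 0 \<or> d x < 4 * (1/2) ^ j)}"
  shows "(\<Sum>j. indicator (U j) x :: ennreal) \<le> 3 * indicator {x. d x > 0} x"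
proof (cases "\<exists>j. x \<in> U j")
  case False
  then have "(\<Sum>j. indicator (U j) x :: ennreal) = 0" by (simp add: indicator_def)
  then show ?thesis by simp
next
  case True
  define j0 where "j0 = (LEAST j. x \<in> U j)"
  have j0: "x \<in> U j0" unfolding j0_def using True by (rule LeastI_ex)
  have "j \<in> {j0, j0 + 1, j0 + 2}" if "x \<in> U j" for j
  proof -
    have le: "j0 \<le> j" unfolding j0_def using that by (rule Least_le)
    have "j < j0 + 3"
    proof (rule ccontr)
      assume "\<not> j < j0 + 3"
      then have ge: "j0 + 3 \<le> j" by simp
      have "(1/2) ^ (j0 + 1) < d x" using j0 by (simp add: U_def)
      also have "d x < 4 * (1/2) ^ j" using that ge by (auto simp: U_def)
      also have "\<dots> \<le> 4 * (1/2) ^ (j0 + 3)"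
        using ge by (intro mult_left_mono power_decreasing) auto
      finally show False by (simp add: power_add power3_eq_cube)
    qed
    with le show ?thesis by auto
  qed
  then have "(\<Sum>j. indicator (U j) x :: ennreal) = (\<Sum>j\<in>{j0, j0 + 1, j0 + 2}. indicator (U j) x)"
    by (intro suminf_finite) (auto simp: indicator_def)
  also have "\<dots> \<le> (\<Sum>j\<in>{j0, j0 + 1, j0 + 2}. 1)" by (intro sum_mono) (auto simp: indicator_def)
  also have "\<dots> = 3" by simp
  also have "(3::ennreal) = 3 * indicator {x. d x > 0} x"
  proof -
    have "0 < (1/2::real) ^ (j0 + 1)" by simp
    also have "\<dots> < d x" using j0 by (simp add: U_def)
    finally show ?thesis by simp
  qed
  finally show ?thesis .
qed

text \<open>The weak derivatives live on the completed Lebesgue measure, the mass measure on the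
  Borel sets; the almost everywhere majorant carries the estimate across.\<close>

lemma set_integral_le_measure_density:
  fixes G :: "real^'n \<Rightarrow> real" and h :: "real^'n \<Rightarrow> real"
  assumes int: "integrable lborel (\<lambda>x. indicator U x * G x)" and G0: "\<And>x. G x \<ge> 0" and B: "B \<in> sets borel" "B \<subseteq> U"
    and le: "AE x in lebesgue. x \<in> U \<longrightarrow> h x \<le> G x"
    and h: "set_integrable lebesgue B h"
  shows "(LINT x:B|lebesgue. h x) \<le> measure (density lborel (\<lambda>x. ennreal (indicator U x * G x))) B"
proof -
  have i: "integrable lborel (\<lambda>x. indicator U x * G x * indicator B x)"
    using int B(1) by (intro integrable_real_mult_indicator) auto
  have m: "(\<lambda>x. indicator U x * G x * indicator B x) \<in> borel_measurable lborel"
    using i by (rule borel_measurable_integrable)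
  have i': "integrable lebesgue (\<lambda>x. indicator U x * G x * indicator B x)"
    using i by (simp add: integrable_completion[OF m])
  have "(LINT x:B|lebesgue. h x) \<le> (LINT x|lebesgue. indicator U x * G x * indicator B x)"
    unfolding set_lebesgue_integral_def
  proof (rule integral_mono_AE[OF _ i'])
    show "integrable lebesgue (\<lambda>x. indicator B x *\<^sub>R h x)" using h by (simp add: set_integrable_def)
    show "AE x in lebesgue. indicator B x *\<^sub>R h x \<le> indicator U x * G x * indicator B x"
      using le by eventually_elim (use B(2) in \<open>auto simp: indicator_def\<close>)
  qed
  also have "\<dots> = (LINT x|lborel. indicator U x * G x * indicator B x)"
    by (rule integral_completion[OF m])
  also have "\<dots> = measure (density lborel (\<lambda>x. ennreal (indicator U x * G x))) B"
    using B(1) G0 by (intro measure_density_eq_integral[OF int, symmetric]) auto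
  finally show ?thesis .
qed

text \<open>From scale \<open>J + 1\<close> on, all closed dyadic balls about points of
  \<open>S\<close> stay inside \<open>V\<close>, so there the potential of the weak derivatives is
  bounded by that of the mass in \<open>V\<close>. Each of the n partial derivatives is bounded by
  \<open>G\<close> separately, whence the factor n at \<open>C0\<close>. Coarser scales do not
  matter for summability.\<close>

lemma hausdorff_delta_image_piece_le:
  fixes f :: "real^'n \<Rightarrow> real^'d" and g :: "'n \<Rightarrow> real^'n \<Rightarrow> real^'d" and G :: "real^'n \<Rightarrow> real"
    and Lf :: "nat \<Rightarrow> nat" and \<psi> :: "nat \<Rightarrow> real" and C0 lam R :: real and S V :: "(real^'n) set"
  defines "P \<equiv> \<lambda>z l. 2 ^ (l * (CARD('n) - 1)) * (\<Sum>i\<in>UNIV. LINT w:ball z ((1/2) ^ l)|lebesgue. norm (g i w))"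
    and "\<rho> \<equiv> \<lambda>x. energy_density CARD('n) lam (G x)"
    and "K \<equiv> 1 + unit_ball_vol (real CARD('n)) * (R + 1) ^ CARD('n) + 4 powr lam"
  assumes n2: "CARD('n) \<ge> 2" and lam: "lam \<ge> 0" and R: "R \<ge> 0" "V \<subseteq> ball 0 R"
    and G: "G \<in> borel_measurable borel" "\<And>x. G x \<ge> 1"
    and gG: "\<And>i. AE x in lebesgue. x \<in> V \<longrightarrow> norm (g i x) \<le> G x"
    and gint: "\<And>i z r. ball z r \<subseteq> \<Omega> \<Longrightarrow> set_integrable lebesgue (ball z r) (\<lambda>w. norm (g i w))"
    and V: "open V" "V \<subseteq> \<Omega>" and int: "integrable lborel (\<lambda>x. indicator V x * \<rho> x)"
    and small: "(LINT x|lborel. indicator V x * \<rho> x) \<le> 1/2"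
    and pot: "\<And>z m x. cball z ((1/2) ^ m) \<subseteq> \<Omega> \<Longrightarrow> dist z x \<le> (1/2) ^ (m + 1) \<Longrightarrow> summable (P z) \<Longrightarrow>
      norm (f z - c m x) \<le> C0 * (\<Sum>l. P z (l + m))" and C0: "C0 > 0"
    and S: "S \<subseteq> V" and SV: "\<And>z. z \<in> S \<Longrightarrow> ball z ((1/2) ^ J) \<subseteq> V"
    and good: "\<And>z m. z \<in> S \<Longrightarrow> m \<ge> M0 \<Longrightarrow>
      measure (density lborel (\<lambda>x. ennreal (indicator V x * \<rho> x))) (ball z ((1/2) ^ m)) \<le> \<psi> m ^ CARD('n)"
    and D: "D \<ge> 1"
    and Lf: "\<And>N. N \<ge> N0 \<Longrightarrow> N \<le> Lf N"
      "\<And>N. N \<ge> N0 \<Longrightarrow> (\<Sum>m=1..<Lf N + 2 * N + 1. real m powr (- lam / (real CARD('n) - 1))) \<le> real ((D + 16) * N)"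
      "\<And>N. N \<ge> N0 \<Longrightarrow> real (Lf N + 2 * N + 1) \<le> 2 ^ (D * N)"
    and \<psi>: "summable \<psi>" "\<And>m. \<psi> m > 0"
      "\<And>N. N \<ge> N0 \<Longrightarrow> (\<Sum>m. \<psi> (m + Lf N)) \<le> (1/2) ^ (16 * N)"
    and \<delta>: "\<delta> > 0"
  shows "hausdorff_delta (\<lambda>t. ennreal (t ^ CARD('n))) \<delta> (f ` S)
    \<le> ennreal (luzin_const CARD('n) K R D (C0 * CARD('n)) * measure (density lborel (\<lambda>x. ennreal (indicator V x * \<rho> x))) UNIV)"
proof (cases "S = {}")
  case True
  then show ?thesis using n2 \<delta> by (simp add: power_0_left)
next
  case False
  let ?\<mu> = "density lborel (\<lambda>x. ennreal (indicator V x * G x))"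
  let ?\<nu> = "density lborel (\<lambda>x. ennreal (indicator V x * \<rho> x))"
  let ?w = "\<lambda>m. real m powr (- lam / (real CARD('n) - 1))"
  have G0: "G x \<ge> 0" for x using G(2)[of x] by linarith
  have "V \<noteq> {}" using False S by auto
  then have me: "mass_energy ?\<mu> ?\<nu> ?w K"
    unfolding \<rho>_def K_def
    by (intro mass_energy_density n2 lam R V G int[unfolded \<rho>_def] small[unfolded \<rho>_def])
  then interpret mass_energy ?\<mu> ?\<nu> ?w K .
  have intG: "integrable lborel (\<lambda>x. indicator V x * G x)"
  proof (rule Bochner_Integration.integrable_bound[OF int])
    show "(\<lambda>x. indicator V x * G x) \<in> borel_measurable lborel" using V(1) G(1) by (intro borel_measurable_times borel_measurable_indicator) auto
    have "G x \<le> \<rho> x" for x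
    proof -
      have "G x ^ 1 \<le> G x ^ CARD('n)" using n2 G(2) by (intro power_increasing) auto
      then show ?thesis using power_le_energy_density[OF G0 lam, of x "CARD('n)"] by (simp add: \<rho>_def)
    qed
    then show "AE x in lborel. norm (indicator V x * G x) \<le> norm (indicator V x * \<rho> x)"
      using G0 by (intro AE_I2) (auto simp: indicator_def intro: order_trans[OF _ abs_ge_self])
  qed
  define N1 where "N1 = max (max M0 (J + 1)) 1"
  have P0: "P z l \<ge> 0" for z l
    unfolding P_def by (intro mult_nonneg_nonneg sum_nonneg) (auto simp: set_lebesgue_integral_def intro!: integral_nonneg_AE)
  have cb: "cball z ((1/2) ^ m) \<subseteq> V" if "z \<in> S" "m \<ge> N1" for z m
  proof -
    have "(1/2::real) ^ m \<le> (1/2) ^ (J + 1)" using that(2) by (intro power_decreasing) (auto simp: N1_def)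
    also have "\<dots> < (1/2) ^ J" by simp
    finally have "cball z ((1/2) ^ m) \<subseteq> ball z ((1/2) ^ J)" by (simp add: cball_subset_ball_iff)
    with SV[OF that(1)] show ?thesis by blast
  qed
  have P\<alpha>: "P z l \<le> CARD('n) * scaled_mass ?\<mu> l z" if "z \<in> S" "l \<ge> N1" for z l
  proof -
    have b: "ball z ((1/2) ^ l) \<subseteq> V" using cb[OF that] ball_subset_cball by blast
    have "(\<Sum>i\<in>UNIV. LINT w:ball z ((1/2) ^ l)|lebesgue. norm (g i w)) \<le> (\<Sum>i\<in>(UNIV::'n set). measure ?\<mu> (ball z ((1/2) ^ l)))"
      by (intro sum_mono set_integral_le_measure_density intG G0 gG gint b subset_trans[OF b V(2)]) auto
    also have "\<dots> = CARD('n) * measure ?\<mu> (dyadic_ball l z)"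
      using that(2) by (simp add: dyadic_ball_def N1_def)
    finally show ?thesis unfolding P_def scaled_mass_def by (simp add: mult_left_mono mult.left_commute)
  qed
  show ?thesis
  proof (rule hausdorff_delta_image_le[where c="\<lambda>m k. c m (lattice_point (m - 1) k)" and Lf=Lf and \<psi>=\<psi> and ?N0.0=N0 and ?N1.0=N1])
    show "S \<subseteq> ball 0 R" using S R(2) by blast
    show "C0 * real CARD('n) > 0" using C0 by simp
    show "measure ?\<nu> (dyadic_ball m z) \<le> \<psi> m ^ CARD('n)" if "z \<in> S" "m \<ge> N1" for z m
      using good[OF that(1), of m] that(2) by (simp add: N1_def dyadic_ball_def)
    fix z m k assume z: "z \<in> S" and m: "m \<ge> N1" and d: "dist z (lattice_point (m - 1) k) \<le> (1/2) ^ (m + 1)"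
      and sum: "summable (\<lambda>l. scaled_mass ?\<mu> l z)"
    have sumP: "summable (P z)"
    proof (rule summable_comparison_test'[where N=N1])
      show "summable (\<lambda>l. CARD('n) * scaled_mass ?\<mu> l z)" using sum by (rule summable_mult)
      show "norm (P z l) \<le> CARD('n) * scaled_mass ?\<mu> l z" if "l \<ge> N1" for l
        using P\<alpha>[OF z that] P0[of z l] by simp
    qed
    have "norm (f z - c m (lattice_point (m - 1) k)) \<le> C0 * (\<Sum>l. P z (l + m))"
      using cb[OF z m] V(2) by (intro pot d sumP) auto
    also have "\<dots> \<le> C0 * (\<Sum>l. CARD('n) * scaled_mass ?\<mu> (l + m) z)"
      using C0 m by (intro mult_left_mono suminf_le P\<alpha> z summable_mult summable_ignore_initial_segment sum sumP) auto
    also have "\<dots> = C0 * CARD('n) * (\<Sum>l. scaled_mass ?\<mu> (l + m) z)"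
      using suminf_mult[OF summable_ignore_initial_segment[OF sum], of "CARD('n)" m] by simp
    finally show "norm (f z - c m (lattice_point (m - 1) k)) \<le> C0 * real CARD('n) * (\<Sum>l. scaled_mass ?\<mu> (l + m) z)" .
  qed (use R(1) \<delta> D Lf \<psi> in blast)+
qed

text \<open>The layers \<open>V j\<close> of \<open>U\<close> have bounded overlap, and every point of the \<open>j\<close>-th piece of \<open>Z\<close> has a ball of
  fixed radius inside \<open>V j\<close>; thus all points of a piece may start from one common scale.\<close>
lemma hausdorff_gauge_image_eq_0:
  fixes f :: "real^'n \<Rightarrow> real^'d" and g :: "'n \<Rightarrow> real^'n \<Rightarrow> real^'d" and G :: "real^'n \<Rightarrow> real"
    and Lf :: "nat \<Rightarrow> nat" and \<psi> :: "nat \<Rightarrow> real" and lam R :: real and Z \<Omega>' :: "(real^'n) set"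
  defines "\<rho> \<equiv> \<lambda>x. energy_density CARD('n) lam (G x)"
  assumes n2: "CARD('n) \<ge> 2" and lam: "lam \<ge> 0" and R: "R \<ge> 0" "\<Omega>' \<subseteq> ball 0 R"
    and f: "continuous_on \<Omega> f" and w: "\<And>i. weak_partial \<Omega> i f (g i)"
    and gint: "\<And>i z r. ball z r \<subseteq> \<Omega> \<Longrightarrow> set_integrable lebesgue (ball z r) (\<lambda>w. norm (g i w))"
    and \<Omega>': "open \<Omega>'" "\<Omega>' \<subseteq> \<Omega>"
    and G: "G \<in> borel_measurable borel" "\<And>x. G x \<ge> 1"
    and gG: "\<And>i. AE x in lebesgue. x \<in> \<Omega>' \<longrightarrow> norm (g i x) \<le> G x"
    and int: "integrable lborel (\<lambda>x. indicator \<Omega>' x * \<rho> x)"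
    and Z: "Z \<subseteq> \<Omega>'" "Z \<in> null_sets lebesgue"
    and good: "\<And>z m. z \<in> Z \<Longrightarrow> m \<ge> M0 \<Longrightarrow>
      measure (density lborel (\<lambda>x. ennreal (indicator \<Omega>' x * \<rho> x))) (ball z ((1/2) ^ m)) \<le> \<psi> m ^ CARD('n)"
    and D: "D \<ge> 1"
    and Lf: "\<And>N. N \<ge> N0 \<Longrightarrow> N \<le> Lf N"
      "\<And>N. N \<ge> N0 \<Longrightarrow> (\<Sum>m=1..<Lf N + 2 * N + 1. real m powr (- lam / (real CARD('n) - 1))) \<le> real ((D + 16) * N)"
      "\<And>N. N \<ge> N0 \<Longrightarrow> real (Lf N + 2 * N + 1) \<le> 2 ^ (D * N)"
    and \<psi>: "summable \<psi>" "\<And>m. \<psi> m > 0"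
      "\<And>N. N \<ge> N0 \<Longrightarrow> (\<Sum>m. \<psi> (m + Lf N)) \<le> (1/2) ^ (16 * N)"
  shows "hausdorff_gauge (\<lambda>t. ennreal (t ^ CARD('n))) (f ` Z) = 0"
  unfolding hausdorff_gauge_eq_0_iff
proof (intro allI impI)
  fix \<delta> :: real assume \<delta>: "\<delta> > 0"
  let ?\<nu> = "\<lambda>V. density lborel (\<lambda>x. ennreal (indicator V x * \<rho> x))"
  have \<rho>0: "\<rho> x \<ge> 0" for x
    unfolding \<rho>_def using G(2)[of x] by (intro energy_density_nonneg) linarith
  have \<rho>m [measurable]: "\<rho> \<in> borel_measurable borel"
    unfolding \<rho>_def energy_density_def using G(1) by measurable
  obtain C0 c where C0: "C0 > 0" and pot: "\<forall>z m x. cball z ((1/2) ^ m) \<subseteq> \<Omega> \<longrightarrow> dist z x \<le> (1/2) ^ (m + 1) \<longrightarrow>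
      summable (\<lambda>l. 2 ^ (l * (CARD('n) - 1)) * (\<Sum>i\<in>UNIV. LINT w:ball z ((1/2) ^ l)|lebesgue. norm (g i w))) \<longrightarrow>
      norm (f z - c m x) \<le> C0 * (\<Sum>l. 2 ^ ((l + m) * (CARD('n) - 1)) * (\<Sum>i\<in>UNIV. LINT w:ball z ((1/2) ^ (l + m))|lebesgue. norm (g i w)))"
    using potential_estimate[OF f w gint] by blast
  define K where "K = 1 + unit_ball_vol (real CARD('n)) * (R + 1) ^ CARD('n) + 4 powr lam"
  define K1 where "K1 = luzin_const CARD('n) K R D (C0 * CARD('n))"
  have K0: "K \<ge> 0" using R by (simp add: K_def)
  have K1: "K1 \<ge> 0"
    unfolding K1_def luzin_const_def Let_def using K0 R(1) C0
    by (intro mult_nonneg_nonneg zero_le_power) auto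
  have intV: "integrable lborel (\<lambda>x. indicator V x * \<rho> x)" if "V \<in> sets borel" "V \<subseteq> \<Omega>'" for V
    by (rule Bochner_Integration.integrable_bound[OF int])
      (use that \<rho>0 in \<open>auto simp: indicator_def intro!: borel_measurable_times borel_measurable_indicator\<close>)
  have fin: "finite_measure (?\<nu> \<Omega>')"
  proof (rule finite_measureI)
    have "emeasure (?\<nu> \<Omega>') UNIV = (\<integral>\<^sup>+x. ennreal (indicator \<Omega>' x * \<rho> x) \<partial>lborel)"
      using \<Omega>'(1) by (subst emeasure_density) auto
    also have "\<dots> < \<infinity>" using integrableD(2)[OF int] \<rho>0 by (simp add: less_top)
    finally show "emeasure (?\<nu> \<Omega>') (space (?\<nu> \<Omega>')) \<noteq> \<infinity>" by simp
  qed
  then interpret \<nu>: finite_measure "?\<nu> \<Omega>'" .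
  have restr: "emeasure (?\<nu> V) B = emeasure (?\<nu> \<Omega>') (V \<inter> B)" if "V \<in> sets borel" "V \<subseteq> \<Omega>'" "B \<in> sets borel" for V B
    using that \<Omega>'(1)
    by (simp add: emeasure_density) (intro nn_integral_cong, auto simp: indicator_def)
  have bound: "hausdorff_delta (\<lambda>t. ennreal (t ^ CARD('n))) \<delta> (f ` Z) \<le> ennreal (3 * K1 * \<epsilon>)"
    if \<epsilon>: "0 < \<epsilon>" "\<epsilon> \<le> 1/2" for \<epsilon>
  proof -
    obtain B where B: "B \<in> null_sets lborel" "Z \<subseteq> B"
      using Z(2) null_sets_completion_iff2[of Z lborel] by auto
    have "B \<in> null_sets (?\<nu> \<Omega>')"
      using B(1) \<Omega>'(1) by (subst null_sets_density_iff) (auto intro: AE_I')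
    then have "emeasure (?\<nu> \<Omega>') B = 0" by auto
    moreover have "emeasure (?\<nu> \<Omega>') B = (INF U \<in> {U. B \<subseteq> U \<and> open U}. emeasure (?\<nu> \<Omega>') U)"
      by (rule outer_regular) (use B(1) \<nu>.emeasure_finite in auto)
    ultimately have "(INF U \<in> {U. B \<subseteq> U \<and> open U}. emeasure (?\<nu> \<Omega>') U) < ennreal \<epsilon>" using \<epsilon> by simp
    then obtain U1 where U1: "B \<subseteq> U1" "open U1" "emeasure (?\<nu> \<Omega>') U1 < ennreal \<epsilon>"
      unfolding INF_less_iff by auto
    define U where "U = U1 \<inter> \<Omega>'"
    have U: "open U" "Z \<subseteq> U" "U \<subseteq> \<Omega>'" using U1 B Z \<Omega>' by (auto simp: U_def)
    have U\<epsilon>: "emeasure (?\<nu> \<Omega>') U \<le> ennreal \<epsilon>"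
      using emeasure_mono[of U U1 "?\<nu> \<Omega>'"] U1 unfolding U_def by (auto intro: order_trans less_imp_le)
    \<comment> \<open>\<open>infdist\<close> to the empty set is 0 by convention, so the
      characterization of \<open>U\<close> by \<open>d x > 0\<close> needs a nonempty complement;
      boundedness provides it.\<close>
    have ne: "- U \<noteq> {}"
    proof
      assume "- U = {}"
      then have "(UNIV::(real^'n) set) \<subseteq> ball 0 R" using U(3) R(2) by blast
      then show False using bounded_subset[OF bounded_ball] not_bounded_UNIV by blast
    qed
    define d where "d x = infdist x (- U)" for x
    have dpos: "d x > 0 \<longleftrightarrow> x \<in> U" for x
      using in_closed_iff_infdist_zero[of "- U" x] ne U(1) infdist_nonneg[of x "- U"] unfolding d_def by fastforce
    have dcont: "continuous_on UNIV d"
      unfolding d_def by (intro continuous_intros)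
    define V where "V j = {x. (1/2) ^ (j + 1) < d x \<and> (j = 0 \<or> d x < 4 * (1/2) ^ j)}" for j :: nat
    have V: "open (V j)" "V j \<subseteq> U" for j
    proof -
      have "open {x. (1/2) ^ (j + 1) < d x}" "open {x. d x < 4 * (1/2) ^ j}"
        using dcont by (auto intro!: open_Collect_less continuous_intros)
      then have "open ({x. (1/2) ^ (j + 1) < d x} \<inter> (if j = 0 then UNIV else {x. d x < 4 * (1/2) ^ j}))" by auto
      also have "({x. (1/2) ^ (j + 1) < d x} \<inter> (if j = 0 then UNIV else {x. d x < 4 * (1/2) ^ j})) = V j"
        by (auto simp: V_def)
      finally show "open (V j)" .
      show "V j \<subseteq> U"
      proof
        fix x assume "x \<in> V j"
        then have "(1/2) ^ (j + 1) < d x" by (simp add: V_def)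
        moreover have "0 < (1/2::real) ^ (j + 1)" by simp
        ultimately have "0 < d x" by linarith
        then show "x \<in> U" by (simp add: dpos)
      qed
    qed
    \<comment> \<open>The interval of distances for \<open>S j\<close> sits inside that for
      \<open>V j\<close> with margin at least 2^(-(j+1)), which is the radius of the balls in
      \<open>ballV\<close>. Layer 0 is unbounded above in both.\<close>
    define S where "S j = {z \<in> Z. (1/2) ^ j \<le> d z \<and> (j = 0 \<or> d z < 2 * (1/2) ^ j)}" for j :: nat
    have cover: "Z \<subseteq> (\<Union>j. S j)"
    proof
      fix z assume z: "z \<in> Z"
      then have "d z > 0" using U dpos by auto
      then obtain k where k: "(1/2) ^ k < d z" using real_arch_pow_inv[of "d z" "1/2"] by auto
      define j where "j = (LEAST j. (1/2) ^ j \<le> d z)"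
      have j: "(1/2) ^ j \<le> d z" unfolding j_def by (rule LeastI[of _ k]) (use k in simp)
      have "d z < 2 * (1/2) ^ j" if "j \<noteq> 0"
      proof -
        have "j - 1 < j" using that by simp
        then have "\<not> (1/2) ^ (j - 1) \<le> d z" unfolding j_def by (rule not_less_Least)
        moreover have "(1/2::real) ^ j = (1/2) * (1/2) ^ (j - 1)" using that power_eq_if[of "1/2::real" j] by simp
        ultimately show ?thesis by simp
      qed
      with j z show "z \<in> (\<Union>j. S j)" by (auto simp: S_def)
    qed
    have ballV: "ball z ((1/2) ^ (j + 1)) \<subseteq> V j" if "z \<in> S j" for z j
    proof
      fix x assume "x \<in> ball z ((1/2) ^ (j + 1))"
      then have "\<bar>d x - d z\<bar> < (1/2) ^ (j + 1)"
        using infdist_triangle_abs[of x "- U" z] unfolding d_def by (simp add: dist_commute)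
      then have x: "d z - (1/2) ^ (j + 1) < d x" "d x < d z + (1/2) ^ (j + 1)" by linarith+
      have p: "(1/2::real) ^ j = 2 * (1/2) ^ (j + 1)" "(0::real) < (1/2) ^ (j + 1)" by simp_all
      have z: "(1/2) ^ j \<le> d z" "j \<noteq> 0 \<Longrightarrow> d z < 2 * (1/2) ^ j" using that by (auto simp: S_def)
      have "(1/2) ^ (j + 1) < d x" using x(1) z(1) p by linarith
      moreover have "d x < 4 * (1/2) ^ j" if "j \<noteq> 0" using x(2) z(2)[OF that] p by linarith
      ultimately show "x \<in> V j" unfolding V_def by blast
    qed
    have piece: "hausdorff_delta (\<lambda>t. ennreal (t ^ CARD('n))) \<delta> (f ` S j) \<le> ennreal K1 * emeasure (?\<nu> \<Omega>') (V j)" for j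
    proof -
      have Vb: "V j \<in> sets borel" "V j \<subseteq> \<Omega>'"
        using borel_open[OF V(1)] order_trans[OF V(2) U(3)] by simp_all
      have em: "emeasure (?\<nu> (V j)) UNIV = emeasure (?\<nu> \<Omega>') (V j)" using restr[OF Vb, of UNIV] by simp
      have small: "(LINT x|lborel. indicator (V j) x * \<rho> x) \<le> 1/2"
      proof -
        have "(LINT x|lborel. indicator (V j) x * \<rho> x) = measure (?\<nu> (V j)) UNIV"
          using measure_density_eq_integral[OF intV[OF Vb], of UNIV] \<rho>0 by simp
        also have "\<dots> \<le> \<epsilon>"
        proof -
          have "emeasure (?\<nu> \<Omega>') (V j) \<le> emeasure (?\<nu> \<Omega>') U" using V U by (intro emeasure_mono) auto
          then have "emeasure (?\<nu> (V j)) UNIV \<le> ennreal \<epsilon>" using U\<epsilon> em by (auto intro: order_trans)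
          then show ?thesis using \<epsilon> by (simp add: measure_def enn2real_leI)
        qed
        finally show ?thesis using \<epsilon> by simp
      qed
      have "hausdorff_delta (\<lambda>t. ennreal (t ^ CARD('n))) \<delta> (f ` S j)
          \<le> ennreal (luzin_const CARD('n) K R D (C0 * CARD('n)) * measure (?\<nu> (V j)) UNIV)"
        unfolding K_def \<rho>_def
      proof (rule hausdorff_delta_image_piece_le[where \<Omega>=\<Omega> and g=g and c=c and J="j + 1" and ?M0.0=M0 and ?N0.0=N0 and Lf=Lf and \<psi>=\<psi>])
        show "V j \<subseteq> ball 0 R" using Vb R by blast
        show "AE x in lebesgue. x \<in> V j \<longrightarrow> norm (g i x) \<le> G x" for i
          using gG[of i] by eventually_elim (use Vb in auto)
        show "integrable lborel (\<lambda>x. indicator (V j) x * energy_density CARD('n) lam (G x))"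
          using intV[OF Vb] by (simp add: \<rho>_def)
        show "(LINT x|lborel. indicator (V j) x * energy_density CARD('n) lam (G x)) \<le> 1/2"
          using small by (simp add: \<rho>_def)
        show "S j \<subseteq> V j"
        proof
          fix z assume "z \<in> S j"
          moreover have "z \<in> ball z ((1/2) ^ (j + 1))" by simp
          ultimately show "z \<in> V j" using ballV by blast
        qed
        show "measure (density lborel (\<lambda>x. ennreal (indicator (V j) x * energy_density CARD('n) lam (G x)))) (ball z ((1/2) ^ m)) \<le> \<psi> m ^ CARD('n)"
          if "z \<in> S j" "m \<ge> M0" for z m
        proof -
          have "measure (?\<nu> (V j)) (ball z ((1/2) ^ m)) = measure (?\<nu> \<Omega>') (V j \<inter> ball z ((1/2) ^ m))"
            using restr[OF Vb, of "ball z ((1/2) ^ m)"] by (simp add: measure_def)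
          also have "\<dots> \<le> measure (?\<nu> \<Omega>') (ball z ((1/2) ^ m))"
            by (rule \<nu>.finite_measure_mono) auto
          also have "\<dots> \<le> \<psi> m ^ CARD('n)" using that by (intro good) (auto simp: S_def)
          finally show ?thesis by (simp add: \<rho>_def)
        qed
        show "norm (f z - c m x) \<le> C0 * (\<Sum>l. 2 ^ ((l + m) * (CARD('n) - 1)) *
            (\<Sum>i\<in>UNIV. LINT w:ball z ((1/2) ^ (l + m))|lebesgue. norm (g i w)))"
          if "cball z ((1/2) ^ m) \<subseteq> \<Omega>" "dist z x \<le> (1/2) ^ (m + 1)"
            "summable (\<lambda>l. 2 ^ (l * (CARD('n) - 1)) * (\<Sum>i\<in>UNIV. LINT w:ball z ((1/2) ^ l)|lebesgue. norm (g i w)))" for z m x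
          using pot that by blast
      qed (use n2 lam R(1) G gint V(1) Vb(2) \<Omega>'(2) C0 ballV D Lf \<psi> \<delta> in blast)+
      also have "\<dots> = ennreal K1 * ennreal (measure (?\<nu> (V j)) UNIV)"
        using K1 by (simp add: K1_def ennreal_mult)
      also have "ennreal (measure (?\<nu> (V j)) UNIV) = emeasure (?\<nu> (V j)) UNIV"
        unfolding measure_def em by (rule \<nu>.emeasure_eq_measure[unfolded measure_def, symmetric])
      finally show ?thesis unfolding em .
    qed
    have "hausdorff_delta (\<lambda>t. ennreal (t ^ CARD('n))) \<delta> (f ` Z) \<le> hausdorff_delta (\<lambda>t. ennreal (t ^ CARD('n))) \<delta> (\<Union>j. f ` S j)"
      using cover by (intro hausdorff_delta_mono) blast
    also have "\<dots> \<le> (\<Sum>j. hausdorff_delta (\<lambda>t. ennreal (t ^ CARD('n))) \<delta> (f ` S j))"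
      by (rule hausdorff_delta_countable_subadditive)
    also have "\<dots> \<le> (\<Sum>j. ennreal K1 * emeasure (?\<nu> \<Omega>') (V j))"
      by (intro suminf_le piece) auto
    also have "\<dots> = ennreal K1 * (\<Sum>j. emeasure (?\<nu> \<Omega>') (V j))" by simp
    also have "(\<Sum>j. emeasure (?\<nu> \<Omega>') (V j)) = (\<integral>\<^sup>+x. (\<Sum>j. indicator (V j) x) \<partial>?\<nu> \<Omega>')"
      using V(1) by (subst nn_integral_suminf) auto
    also have "\<dots> \<le> (\<integral>\<^sup>+x. 3 * indicator U x \<partial>?\<nu> \<Omega>')"
    proof (rule nn_integral_mono)
      fix x
      have "{x. d x > 0} = U" using dpos by auto
      then show "(\<Sum>j. indicator (V j) x :: ennreal) \<le> 3 * indicator U x"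
        using suminf_indicator_layers_le[of d x] unfolding V_def by simp
    qed
    also have "\<dots> = 3 * emeasure (?\<nu> \<Omega>') U"
      using U(1) by (simp add: nn_integral_cmult_indicator)
    also have "ennreal K1 * (3 * emeasure (?\<nu> \<Omega>') U) \<le> ennreal K1 * (3 * ennreal \<epsilon>)"
      using U\<epsilon> by (intro mult_left_mono) auto
    also have "\<dots> = ennreal (3 * K1 * \<epsilon>)"
    proof -
      have "(3::ennreal) = ennreal 3" by simp
      then show ?thesis using K1 \<epsilon> by (simp only: ennreal_mult[symmetric] mult_ac)
    qed
    finally show ?thesis by (simp add: mult_left_mono)
  qed
  have "hausdorff_delta (\<lambda>t. ennreal (t ^ CARD('n))) \<delta> (f ` Z) \<le> 0"
  proof (rule ennreal_le_epsilon)
    fix e :: real assume e: "e > 0"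
    \<comment> \<open>The bound 1/2 is the one that the locale imposes on the total energy; the
      summand 1 in the denominator covers the case \<open>K1 = 0\<close>.\<close>
    define \<epsilon> where "\<epsilon> = min (1/2) (e / (3 * K1 + 1))"
    have \<epsilon>: "0 < \<epsilon>" using e K1 by (simp add: \<epsilon>_def)
    have \<epsilon>2: "\<epsilon> \<le> 1/2" unfolding \<epsilon>_def by (rule min.cobounded1)
    have "3 * K1 * \<epsilon> \<le> (3 * K1 + 1) * (e / (3 * K1 + 1))"
      using K1 \<epsilon> by (intro mult_mono) (auto simp: \<epsilon>_def)
    also have "\<dots> = e" using K1 by simp
    finally have "ennreal (3 * K1 * \<epsilon>) \<le> ennreal e" by (rule ennreal_leI)
    then show "hausdorff_delta (\<lambda>t. ennreal (t ^ CARD('n))) \<delta> (f ` Z) \<le> 0 + ennreal e"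
      unfolding add_0_left by (rule order_trans[OF bound[OF \<epsilon> \<epsilon>2]])
  qed
  then show "hausdorff_delta (\<lambda>t. ennreal (t ^ CARD('n))) \<delta> (f ` Z) = 0" unfolding le_zero_eq .
qed

section \<open>Points of slow energy decay\<close>

text \<open>The five-fold enlargement of a ball of radius 2^(-m) has diameter 10 times 2^(-m), hence
  the argument of \<open>h\<close>. The selected balls are disjoint, so their measures add up to at
  most the finite total; the free factor \<epsilon> then forces the value 0.\<close>

lemma hausdorff_gauge_eq_0_by_density:
  fixes E :: "'a::euclidean_space set" and h :: "real \<Rightarrow> ennreal"
  assumes fin: "finite_measure \<nu>" and sets: "sets \<nu> = sets borel" and h0: "h 0 = 0"
    and dens: "\<And>\<epsilon> m0 z. \<epsilon> > 0 \<Longrightarrow> z \<in> E \<Longrightarrow>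
      \<exists>m\<ge>m0. h (10 * (1/2) ^ m) \<le> ennreal \<epsilon> * emeasure \<nu> (ball z ((1/2) ^ m))"
  shows "hausdorff_gauge h E = 0"
  unfolding hausdorff_gauge_eq_0_iff
proof (intro allI impI)
  fix \<delta> :: real assume \<delta>: "\<delta> > 0"
  interpret finite_measure \<nu> by (rule fin)
  obtain m0 where m0: "(1/2) ^ m0 < \<delta> / 10" using real_arch_pow_inv[of "\<delta> / 10" "1/2"] \<delta> by auto
  have bound: "hausdorff_delta h \<delta> E \<le> ennreal \<epsilon> * emeasure \<nu> UNIV" if \<epsilon>: "\<epsilon> > 0" for \<epsilon>
  proof -
    have "\<forall>z\<in>E. \<exists>m. m \<ge> m0 \<and> h (10 * (1/2) ^ m) \<le> ennreal \<epsilon> * emeasure \<nu> (ball z ((1/2) ^ m))"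
      using dens[OF \<epsilon>] by blast
    from bchoice[OF this] obtain m where m: "\<And>z. z \<in> E \<Longrightarrow> m z \<ge> m0"
      "\<And>z. z \<in> E \<Longrightarrow> h (10 * (1/2) ^ m z) \<le> ennreal \<epsilon> * emeasure \<nu> (ball z ((1/2) ^ m z))"
      by blast
    define r where "r z = (1/2::real) ^ m z" for z
    have "\<exists>C. countable C \<and> C \<subseteq> E \<and> pairwise (\<lambda>i j. disjnt (ball i (r i)) (ball j (r j))) C
        \<and> E \<subseteq> (\<Union>i\<in>C. ball i (5 * r i))"
      by (rule Vitali_covering_lemma_balls[where S=E and K=E and a="\<lambda>z. z" and r=r and B=1])
        (auto simp: r_def power_le_one)
    then obtain C where C: "countable C" "C \<subseteq> E"
      "pairwise (\<lambda>i j. disjnt (ball i (r i)) (ball j (r j))) C" "E \<subseteq> (\<Union>i\<in>C. ball i (5 * r i))" by blast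
    have dia: "diameter (ball z (5 * r z)) = 10 * (1/2) ^ m z" for z
      by (simp add: r_def)
    have "hausdorff_delta h \<delta> E \<le> (\<integral>\<^sup>+z. h (diameter (ball z (5 * r z))) \<partial>count_space C)"
    proof (rule hausdorff_delta_countable_cover[where h=h and D="\<lambda>z. ball z (5 * r z)", OF C(1,4) h0])
      fix z assume z: "z \<in> C"
      have "(1/2::real) ^ m z \<le> (1/2) ^ m0" using m(1) C(2) z by (intro power_decreasing) auto
      with m0 show "diameter (ball z (5 * r z)) \<le> \<delta>" unfolding dia by linarith
    qed (use \<delta> in auto)
    also have "\<dots> \<le> (\<integral>\<^sup>+z. ennreal \<epsilon> * emeasure \<nu> (ball z (r z)) \<partial>count_space C)"
      unfolding dia using m(2) C(2) by (intro nn_integral_mono) (auto simp: r_def)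
    also have "\<dots> = ennreal \<epsilon> * (\<integral>\<^sup>+z. emeasure \<nu> (ball z (r z)) \<partial>count_space C)"
      by (rule nn_integral_cmult) simp
    also have "(\<integral>\<^sup>+z. emeasure \<nu> (ball z (r z)) \<partial>count_space C) = emeasure \<nu> (\<Union>z\<in>C. ball z (r z))"
    proof (rule emeasure_UN_countable[symmetric])
      show "disjoint_family_on (\<lambda>z. ball z (r z)) C"
        using C(3) unfolding disjoint_family_on_def pairwise_def disjnt_def by blast
    qed (use C(1) sets in auto)
    also have "ennreal \<epsilon> * \<dots> \<le> ennreal \<epsilon> * emeasure \<nu> UNIV"
      using sets by (intro mult_left_mono emeasure_mono) auto
    finally show ?thesis .
  qed
  have "hausdorff_delta h \<delta> E \<le> 0"
  proof (rule ennreal_le_epsilon)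
    fix e :: real assume e: "e > 0"
    define M where "M = measure \<nu> UNIV"
    have M: "emeasure \<nu> UNIV = ennreal M" "M \<ge> 0" unfolding M_def by (simp_all add: emeasure_eq_measure)
    have "hausdorff_delta h \<delta> E \<le> ennreal (e / (M + 1)) * emeasure \<nu> UNIV"
      by (rule bound) (use e M in auto)
    also have "\<dots> = ennreal (e / (M + 1) * M)" unfolding M(1) using e M by (intro ennreal_mult[symmetric]) auto
    also have "\<dots> \<le> ennreal e"
    proof (rule ennreal_leI)
      have "e / (M + 1) * M \<le> e / (M + 1) * (M + 1)" using e M by (intro mult_left_mono) auto
      also have "\<dots> = e" using M by simp
      finally show "e / (M + 1) * M \<le> e" .
    qed
    finally show "hausdorff_delta h \<delta> E \<le> 0 + ennreal e" by simp
  qed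
  then show "hausdorff_delta h \<delta> E = 0" by simp
qed

text \<open>A threshold for the n-th root of the energy of the ball of radius 2^(-m), in a countable
  family that replaces the continuum of exponents \<gamma>. It meets two opposite demands: it is
  summable in \<open>m\<close>, so that the potential converges, and for suitable \<open>k\<close>
  its n-th power eventually exceeds every multiple of a given gauge. It increases with
  \<open>k\<close>.\<close>

definition decay :: "real \<Rightarrow> nat \<Rightarrow> nat \<Rightarrow> real" where
  "decay al k m = (if al > 0 then exp (- (real m powr al / real (k + 1)))
     else real (m + 1) powr (- (1 + 1 / real (k + 1))))"

lemma decay_pos: "decay al k m > 0"
  by (simp add: decay_def)

lemma decay_mono: "k \<le> k' \<Longrightarrow> decay al k m \<le> decay al k' m"
  by (auto simp: decay_def intro!: divide_left_mono powr_mono)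

text \<open>With an integer \<open>j\<close> of at least \<open>2 / al\<close>, the j-th power of
  \<open>c * m powr al / j\<close> lies below the exponential and is at least a multiple of
  \<open>m powr 2\<close>.\<close>

lemma summable_exp_neg_powr:
  assumes "al > 0" "c > 0"
  shows "summable (\<lambda>m. exp (- (c * real m powr al)))"
proof -
  define j where "j = Suc (nat \<lceil>2 / al\<rceil>)"
  have j: "2 \<le> al * real j" "j > 0"
  proof -
    have "2 / al \<le> real j" unfolding j_def by linarith
    then show "2 \<le> al * real j" using assms(1) by (simp add: divide_le_eq mult.commute)
  qed (simp add: j_def)
  show ?thesis
  proof (rule summable_comparison_test'[where N=1])
    show "summable (\<lambda>m. (j / c) ^ j * real m powr (-2))"
      by (intro summable_mult) (subst summable_real_powr_iff, simp)
    fix m :: nat assume m: "m \<ge> 1"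
    have "real m powr 2 \<le> real m powr (al * real j)" using m j by (intro powr_mono) auto
    also have "\<dots> = (real m powr al) ^ j" using m by (simp add: powr_powr flip: powr_realpow)
    finally have p: "real m powr 2 \<le> (real m powr al) ^ j" .
    have "(c / j) ^ j * real m powr 2 \<le> (c / j) ^ j * (real m powr al) ^ j"
      using assms by (intro mult_left_mono p) auto
    also have "\<dots> = (c * real m powr al / j) ^ j"
      by (simp only: power_mult_distrib[symmetric] times_divide_eq_left)
    also have "\<dots> \<le> (1 + c * real m powr al / j) ^ j"
      using assms by (intro power_mono) auto
    also have "\<dots> \<le> exp (c * real m powr al)"
      using assms j by (intro exp_ge_one_plus_x_over_n_power_n) (auto intro: order_trans[of _ 0])
    finally have le: "(c / j) ^ j * real m powr 2 \<le> exp (c * real m powr al)" .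
    have pos: "(c / j) ^ j * real m powr 2 > 0" using assms j m by simp
    have "exp (- (c * real m powr al)) = 1 / exp (c * real m powr al)" by (simp add: exp_minus inverse_eq_divide)
    also have "\<dots> \<le> 1 / ((c / j) ^ j * real m powr 2)"
      using le pos by (intro divide_left_mono) auto
    also have "\<dots> = (j / c) ^ j * real m powr (-2)"
      using m by (simp add: power_divide powr_minus_divide)
    finally show "norm (exp (- (c * real m powr al))) \<le> (j / c) ^ j * real m powr (-2)" by simp
  qed
qed

text \<open>By the mean value theorem each summand is at most the increment of
  \<open>m powr al / al\<close>, because the exponent \<open>al - 1\<close> is not positive; the
  increments telescope.\<close>

lemma sum_powr_le:
  assumes "0 < al" "al \<le> 1" "M \<ge> 1"
  shows "(\<Sum>m=1..<M. real m powr (al - 1)) \<le> real M powr al / al"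
proof -
  have "real m powr (al - 1) \<le> (real m powr al - real (m - 1) powr al) / al" if "m \<ge> 1" for m
  proof (cases "m = 1")
    case True
    then show ?thesis using assms by (simp add: le_divide_eq)
  next
    case False
    then have m: "real m - 1 > 0" using that by simp
    have "\<exists>\<xi>. real m - 1 < \<xi> \<and> \<xi> < real m \<and>
        real m powr al - (real m - 1) powr al = (real m - (real m - 1)) * (al * \<xi> powr (al - 1))"
      by (rule MVT2) (use m in \<open>auto intro!: derivative_eq_intros\<close>)
    then obtain \<xi> where \<xi>: "real m - 1 < \<xi>" "\<xi> < real m"
      "real m powr al - (real m - 1) powr al = al * \<xi> powr (al - 1)" by auto
    have "real m powr (al - 1) \<le> \<xi> powr (al - 1)"
      using \<xi> m assms by (intro powr_mono2') auto
    then show ?thesis using \<xi>(3) assms that by (simp add: of_nat_diff)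
  qed
  then have "(\<Sum>m=1..<M. real m powr (al - 1)) \<le> (\<Sum>m=1..<M. (real m powr al - real (m - 1) powr al) / al)"
    by (intro sum_mono) auto
  also have "\<dots> = real (M - 1) powr al / al"
    using assms(3) by (induction M rule: dec_induct) (use assms(1) in \<open>auto simp: diff_divide_distrib\<close>)
  also have "\<dots> \<le> real M powr al / al"
    using assms by (intro divide_right_mono powr_mono2) auto
  finally show ?thesis .
qed

lemma sum_inverse_le:
  assumes "M \<ge> 1"
  shows "(\<Sum>m=1..<M. real m powr (- 1)) \<le> 1 + ln (real M)"
proof -
  have "real m powr (- 1) \<le> (if m = 1 then 1 else 0) + (ln (real m) - ln (real (m - 1)))" if "m \<ge> 1" for m
  proof (cases "m = 1")
    case False
    then have m: "real (m - 1) > 0" "real (m - 1) = real m - 1" using that by (auto simp: of_nat_diff)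
    have "ln (real (m - 1) / real m) \<le> real (m - 1) / real m - 1"
      using m that by (intro ln_le_minus_one) auto
    also have "\<dots> = - (1 / real m)" using m that by (simp add: field_simps)
    finally show ?thesis using m False that by (simp add: ln_div powr_minus_divide)
  qed simp
  then have "(\<Sum>m=1..<M. real m powr (- 1)) \<le> (\<Sum>m=1..<M. (if m = 1 then 1 else 0) + (ln (real m) - ln (real (m - 1))))"
    by (intro sum_mono) auto
  also have "\<dots> \<le> 1 + ln (real (M - 1))"
    using assms by (induction M rule: dec_induct) auto
  also have "ln (real (M - 1)) \<le> ln (real M)"
    using assms by (cases "M = 1") auto
  finally show ?thesis by simp
qed

lemma suminf_scaled_le:
  fixes a b :: "nat \<Rightarrow> real"
  assumes "summable b" "\<And>m. 0 \<le> a m" "\<And>m. 0 \<le> b m" "c \<ge> 0" "\<And>m. m \<ge> L \<Longrightarrow> a m \<le> c * b m"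
  shows "(\<Sum>m. a (m + L)) \<le> c * (\<Sum>m. b m)"
proof -
  have sb: "summable (\<lambda>m. b (m + L))" by (rule summable_ignore_initial_segment) fact
  have "summable (\<lambda>m. a (m + L))"
    by (rule summable_comparison_test'[where g="\<lambda>m. c * b (m + L)" and N=0])
      (use assms sb in \<open>auto intro: summable_mult\<close>)
  then have "(\<Sum>m. a (m + L)) \<le> (\<Sum>m. c * b (m + L))"
    by (intro suminf_le summable_mult sb) (use assms in auto)
  also have "\<dots> = c * (\<Sum>m. b (m + L))" by (rule suminf_mult[OF sb])
  also have "(\<Sum>m. b (m + L)) \<le> (\<Sum>m. b m)"
    using suminf_split_initial_segment[OF assms(1), of L] sum_nonneg[of "{..<L}" b] assms(3) by simp
  finally show ?thesis using assms(4) by (simp add: mult_left_mono)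
qed

lemma summable_decay:
  assumes "0 \<le> al"
  shows "summable (decay al k)"
proof (cases "al > 0")
  case True
  have "summable (\<lambda>m. exp (- (1 / real (k + 1) * real m powr al)))"
    by (rule summable_exp_neg_powr) (use True in auto)
  then show ?thesis using True by (simp add: decay_def[abs_def])
next
  case False
  have "summable (\<lambda>m. real (Suc m) powr (- (1 + 1 / real (k + 1))))"
    by (subst summable_Suc_iff, subst summable_real_powr_iff) simp
  then show ?thesis using False by (simp add: decay_def[abs_def])
qed

text \<open>The sum of \<open>m powr (al - 1)\<close> up to \<open>L\<close> is of order \<open>L powr al\<close> (for \<open>al = 0\<close>, of order \<open>ln L\<close>), which is
  the order of \<open>- ln (decay al k L)\<close>; so \<open>Lf N\<close> is chosen as \<open>(A N) powr (1 / al)\<close>, respectively \<open>2 ^ (A N)\<close>.\<close>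
lemma decay_scales:
  assumes al: "0 \<le> al" "al \<le> 1"
  shows "\<exists>Lf D. D \<ge> 1 \<and> (\<forall>N\<ge>1. N \<le> Lf N \<and>
    (\<Sum>m=1..<Lf N + 2 * N + 1. real m powr (al - 1)) \<le> real ((D + 16) * N) \<and>
    real (Lf N + 2 * N + 1) \<le> 2 ^ (D * N) \<and>
    (\<Sum>m. decay al k (m + Lf N)) \<le> (1/2) ^ (16 * N))"
proof (cases "al > 0")
  case True
  define c where "c = 1 / real (k + 1)"
  have c: "0 < c" "c \<le> 1" by (auto simp: c_def)
  \<comment> \<open>The square root of the decay. One half of the exponent yields the factor in
    front, the other half keeps the series summable.\<close>
  define b where "b m = exp (- (c / 2 * real m powr al))" for m :: nat
  have sb: "summable b" unfolding b_def by (rule summable_exp_neg_powr) (use True c in auto)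
  define Ct where "Ct = (\<Sum>m. b m)"
  have Ct: "Ct > 0" unfolding Ct_def by (intro suminf_pos sb) (simp add: b_def)
  \<comment> \<open>From scale \<open>Lf N\<close> on, half of the exponent is then at least
    \<open>(16 + Ct) * N\<close>: 16 is the required rate, and \<open>Ct * N\<close> absorbs the sum
    \<open>Ct\<close> of the remaining series.\<close>
  define A where "A = 2 * (16 + Ct) / c"
  have A: "A \<ge> 1" using c Ct by (simp add: A_def field_simps)
  define Lf where "Lf N = nat \<lceil>(A * real N) powr (1 / al)\<rceil>" for N :: nat
  define D where "D = nat \<lceil>5 * A / al\<rceil> + 3"
  have D: "5 * A / al + 3 \<le> real D" unfolding D_def by linarith
  show ?thesis
  proof (intro exI[of _ Lf] exI[of _ D] conjI allI impI)
    show "D \<ge> 1" by (simp add: D_def)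
    fix N :: nat assume N: "N \<ge> 1"
    let ?x = "(A * real N) powr (1 / al)"
    have AN: "1 \<le> A * real N" "real N \<le> A * real N"
      using mult_mono[of 1 A 1 "real N"] A N by (auto simp: mult_le_cancel_right1)
    have "(A * real N) powr 1 \<le> ?x" using AN(1) al True by (intro powr_mono) auto
    then have x: "real N \<le> ?x" "1 \<le> ?x" using AN by auto
    have xal: "?x powr al = A * real N" using AN(1) True by (simp add: powr_powr)
    have Lx: "?x \<le> real (Lf N)" "real (Lf N) \<le> ?x + 1" unfolding Lf_def using x(2) by linarith+
    show "N \<le> Lf N" using x(1) Lx(1) by linarith
    have M: "real (Lf N + 2 * N + 1) \<le> 5 * ?x" using Lx(2) x by simp
    show "(\<Sum>m=1..<Lf N + 2 * N + 1. real m powr (al - 1)) \<le> real ((D + 16) * N)"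
    proof -
      have "(\<Sum>m=1..<Lf N + 2 * N + 1. real m powr (al - 1)) \<le> real (Lf N + 2 * N + 1) powr al / al"
        by (rule sum_powr_le) (use True al in auto)
      also have "\<dots> \<le> (5 * ?x) powr al / al"
        using M True by (intro divide_right_mono powr_mono2) auto
      also have "(5 * ?x) powr al = 5 powr al * (A * real N)" using x xal by (simp add: powr_mult)
      also have "\<dots> / al \<le> 5 * (A * real N) / al"
      proof (intro divide_right_mono mult_right_mono)
        show "(5::real) powr al \<le> 5" using powr_mono[of al 1 "5::real"] al by simp
      qed (use AN True in auto)
      also have "\<dots> = 5 * A / al * real N" by simp
      also have "\<dots> \<le> real (D + 16) * real N"
        using D by (intro mult_right_mono) auto
      finally show ?thesis by simp
    qed
    show "real (Lf N + 2 * N + 1) \<le> 2 ^ (D * N)"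
    proof -
      have lt: "y \<le> 2 powr y" if y: "y \<ge> 0" for y :: real
      proof -
        have "y * (2/3) \<le> y * ln 2" using ln2_ge_two_thirds y by (intro mult_left_mono) auto
        moreover have "1 + (y * ln 2 / 2) \<le> exp (y * ln 2 / 2)" by (rule exp_ge_add_one_self)
        ultimately have "1 + y / 3 \<le> exp (y * ln 2 / 2)" by linarith
        then have "(1 + y / 3)\<^sup>2 \<le> (exp (y * ln 2 / 2))\<^sup>2" using y by (intro power_mono) auto
        also have "\<dots> = 2 powr y" by (simp add: powr_def power2_eq_square flip: exp_add)
        finally have "(1 + y / 3)\<^sup>2 \<le> 2 powr y" .
        moreover have "y \<le> (1 + y / 3)\<^sup>2"
          using zero_le_power2[of "y / 3 - 1 / 2"] by (simp add: power2_eq_square algebra_simps)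
        ultimately show ?thesis by linarith
      qed
      have "?x \<le> (2 powr (A * real N)) powr (1 / al)"
        using lt AN True by (intro powr_mono2) auto
      also have "\<dots> = 2 powr (A / al * real N)" by (simp add: powr_powr)
      finally have "5 * ?x \<le> 2 powr (3 * real N) * 2 powr (A / al * real N)"
      proof (intro mult_mono)
        have "(2::real) powr 3 \<le> 2 powr (3 * real N)" using N by (intro powr_mono) auto
        then show "5 \<le> 2 powr (3 * real N)" by simp
      qed auto
      also have "\<dots> = 2 powr ((3 + A / al) * real N)" by (simp add: powr_add[symmetric] algebra_simps)
      also have "\<dots> \<le> 2 powr (real D * real N)"
      proof (intro powr_mono mult_right_mono)
        have "A / al \<le> 5 * A / al" using A True by (intro divide_right_mono) auto
        then show "3 + A / al \<le> real D" using D by linarith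
      qed auto
      also have "\<dots> = 2 ^ (D * N)" by (simp flip: powr_realpow)
      finally show ?thesis using M by linarith
    qed
    show "(\<Sum>m. decay al k (m + Lf N)) \<le> (1/2) ^ (16 * N)"
    proof -
      have "(\<Sum>m. decay al k (m + Lf N)) \<le> exp (- ((16 + Ct) * real N)) * Ct"
        unfolding Ct_def
      proof (rule suminf_scaled_le[OF sb])
        fix m assume m: "m \<ge> Lf N"
        have "?x powr al \<le> real m powr al" using m Lx(1) True by (intro powr_mono2) auto
        then have "c / 2 * (A * real N) \<le> c / 2 * real m powr al" unfolding xal using c by (intro mult_left_mono) auto
        moreover have "c / 2 * (A * real N) = (16 + Ct) * real N" using c by (simp add: A_def)
        ultimately have le: "(16 + Ct) * real N \<le> c / 2 * real m powr al" by linarith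
        have "decay al k m = exp (- (c * real m powr al))"
          using True by (simp add: decay_def c_def)
        also have "\<dots> = exp (- (c / 2 * real m powr al)) * b m"
          unfolding b_def exp_add[symmetric] by simp
        also have "\<dots> \<le> exp (- ((16 + Ct) * real N)) * b m"
          using le by (intro mult_right_mono) (auto simp: b_def)
        finally show "decay al k m \<le> exp (- ((16 + (\<Sum>m. b m)) * real N)) * b m" by (simp add: Ct_def)
      qed (auto simp: b_def decay_pos less_imp_le)
      also have "\<dots> \<le> exp (- ((16 + Ct) * real N)) * exp (Ct * real N)"
      proof (intro mult_left_mono)
        have "Ct \<le> Ct * real N" using Ct N by simp
        also have "\<dots> \<le> exp (Ct * real N)" using exp_ge_add_one_self[of "Ct * real N"] by linarith
        finally show "Ct \<le> exp (Ct * real N)" .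
      qed simp
      also have "\<dots> = exp (- (16 * real N))" by (simp add: algebra_simps flip: exp_add)
      also have "\<dots> \<le> exp (- (real (16 * N) * ln 2))"
        using ln_2_less_1 by (simp add: mult_left_le)
      also have "\<dots> = (1/2) ^ (16 * N)"
        using exp_of_nat_mult[of "16 * N" "ln 2 :: real"]
        by (simp only: exp_minus) (simp add: power_one_over inverse_eq_divide)
      finally show ?thesis .
    qed
  qed
next
  case False
  then have al0: "al = 0" using al by simp
  define c where "c = 1 / real (k + 1)"
  have c: "0 < c" "c \<le> 1" by (auto simp: c_def)
  define b where "b m = real (m + 1) powr (- (1 + c / 2))" for m :: nat
  have sb: "summable b"
  proof -
    have "summable (\<lambda>m. real (Suc m) powr (- (1 + c / 2)))"
      by (subst summable_Suc_iff, subst summable_real_powr_iff) (use c in simp)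
    then show ?thesis by (simp add: b_def[abs_def])
  qed
  define Ct where "Ct = (\<Sum>m. b m)"
  have Ct: "Ct > 0" unfolding Ct_def by (intro suminf_pos sb) (simp add: b_def)
  \<comment> \<open>As in the exponential case, but with powers of 2; absorbing \<open>Ct\<close>
    into \<open>2 powr (2 * Ct * N)\<close> uses that \<open>2 * ln 2\<close> exceeds 1.\<close>
  define A where "A = nat \<lceil>2 * (16 + 2 * Ct) / c\<rceil> + 1"
  have A: "2 * (16 + 2 * Ct) / c \<le> real A" "A \<ge> 1" unfolding A_def by linarith+
  define Lf :: "nat \<Rightarrow> nat" where "Lf N = 2 ^ (A * N)" for N
  define D where "D = A + 3"
  show ?thesis
  proof (intro exI[of _ Lf] exI[of _ D] conjI allI impI)
    show "D \<ge> 1" by (simp add: D_def)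
    fix N :: nat assume N: "N \<ge> 1"
    have NL: "N < Lf N"
    proof -
      have "N \<le> A * N" using A(2) by simp
      also have "A * N < 2 ^ (A * N)" by (rule less_exp)
      finally show ?thesis by (simp add: Lf_def)
    qed
    then show "N \<le> Lf N" by simp
    have M: "Lf N + 2 * N + 1 \<le> 2 ^ ((A + 2) * N)"
    proof -
      have "Lf N + 2 * N + 1 \<le> 4 * Lf N" using NL N by linarith
      also have "\<dots> = 2 ^ (A * N + 2)" by (simp add: Lf_def power_add)
      also have "\<dots> \<le> 2 ^ ((A + 2) * N)" using N by (intro power_increasing) (auto simp: algebra_simps)
      finally show ?thesis .
    qed
    then show "real (Lf N + 2 * N + 1) \<le> 2 ^ (D * N)"
    proof -
      have "(2::nat) ^ ((A + 2) * N) \<le> 2 ^ (D * N)" by (intro power_increasing mult_right_mono) (auto simp: D_def)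
      with M have "Lf N + 2 * N + 1 \<le> 2 ^ (D * N)" by linarith
      then have "real (Lf N + 2 * N + 1) \<le> real (2 ^ (D * N))" by (rule of_nat_mono)
      then show ?thesis by simp
    qed
    show "(\<Sum>m=1..<Lf N + 2 * N + 1. real m powr (al - 1)) \<le> real ((D + 16) * N)"
    proof -
      have "(\<Sum>m=1..<Lf N + 2 * N + 1. real m powr (al - 1)) \<le> 1 + ln (real (Lf N + 2 * N + 1))"
        using sum_inverse_le[of "Lf N + 2 * N + 1"] by (simp add: al0)
      also have "ln (real (Lf N + 2 * N + 1)) \<le> ln (2 ^ ((A + 2) * N))"
        using of_nat_mono[OF M, where 'a=real] by (subst ln_le_cancel_iff) auto
      also have "\<dots> = real ((A + 2) * N) * ln 2" by (rule ln_realpow)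
      also have "\<dots> \<le> real ((A + 2) * N) * 1" using ln_2_less_1 by (intro mult_left_mono) auto
      also have "1 + real ((A + 2) * N) * 1 \<le> real ((D + 16) * N)"
        using N by (simp add: D_def algebra_simps)
      finally show ?thesis by simp
    qed
    show "(\<Sum>m. decay al k (m + Lf N)) \<le> (1/2) ^ (16 * N)"
    proof -
      have "(\<Sum>m. decay al k (m + Lf N)) \<le> 2 powr (- ((16 + 2 * Ct) * real N)) * Ct"
        unfolding Ct_def
      proof (rule suminf_scaled_le[OF sb])
        fix m assume m: "m \<ge> Lf N"
        have "real (Lf N) \<le> real (m + 1)" using m by simp
        then have L: "2 powr (real A * real N) \<le> real (m + 1)" by (simp add: Lf_def powr_realpow flip: of_nat_mult)
        have "real (m + 1) powr (- (c / 2)) \<le> (2 powr (real A * real N)) powr (- (c / 2))"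
          using L c by (intro powr_mono2') auto
        also have "\<dots> = 2 powr (- (c / 2 * real A * real N))" by (simp add: powr_powr mult_ac)
        also have "\<dots> \<le> 2 powr (- ((16 + 2 * Ct) * real N))"
        proof (intro powr_mono)
          have "16 + 2 * Ct \<le> c / 2 * real A" using A(1) c by (simp add: field_simps)
          then have "(16 + 2 * Ct) * real N \<le> c / 2 * real A * real N" by (rule mult_right_mono) simp
          then show "- (c / 2 * real A * real N) \<le> - ((16 + 2 * Ct) * real N)" by simp
        qed simp
        finally have le: "real (m + 1) powr (- (c / 2)) \<le> 2 powr (- ((16 + 2 * Ct) * real N))" .
        have "decay al k m = real (m + 1) powr (- (1 + c))"
          using al0 by (simp add: decay_def c_def)
        also have "\<dots> = real (m + 1) powr (- (c / 2)) * b m"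
          unfolding b_def powr_add[symmetric] by (rule arg_cong[where f="(powr) (real (m + 1))"]) simp
        also have "\<dots> \<le> 2 powr (- ((16 + 2 * Ct) * real N)) * b m"
          by (intro mult_right_mono le) (simp add: b_def)
        finally show "decay al k m \<le> 2 powr (- ((16 + 2 * (\<Sum>m. b m)) * real N)) * b m" by (simp add: Ct_def)
      qed (auto simp: b_def decay_pos less_imp_le)
      also have "\<dots> \<le> 2 powr (- ((16 + 2 * Ct) * real N)) * 2 powr (2 * Ct * real N)"
      proof (intro mult_left_mono)
        have "Ct \<le> 2 * Ct * real N * (2/3)" using Ct N mult_mono[of Ct Ct 1 "real N"] by simp
        also have "\<dots> \<le> 2 * Ct * real N * ln 2" using ln2_ge_two_thirds Ct by (intro mult_left_mono) auto
        also have "\<dots> \<le> exp (2 * Ct * real N * ln 2)" using exp_ge_add_one_self[of "2 * Ct * real N * ln 2"] by linarith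
        also have "\<dots> = 2 powr (2 * Ct * real N)" by (simp add: powr_def)
        finally show "Ct \<le> 2 powr (2 * Ct * real N)" .
      qed simp
      also have "\<dots> = 2 powr (- real (16 * N))" by (simp add: algebra_simps flip: powr_add)
      also have "\<dots> = (1/2) ^ (16 * N)"
        by (simp only: powr_minus powr_realpow) (simp add: power_one_over inverse_eq_divide)
      finally show ?thesis .
    qed
  qed
qed

text \<open>Since 10 is below 2^4, the logarithm is at least \<open>(m - 4) * ln 2\<close>, and two
  thirds of \<open>m - 4\<close> reach \<open>m / 3\<close> exactly from \<open>m = 8\<close>
  on.\<close>

lemma ln_inverse_scale_ge:
  assumes "m \<ge> 8"
  shows "10 * (1/2) ^ m < (1::real)" "real m / 3 \<le> ln (1 / (10 * (1/2) ^ m))"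
proof -
  have m: "real m \<ge> 8" using assms by linarith
  have "(2::real) ^ 4 \<le> 2 ^ m" using assms by (intro power_increasing) auto
  then have "10 < (2::real) ^ m" by simp
  then show "10 * (1/2) ^ m < (1::real)" by (simp add: power_one_over field_simps)
  have "1 / (10 * (1/2) ^ m) = 2 ^ m / (10::real)" by (simp add: power_one_over)
  then have "ln (1 / (10 * (1/2) ^ m)) = ln (2 ^ m / (10::real))" by (rule arg_cong)
  also have "\<dots> = real m * ln 2 - ln 10" by (simp add: ln_divide_pos ln_realpow)
  finally have eq: "ln (1 / (10 * (1/2) ^ m)) = real m * ln 2 - ln (10::real)" .
  have "ln 10 \<le> ln ((2::real) ^ 4)" by (subst ln_le_cancel_iff) auto
  also have "\<dots> = real 4 * ln (2::real)" by (rule ln_realpow)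
  finally have "ln 10 \<le> 4 * ln (2::real)" by simp
  moreover have "(real m - 4) * (2/3) \<le> (real m - 4) * ln 2"
    using m ln2_ge_two_thirds by (intro mult_left_mono) auto
  ultimately show "real m / 3 \<le> ln (1 / (10 * (1/2) ^ m))"
    using m unfolding eq left_diff_distrib by linarith
qed

text \<open>\<open>k\<close> is so large that \<open>n / (k + 1)\<close> is at most
  \<open>\<gamma> / 6\<close>. With \<open>ln (1 / r)\<close> at least \<open>m / 3\<close>, the
  gauge has exponent at least \<open>\<gamma> / 3\<close> in \<open>m powr al\<close>; one half of
  it pays for the n-th power of the decay, the other tends to 0 and beats \<epsilon>. For
  \<open>al = 0\<close> the surplus \<gamma> in the power is halved in the same way.\<close>

lemma gauge_eventually_le_decay:
  assumes "\<gamma> > 0" "0 \<le> al" "al \<le> 1" "n \<ge> 1"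
    and \<phi>: "\<And>r. 0 < r \<Longrightarrow> r < 1 \<Longrightarrow> \<phi> r = ennreal (if al > 0 then exp (- \<gamma> * ln (1 / r) powr al)
      else ln (1 / r) powr (- (real n + \<gamma>)))"
  shows "\<exists>k. \<forall>\<epsilon>>0. eventually (\<lambda>m. \<phi> (10 * (1/2) ^ m) \<le> ennreal (\<epsilon> * decay al k m ^ n)) sequentially"
proof -
  define k where "k = nat \<lceil>6 * real n / \<gamma>\<rceil>"
  have "6 * real n / \<gamma> \<le> real (k + 1)" unfolding k_def by linarith
  then have k: "real n / real (k + 1) \<le> \<gamma> / 6" using assms(1) by (simp add: field_simps)
  show ?thesis
  proof (intro exI[of _ k] allI impI)
    fix \<epsilon> :: real assume \<epsilon>: "\<epsilon> > 0"
    show "eventually (\<lambda>m. \<phi> (10 * (1/2) ^ m) \<le> ennreal (\<epsilon> * decay al k m ^ n)) sequentially"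
    proof (cases "al > 0")
      case True
      have "summable (\<lambda>m. exp (- (\<gamma> / 6 * real m powr al)))"
        by (rule summable_exp_neg_powr) (use True assms in auto)
      then have "(\<lambda>m. exp (- (\<gamma> / 6 * real m powr al))) \<longlonglongrightarrow> 0" by (rule summable_LIMSEQ_zero)
      then have "eventually (\<lambda>m. exp (- (\<gamma> / 6 * real m powr al)) < \<epsilon>) sequentially"
        using \<epsilon> by (rule order_tendstoD)
      with eventually_ge_at_top[of 8] show ?thesis
      proof eventually_elim
        case (elim m)
        define y where "y = real m powr al"
        define r where "r = 10 * (1/2::real) ^ m"
        have "(3::real) powr al \<le> 3" using powr_mono[of al 1 "3::real"] assms by simp
        then have "y / 3 \<le> y / 3 powr al" by (intro divide_left_mono) (auto simp: y_def)
        also have "\<dots> = (real m / 3) powr al" by (simp add: powr_divide y_def)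
        also have "\<dots> \<le> ln (1 / r) powr al"
          unfolding r_def using True ln_inverse_scale_ge(2)[OF elim(1)] by (intro powr_mono2) auto
        finally have "\<gamma> * (y / 3) \<le> \<gamma> * ln (1 / r) powr al" using assms by (intro mult_left_mono) auto
        then have "exp (- \<gamma> * ln (1 / r) powr al) \<le> exp (- (\<gamma> / 6 * y)) * exp (- (\<gamma> / 6 * y))"
          unfolding exp_add[symmetric] by simp
        also have "\<dots> \<le> \<epsilon> * exp (- (real n / real (k + 1) * y))"
        proof (intro mult_mono)
          show "exp (- (\<gamma> / 6 * y)) \<le> exp (- (real n / real (k + 1) * y))"
            using mult_right_mono[OF k, of y] by (simp add: y_def)
        qed (use elim \<epsilon> in \<open>auto simp: y_def\<close>)
        also have "exp (- (real n / real (k + 1) * y)) = decay al k m ^ n"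
          using True by (simp add: decay_def y_def flip: exp_of_nat_mult)
        finally show ?case
          using True ln_inverse_scale_ge(1)[OF elim(1)] by (subst \<phi>) (auto simp: r_def intro!: ennreal_leI)
      qed
    next
      case False
      then have al: "al = 0" using assms by simp
      define C where "C = 3 powr (real n + \<gamma>) * 2 powr (real n + \<gamma> / 2)"
      have "(\<lambda>m. real m powr (- (\<gamma> / 2))) \<longlonglongrightarrow> 0"
        using assms by (intro tendsto_neg_powr filterlim_real_sequentially) auto
      then have "(\<lambda>m. C * real m powr (- (\<gamma> / 2))) \<longlonglongrightarrow> C * 0" by (rule tendsto_mult_left)
      then have "eventually (\<lambda>m. C * real m powr (- (\<gamma> / 2)) < \<epsilon>) sequentially"
        using \<epsilon> by (intro order_tendstoD) auto
      with eventually_ge_at_top[of 8] show ?thesis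
      proof eventually_elim
        case (elim m)
        define r where "r = 10 * (1/2::real) ^ m"
        have m: "real m \<ge> 8" using elim(1) by linarith
        have d: "decay al k m ^ n \<ge> 2 powr (- (real n + \<gamma> / 2)) * real m powr (- (real n + \<gamma> / 2))"
        proof -
          have "real n * (1 + 1 / real (k + 1)) \<le> real n + \<gamma> / 2"
          proof -
            have "real n * (1 + 1 / real (k + 1)) = real n + real n / real (k + 1)" by (simp only: distrib_left) simp
            then show ?thesis using k assms(1) by linarith
          qed
          then have "real (m + 1) powr (- (real n + \<gamma> / 2)) \<le> real (m + 1) powr (- (real n * (1 + 1 / real (k + 1))))"
            by (intro powr_mono) auto
          also have "\<dots> = decay al k m ^ n"
            using al by (simp add: decay_def powr_power algebra_simps)
          finally have "real (m + 1) powr (- (real n + \<gamma> / 2)) \<le> decay al k m ^ n" .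
          moreover have "(2 * real m) powr (- (real n + \<gamma> / 2)) \<le> real (m + 1) powr (- (real n + \<gamma> / 2))"
            using m assms(1) by (intro powr_mono2') auto
          ultimately show ?thesis by (simp add: powr_mult)
        qed
        have "ln (1 / r) powr (- (real n + \<gamma>)) \<le> (real m / 3) powr (- (real n + \<gamma>))"
          unfolding r_def using ln_inverse_scale_ge(2)[OF elim(1)] m assms(1) by (intro powr_mono2') auto
        also have "\<dots> = 3 powr (real n + \<gamma>) * real m powr (- (real n + \<gamma>))"
        proof -
          have "(real m / 3) powr (- s) = 3 powr s * real m powr (- s)" for s
            by (simp add: powr_divide powr_minus_divide)
          then show ?thesis .
        qed
        also have "real m powr (- (real n + \<gamma>)) = real m powr (- (\<gamma> / 2)) * real m powr (- (real n + \<gamma> / 2))"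
          unfolding powr_add[symmetric] by (rule arg_cong[where f="(powr) (real m)"]) simp
        also have "3 powr (real n + \<gamma>) * (real m powr (- (\<gamma> / 2)) * real m powr (- (real n + \<gamma> / 2)))
          = C * real m powr (- (\<gamma> / 2)) * (2 powr (- (real n + \<gamma> / 2)) * real m powr (- (real n + \<gamma> / 2)))"
        proof -
          have "2 powr (real n + \<gamma> / 2) * 2 powr (- (real n + \<gamma> / 2)) = (1::real)"
            unfolding powr_add[symmetric] by simp
          then show ?thesis unfolding C_def by (simp add: mult_ac)
        qed
        also have "\<dots> \<le> \<epsilon> * decay al k m ^ n"
          by (intro mult_mono d) (use elim \<epsilon> in auto)
        finally show ?case
          using al ln_inverse_scale_ge(1)[OF elim(1)] by (subst \<phi>) (auto simp: r_def intro!: ennreal_leI)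
      qed
    qed
  qed
qed

text \<open>A gauge function may be positive at 0, and then even empty sets in a cover would have a
  cost. The prescribed values near 0 together with monotonicity exclude this.\<close>

lemma gauge_at_0_eq_0:
  fixes \<phi> :: "real \<Rightarrow> ennreal"
  assumes "mono_on {0..} \<phi>"
    and k: "\<forall>\<epsilon>>0. eventually (\<lambda>m. \<phi> (10 * (1/2) ^ m) \<le> ennreal (\<epsilon> * decay al k m ^ n)) sequentially"
  shows "\<phi> 0 = 0"
proof -
  have "\<phi> 0 \<le> 0 + ennreal \<epsilon>" if "\<epsilon> > 0" for \<epsilon>
  proof -
    have "eventually (\<lambda>m. \<phi> (10 * (1/2) ^ m) \<le> ennreal (\<epsilon> * decay al k m ^ n)) sequentially"
      using k that by blast
    then obtain m where m: "\<phi> (10 * (1/2) ^ m) \<le> ennreal (\<epsilon> * decay al k m ^ n)"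
      unfolding eventually_sequentially by blast
    have "\<phi> 0 \<le> \<phi> (10 * (1/2) ^ m)" by (rule mono_onD[OF assms(1)]) auto
    also have "\<dots> \<le> ennreal (\<epsilon> * decay al k m ^ n)" by (rule m)
    finally have le: "\<phi> 0 \<le> ennreal (\<epsilon> * decay al k m ^ n)" .
    have "decay al k m ^ n \<le> 1"
    proof (rule power_le_one)
      show "decay al k m \<le> 1"
      proof (cases "al > 0")
        case False
        have "real (m + 1) powr (- (1 + 1 / real (k + 1))) \<le> real (m + 1) powr 0"
          using zero_le_divide_1_iff[of "real (k + 1)"] by (intro powr_mono) linarith+
        then show ?thesis using False by (simp add: decay_def)
      qed (simp add: decay_def)
    qed (simp add: decay_pos less_imp_le)
    then have le2: "ennreal (\<epsilon> * decay al k m ^ n) \<le> ennreal \<epsilon>"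
      using that by (intro ennreal_leI) (simp add: mult_left_le)
    show ?thesis using order_trans[OF le le2] by simp
  qed
  then have "\<phi> 0 \<le> 0" using ennreal_le_epsilon[of 0 "\<phi> 0"] by blast
  then show ?thesis by simp
qed

section \<open>A Borel majorant of the weak gradient, and the conclusion\<close>

lemma Lp_on_set_integrable_norm_ball:
  assumes "Lp_on p \<Omega> u" "p \<ge> 1" "ball z r \<subseteq> \<Omega>"
  shows "set_integrable lebesgue (ball z r) (\<lambda>x. norm (u x))"
  unfolding set_integrable_def
proof (rule Bochner_Integration.integrable_bound)
  have "integrable lebesgue (indicator (ball z r) :: _ \<Rightarrow> real)"
    using emeasure_bounded_finite[OF bounded_ball, of z r] by (intro integrable_real_indicator) auto
  moreover have "integrable lebesgue (\<lambda>x. indicator \<Omega> x *\<^sub>R (norm (u x) powr p))"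
    using assms(1) by (simp add: Lp_on_def set_integrable_def)
  ultimately show "integrable lebesgue (\<lambda>x. indicator (ball z r) x + indicator \<Omega> x *\<^sub>R (norm (u x) powr p))"
    by (rule Bochner_Integration.integrable_add)
  have m: "(\<lambda>x. indicator \<Omega> x *\<^sub>R u x) \<in> borel_measurable lebesgue"
    using assms(1) by (simp add: Lp_on_def set_borel_measurable_def)
  have "(\<lambda>x. indicator (ball z r) x *\<^sub>R norm (u x)) = (\<lambda>x. indicator (ball z r) x *\<^sub>R norm (indicator \<Omega> x *\<^sub>R u x))"
    using assms(3) by (auto simp: indicator_def fun_eq_iff)
  also have "\<dots> \<in> borel_measurable lebesgue"
  proof -
    have [measurable]: "ball z r \<in> sets lebesgue" by simp
    have [measurable]: "(\<lambda>x. norm (indicator \<Omega> x *\<^sub>R u x)) \<in> borel_measurable lebesgue"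
      by (rule measurable_compose[OF m borel_measurable_norm])
    show ?thesis by (intro borel_measurable_scaleR borel_measurable_indicator) fact+
  qed
  finally show "(\<lambda>x. indicator (ball z r) x *\<^sub>R norm (u x)) \<in> borel_measurable lebesgue" .
  have le: "t \<le> 1 + t powr p" if "t \<ge> 0" for t :: real
  proof (cases "t \<le> 1")
    case True
    then show ?thesis by (simp add: add_increasing2)
  next
    case False
    then have "t powr 1 \<le> t powr p" using assms(2) by (intro powr_mono) auto
    then show ?thesis using False by simp
  qed
  show "AE x in lebesgue. norm (indicator (ball z r) x *\<^sub>R norm (u x))
      \<le> norm (indicator (ball z r) x + indicator \<Omega> x *\<^sub>R (norm (u x) powr p))"
    using assms(3) le by (intro AE_I2) (auto simp: indicator_def)
qed

lemma norm_le_weak_grad_norm: "norm (g i x) \<le> weak_grad_norm g x"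
proof -
  have "(norm (g i x))\<^sup>2 \<le> (\<Sum>i\<in>UNIV. (norm (g i x))\<^sup>2)"
    by (rule member_le_sum) auto
  then have "sqrt ((norm (g i x))\<^sup>2) \<le> weak_grad_norm g x"
    unfolding weak_grad_norm_def by (rule real_sqrt_le_mono)
  then show ?thesis by simp
qed

text \<open>The weak gradient is only Lebesgue measurable, so it is replaced by a Borel function
  that agrees with it almost everywhere on \<Omega>, raised to at least 1. The lower bound makes the
  mass positive on nonempty open sets and lets the energy density dominate \<open>G\<close>. It adds
  at most a constant to the energy density, which is integrable on bounded sets only.\<close>

lemma borel_majorant_energy_density:
  fixes g :: "'n \<Rightarrow> real^'n \<Rightarrow> real^'d"
  assumes n: "CARD('n) \<ge> 1" and m: "\<And>i. set_borel_measurable lebesgue \<Omega> (g i)"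
    and int: "(\<integral>\<^sup>+x\<in>\<Omega>. ennreal (energy_density CARD('n) lam (weak_grad_norm g x)) \<partial>lebesgue) < \<infinity>"
    and \<Omega>: "open \<Omega>"
  obtains G where "G \<in> borel_measurable borel" "\<And>x. G x \<ge> 1"
    "AE x in lebesgue. x \<in> \<Omega> \<longrightarrow> weak_grad_norm g x \<le> G x"
    "\<And>V. open V \<Longrightarrow> bounded V \<Longrightarrow> V \<subseteq> \<Omega> \<Longrightarrow>
      integrable lborel (\<lambda>x. indicator V x * energy_density CARD('n) lam (G x))"
proof -
  define H where "H x = indicator \<Omega> x * weak_grad_norm g x" for x
  have "H = (\<lambda>x. sqrt (\<Sum>i\<in>UNIV. (norm (indicator \<Omega> x *\<^sub>R g i x))\<^sup>2))"
    by (auto simp: H_def fun_eq_iff indicator_def weak_grad_norm_def)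
  also have "\<dots> \<in> borel_measurable lebesgue"
  proof -
    have [measurable]: "\<And>i. (\<lambda>x. indicator \<Omega> x *\<^sub>R g i x) \<in> borel_measurable lebesgue"
      using m by (simp add: set_borel_measurable_def)
    show ?thesis by measurable
  qed
  finally have Hm: "H \<in> borel_measurable lebesgue" .
  have H0: "H x \<ge> 0" for x by (simp add: H_def weak_grad_norm_def sum_nonneg)
  obtain G' where G': "G' \<in> borel_measurable lborel" "AE x in lborel. H x = G' x"
    using completion_ex_borel_measurable_real[OF Hm] by blast
  define G where "G x = max 1 (G' x)" for x
  have Gm: "G \<in> borel_measurable borel"
    using G'(1) unfolding G_def by (intro borel_measurable_max) auto
  have G1: "G x \<ge> 1" for x by (simp add: G_def)
  have AEG: "AE x in lebesgue. G x = max 1 (H x)"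
    using AE_completion[OF G'(2)] by eventually_elim (simp add: G_def)
  show thesis
  proof (rule that[OF Gm G1])
    show "AE x in lebesgue. x \<in> \<Omega> \<longrightarrow> weak_grad_norm g x \<le> G x"
      using AEG by eventually_elim (simp add: H_def)
    fix V assume V: "open V" "bounded V" "V \<subseteq> \<Omega>"
    let ?e = "energy_density CARD('n) lam"
    have e_m: "?e \<in> borel_measurable borel" unfolding energy_density_def by measurable
    have e0: "t \<ge> 0 \<Longrightarrow> ?e t \<ge> 0" for t by (rule energy_density_nonneg)
    have lm: "(\<lambda>x. indicator V x * ?e (G x)) \<in> borel_measurable lborel"
      using V(1) Gm e_m by (intro borel_measurable_times borel_measurable_indicator measurable_compose[OF _ e_m]) auto
    have "(\<integral>\<^sup>+x. ennreal (norm (indicator V x * ?e (G x))) \<partial>lborel) = (\<integral>\<^sup>+x. ennreal (norm (indicator V x * ?e (G x))) \<partial>lebesgue)"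
      by (rule nn_integral_completion[symmetric])
    also have "\<dots> \<le> (\<integral>\<^sup>+x. ennreal (?e (H x)) * indicator \<Omega> x + ennreal (?e 1) * indicator V x \<partial>lebesgue)"
    proof (rule nn_integral_mono_AE)
      show "AE x in lebesgue. ennreal (norm (indicator V x * ?e (G x))) \<le> ennreal (?e (H x)) * indicator \<Omega> x + ennreal (?e 1) * indicator V x"
        using AEG
      proof eventually_elim
        case (elim x)
        have "ennreal (?e (G x)) \<le> ennreal (?e (H x)) + ennreal (?e 1)"
          unfolding elim by (auto simp: max_def add_increasing add_increasing2)
        then show ?case using V(3) e0[of "G x"] G1[of x] by (auto simp: indicator_def)
      qed
    qed
    also have "\<dots> = (\<integral>\<^sup>+x. ennreal (?e (H x)) * indicator \<Omega> x \<partial>lebesgue) + (\<integral>\<^sup>+x. ennreal (?e 1) * indicator V x \<partial>lebesgue)"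
    proof (rule nn_integral_add)
      show "(\<lambda>x. ennreal (?e (H x)) * indicator \<Omega> x) \<in> borel_measurable lebesgue"
      proof -
        have [measurable]: "\<Omega> \<in> sets lebesgue" using \<Omega> by auto
        have [measurable]: "(\<lambda>x. ?e (H x)) \<in> borel_measurable lebesgue"
          by (rule measurable_compose[OF Hm e_m])
        show ?thesis by measurable
      qed
      have [measurable]: "V \<in> sets lebesgue" using V(1) by auto
      show "(\<lambda>x. ennreal (?e 1) * indicator V x) \<in> borel_measurable lebesgue" by measurable
    qed
    also have "(\<integral>\<^sup>+x. ennreal (?e (H x)) * indicator \<Omega> x \<partial>lebesgue) = (\<integral>\<^sup>+x\<in>\<Omega>. ennreal (?e (weak_grad_norm g x)) \<partial>lebesgue)"
      by (rule nn_integral_cong) (auto simp: H_def indicator_def)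
    also have "(\<integral>\<^sup>+x. ennreal (?e 1) * indicator V x \<partial>lebesgue) = ennreal (?e 1) * emeasure lborel V"
      using V(1) by (subst nn_integral_cmult_indicator) auto
    also have "(\<integral>\<^sup>+x\<in>\<Omega>. ennreal (?e (weak_grad_norm g x)) \<partial>lebesgue) + ennreal (?e 1) * emeasure lborel V < \<infinity>"
      using int emeasure_bounded_finite[OF V(2)] by (simp add: ennreal_mult_less_top)
    finally show "integrable lborel (\<lambda>x. indicator V x * ?e (G x))"
      using lm by (intro integrableI_bounded) auto
  qed
qed

theorem theorem1p2:
  fixes f :: "real^'n \<Rightarrow> real^'d" and \<Omega> :: "(real^'n) set"
    and g :: "'n \<Rightarrow> real^'n \<Rightarrow> real^'d" and lam :: real
  assumes n2: "CARD('n) \<ge> 2"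
    and open_\<Omega>: "open \<Omega>"
    and sob: "sobolev_W1p (real CARD('n)) \<Omega> f g"
    and cont: "continuous_on \<Omega> f"
    and lam0: "0 \<le> lam" and lam1: "lam \<le> real CARD('n) - 1"
    and int: "(\<integral>\<^sup>+x\<in>\<Omega>. ennreal (weak_grad_norm g x ^ CARD('n) *
                 ln (exp 1 + weak_grad_norm g x) powr lam) \<partial>lebesgue) < \<infinity>"
  shows "\<exists>E. E \<subseteq> \<Omega> \<and> luzin_N f (\<Omega> - E) \<and>
    (\<forall>\<phi> \<gamma>. gauge_fun \<phi> \<and> \<gamma> > 0 \<and>
       (\<forall>r. 0 < r \<and> r < 1 \<longrightarrow>
          \<phi> r = ennreal (let \<alpha> = 1 - lam / (real CARD('n) - 1) in
                   if \<alpha> > 0 then exp (- \<gamma> * ln (1 / r) powr \<alpha>)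
                   else ln (1 / r) powr (- (real CARD('n) + \<gamma>))))
       \<longrightarrow> hausdorff_gauge \<phi> E = 0)"
proof -
  have Lp: "Lp_on (real CARD('n)) \<Omega> (g i)" and wp: "weak_partial \<Omega> i f (g i)" for i
    using sob by (auto simp: sobolev_W1p_def)
  have gm: "set_borel_measurable lebesgue \<Omega> (g i)" for i using Lp[of i] by (simp add: Lp_on_def)
  have n1: "CARD('n) \<ge> 1" using n2 by linarith
  obtain G where Gm: "G \<in> borel_measurable borel" and G1: "\<And>x. G x \<ge> 1"
    and gG: "AE x in lebesgue. x \<in> \<Omega> \<longrightarrow> weak_grad_norm g x \<le> G x"
    and Gint: "\<And>V. open V \<Longrightarrow> bounded V \<Longrightarrow> V \<subseteq> \<Omega> \<Longrightarrow>
      integrable lborel (\<lambda>x. indicator V x * energy_density CARD('n) lam (G x))"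
    using borel_majorant_energy_density[OF n1 gm int[folded energy_density_def] open_\<Omega>] by blast
  define al where "al = 1 - lam / (real CARD('n) - 1)"
  have al: "0 \<le> al" "al \<le> 1" using n2 lam0 lam1 by (auto simp: al_def field_simps)
  \<comment> \<open>Exhaustion of \<Omega> by bounded open sets, since the energy of
    \<open>G\<close> need not be finite on \<Omega> itself.\<close>
  define W where "W R = \<Omega> \<inter> ball 0 (real R)" for R :: nat
  have W: "open (W R)" "bounded (W R)" "W R \<subseteq> \<Omega>" "W R \<subseteq> ball 0 (real R)" for R
    using open_\<Omega> by (auto simp: W_def)
  define \<nu> where "\<nu> R = density lborel (\<lambda>x. ennreal (indicator (W R) x * energy_density CARD('n) lam (G x)))" for R
  have fin: "finite_measure (\<nu> R)" for R
  proof (rule finite_measureI)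
    have "emeasure (\<nu> R) UNIV = (\<integral>\<^sup>+x. ennreal (indicator (W R) x * energy_density CARD('n) lam (G x)) \<partial>lborel)"
      unfolding \<nu>_def using borel_measurable_integrable[OF Gint[OF W(1-3)]]
      by (subst emeasure_density) auto
    also have "\<dots> \<le> (\<integral>\<^sup>+x. ennreal (norm (indicator (W R) x * energy_density CARD('n) lam (G x))) \<partial>lborel)"
      unfolding real_norm_def by (intro nn_integral_mono ennreal_leI abs_ge_self)
    also have "\<dots> < \<infinity>" using Gint[OF W(1-3), of R] by (simp add: integrable_iff_bounded)
    finally show "emeasure (\<nu> R) (space (\<nu> R)) \<noteq> \<infinity>" by (simp add: \<nu>_def)
  qed
  \<comment> \<open>One index \<open>k\<close> serves both as the rate of decay and as the first
    scale. This keeps the family countable and makes the exceptional set independent of the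
    gauge.\<close>
  define Good where "Good R k = {z \<in> W R. \<forall>m\<ge>k. measure (\<nu> R) (ball z ((1/2) ^ m)) \<le> decay al k m ^ CARD('n)}" for R k
  define E where "E = (\<Union>R. W R - (\<Union>k. Good R k))"
  show ?thesis
  proof (intro exI[of _ E] conjI allI impI)
    show "E \<subseteq> \<Omega>" using W(3) by (auto simp: E_def)
    show "luzin_N f (\<Omega> - E)"
      unfolding luzin_N_def
    proof (intro allI impI)
      fix Z assume Z: "Z \<subseteq> \<Omega> - E" "Z \<in> null_sets lebesgue"
      have null: "hausdorff_gauge (\<lambda>t. ennreal (t ^ CARD('n))) (f ` (Z \<inter> Good R k)) = 0" for R k
      proof -
        obtain Lf D where D: "D \<ge> 1" and Lf: "\<forall>N\<ge>1. N \<le> Lf N \<and>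
            (\<Sum>m=1..<Lf N + 2 * N + 1. real m powr (al - 1)) \<le> real ((D + 16) * N) \<and>
            real (Lf N + 2 * N + 1) \<le> 2 ^ (D * N) \<and>
            (\<Sum>m. decay al k (m + Lf N)) \<le> (1/2) ^ (16 * N)"
          using decay_scales[OF al] by blast
        \<comment> \<open>The exponent of the logarithmic gain \<open>w\<close> is
          \<open>al - 1\<close>, so the sums of \<open>w\<close> are those estimated in
          \<open>decay_scales\<close>.\<close>
        have al1: "- lam / (real CARD('n) - 1) = al - 1" by (simp add: al_def)
        show ?thesis
        proof (rule hausdorff_gauge_image_eq_0[where \<Omega>=\<Omega> and g=g and G=G and \<Omega>'="W R" and R="real R"
              and lam=lam and D=D and Lf=Lf and \<psi>="decay al k" and ?N0.0=1 and ?M0.0=k])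
          show "set_integrable lebesgue (ball z r) (\<lambda>w. norm (g i w))" if "ball z r \<subseteq> \<Omega>" for i z r
            using Lp_on_set_integrable_norm_ball[OF Lp _ that] n1 by simp
          show "AE x in lebesgue. x \<in> W R \<longrightarrow> norm (g i x) \<le> G x" for i
            using gG
          proof eventually_elim
            case (elim x)
            then show ?case using W(3) norm_le_weak_grad_norm[of g i x] by (auto intro: order_trans)
          qed
          show "Z \<inter> Good R k \<subseteq> W R" by (auto simp: Good_def)
          show "Z \<inter> Good R k \<in> null_sets lebesgue"
            by (rule null_sets_completion_subset[OF _ Z(2)]) auto
          show "measure (density lborel (\<lambda>x. ennreal (indicator (W R) x * energy_density CARD('n) lam (G x))))
              (ball z ((1/2) ^ m)) \<le> decay al k m ^ CARD('n)" if "z \<in> Z \<inter> Good R k" "m \<ge> k" for z m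
            using that by (simp add: Good_def \<nu>_def)
          show "summable (decay al k)" by (rule summable_decay[OF al(1)])
        qed (use n2 lam0 W cont wp Gm G1 Gint D Lf decay_pos al1 in auto)
      qed
      have "f ` Z \<subseteq> (\<Union>j. f ` (Z \<inter> Good (fst (prod_decode j)) (snd (prod_decode j))))"
      proof
        fix y assume "y \<in> f ` Z"
        then obtain z where z: "z \<in> Z" "y = f z" by blast
        obtain R where "norm z < real R" using reals_Archimedean2 by blast
        then have "z \<in> W R" using z Z(1) by (auto simp: W_def)
        moreover have "z \<notin> E" using z Z(1) by blast
        ultimately obtain k where "z \<in> Good R k" by (auto simp: E_def)
        then have "y \<in> f ` (Z \<inter> Good (fst (prod_decode (prod_encode (R, k)))) (snd (prod_decode (prod_encode (R, k)))))"
          using z by auto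
        then show "y \<in> (\<Union>j. f ` (Z \<inter> Good (fst (prod_decode j)) (snd (prod_decode j))))" by blast
      qed
      then have "hausdorff_gauge (\<lambda>t. ennreal (t ^ CARD('n))) (f ` Z) = 0"
        by (rule hausdorff_gauge_UN_eq_0) (rule null)
      then show "hausdorff_gauge (\<lambda>t. ennreal (t ^ DIM(real^'n))) (f ` Z) = 0" by simp
    qed
    fix \<phi> :: "real \<Rightarrow> ennreal" and \<gamma> :: real
    assume A: "gauge_fun \<phi> \<and> \<gamma> > 0 \<and> (\<forall>r. 0 < r \<and> r < 1 \<longrightarrow>
          \<phi> r = ennreal (let \<alpha> = 1 - lam / (real CARD('n) - 1) in
                   if \<alpha> > 0 then exp (- \<gamma> * ln (1 / r) powr \<alpha>)
                   else ln (1 / r) powr (- (real CARD('n) + \<gamma>))))"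
    have \<phi>: "\<phi> r = ennreal (if al > 0 then exp (- \<gamma> * ln (1 / r) powr al)
        else ln (1 / r) powr (- (real CARD('n) + \<gamma>)))" if "0 < r" "r < 1" for r
      using A that by (simp add: al_def Let_def)
    obtain k0 where k0: "\<forall>\<epsilon>>0. eventually (\<lambda>m. \<phi> (10 * (1/2) ^ m) \<le> ennreal (\<epsilon> * decay al k0 m ^ CARD('n))) sequentially"
      using gauge_eventually_le_decay[OF _ al n1 \<phi>] A by blast
    have "mono_on {0..} \<phi>" using A by (simp add: gauge_fun_def)
    then have \<phi>0: "\<phi> 0 = 0" using k0 by (rule gauge_at_0_eq_0)
    have "hausdorff_gauge \<phi> (W R - (\<Union>k. Good R k)) = 0" for R
    proof (rule hausdorff_gauge_eq_0_by_density)
      show "finite_measure (\<nu> R)" by (rule fin)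
      show "\<phi> 0 = 0" by (rule \<phi>0)
      show "sets (\<nu> R) = sets borel" by (simp add: \<nu>_def)
      fix \<epsilon> :: real and m0 z assume \<epsilon>: "\<epsilon> > 0" and z: "z \<in> W R - (\<Union>k. Good R k)"
      obtain m1 where m1: "\<And>m. m \<ge> m1 \<Longrightarrow> \<phi> (10 * (1/2) ^ m) \<le> ennreal (\<epsilon> * decay al k0 m ^ CARD('n))"
        using k0 \<epsilon> by (auto simp: eventually_sequentially)
      \<comment> \<open>As \<open>k\<close> is at least \<open>k0\<close>, failure of the decay with
        rate \<open>k\<close> implies failure with the weaker-looking threshold \<open>k0\<close>;
        the failing scale is at least \<open>k\<close> and hence beyond both \<open>m0\<close> and
        \<open>m1\<close>.\<close>
      define k where "k = max m0 (max m1 k0)"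
      have "z \<notin> Good R k" using z by blast
      then obtain m where m: "m \<ge> k" "decay al k m ^ CARD('n) < measure (\<nu> R) (ball z ((1/2) ^ m))"
        using z by (auto simp: Good_def not_le)
      have "decay al k0 m ^ CARD('n) \<le> decay al k m ^ CARD('n)"
        by (intro power_mono decay_mono less_imp_le[OF decay_pos]) (simp add: k_def)
      then have "\<epsilon> * decay al k0 m ^ CARD('n) \<le> \<epsilon> * measure (\<nu> R) (ball z ((1/2) ^ m))"
        using m(2) \<epsilon> by (intro mult_left_mono) auto
      then have "\<phi> (10 * (1/2) ^ m) \<le> ennreal (\<epsilon> * measure (\<nu> R) (ball z ((1/2) ^ m)))"
        using m1[of m] m(1) by (auto simp: k_def intro: order_trans ennreal_leI)
      also have "\<dots> = ennreal \<epsilon> * emeasure (\<nu> R) (ball z ((1/2) ^ m))"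
        using \<epsilon> by (simp add: ennreal_mult finite_measure.emeasure_eq_measure[OF fin])
      finally show "\<exists>m\<ge>m0. \<phi> (10 * (1/2) ^ m) \<le> ennreal \<epsilon> * emeasure (\<nu> R) (ball z ((1/2) ^ m))"
        using m(1) by (intro exI[of _ m]) (auto simp: k_def)
    qed
    then show "hausdorff_gauge \<phi> E = 0"
      unfolding E_def by (rule hausdorff_gauge_UN_eq_0[OF subset_refl])
  qed
qed

end
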